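(* Let $0<\alpha<2$, $H>0$, $0<H'<1$, and let $(\tau^{H'}_t)_{t\in\mathbb{R}}$ be a fractional Brownian motion with Hurst parameter $H'$ defined on a probability space $(\Omega',\mathcal{F}',\mathbf{P}')$. Let $a,b\ge 0$ be such that $\|f_{\alpha,H}(a,b;1,\cdot)\|_{\alpha}=1$, where $$f_{\alpha,H}(a,b;s,x):=a\left((s-x)_+^{H-1/\alpha}-(-x)_+^{H-1/\alpha}\right)+b\left((s-x)_-^{H-1/\alpha}-(-x)_-^{H-1/\alpha}\right),\quad s,x\in\mathbb{R}.$$ Let $M_\alpha$ be a symmetric $\alpha$-stable random measure on $\Omega'\times\mathbb{R}$ with control measure $\mathbf{P}'\times\mathrm{Leb}$. Then the random-time linear fractional stable motion $$X_t=\int_{\Omega'\times\mathbb{R}}f_{\alpha,H}\big(a,b;\tau^{H'}_t(\omega'),x\big)\,M_\alpha(d\omega',dx)$$ is null-conservative.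
   Context: Here $\|h\|_\alpha=(\int_{\mathbb{R}}|h(x)|^\alpha dx)^{1/\alpha}$; $u_+=\max(u,0)$, $u_-=\max(-u,0)$; $u_\pm^{p}$ is interpreted as $0$ when $u_\pm=0$ (so for $H=1/\alpha$, $u_+^0=1_{\{u>0\}}$ and $u_-^0=1_{\{u<0\}}$). A fractional Brownian motion with Hurst parameter $H'$ is a centered Gaussian process with $\tau_0=0$ and $\mathbf{E}'(\tau_t-\tau_s)^2=|t-s|^{2H'}$. An S$\alpha$S random measure $M_\alpha$ with control measure $\mu$ satisfies $\mathbf{E}\exp(i\int h\,dM_\alpha)=\exp(-\int|h|^\alpha d\mu)$ for $h\in L^\alpha(\mu)$. A representation of an S$\alpha$S process $(Y_n)_{n\in\mathbb{Z}}$ is a family $\{f_n\}_{n\in\mathbb{Z}}\subset L^\alpha(E,m)$, $m$ $\sigma$-finite, such that $Y$ has the same finite-dimensional distributions as $(\int_E f_n\,dM_\alpha)_n$, where $M_\alpha$ is an S$\alpha$S random measure with control measure $m$. A nonsingular flow $\{\phi_n\}_{n\in\mathbb{Z}}$ on $(E,m)$ is a measurable family of maps of $E$ onto itself with $\phi_{n+k}=\phi_n\circ\phi_k$, $\phi_0=\mathrm{id}$, and $m\circ\phi_n^{-1}\sim m$ for all $n$. A cocycle for it is a measurable family $\{a_n\}$ with $a_{n+k}(x)=a_k(x)a_n(\phi_k(x))$ $m$-a.e. A stationary S$\alpha$S process $(Y_n)_{n\in\mathbb{Z}}$ is generated by the flow $\{\phi_n\}$ if it has a representation $$f_n(x)=a_n(x)\left(\frac{dm\circ\phi_n}{dm}(x)\right)^{1/\alpha}f_0(\phi_n(x)),\qquad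 n\in\mathbb{Z},$$ with $f_0\in L^\alpha(E,m)$, $\{a_n\}$ a $\{-1,1\}$-valued cocycle, $(E,m)$ a $\sigma$-finite standard Borel measure space, and with full support: $\mathrm{supp}\{f_n:n\in\mathbb{Z}\}=E$ (mod $m$). Every (measurable) stationary S$\alpha$S process is generated by some such flow. A nonsingular flow is conservative if there is no measurable set $W$ with $m(W)>0$ whose images $\phi_n(W)$, $n\in\mathbb{Z}$, are pairwise disjoint mod $m$. It is null if there is no nonzero finite $\phi$-invariant measure absolutely continuous with respect to $m$. A stationary S$\alpha$S process is null-conservative if it is generated by a flow which is both conservative and null (these properties do not depend on which generating flow of the process is chosen). A fractional stable motion $(X_t)_{t\in\mathbb{R}}$ (an S$\alpha$S process on $\mathbb{R}$ that is self-similar with stationary increments) is null-conservative if its increment process $(X_{n+1}-X_n)_{n\in\mathbb{Z}}$ is null-conservative. *)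

theory Defs
  imports "HOL-Probability.Probability"
begin

definition stochastic_process :: "'w measure \<Rightarrow> ('t \<Rightarrow> 'w \<Rightarrow> real) \<Rightarrow> bool" where
  "stochastic_process P X \<longleftrightarrow> prob_space P \<and> (\<forall>t. X t \<in> borel_measurable P)"

definition same_fdd ::
    "'w measure \<Rightarrow> ('t \<Rightarrow> 'w \<Rightarrow> real) \<Rightarrow> 'v measure \<Rightarrow> ('t \<Rightarrow> 'v \<Rightarrow> real) \<Rightarrow> bool" where
  "same_fdd P X Q Y \<longleftrightarrow>
     (\<forall>J. finite J \<longrightarrow>
        distr P (PiM J (\<lambda>_. borel)) (\<lambda>\<omega>. \<lambda>t\<in>J. X t \<omega>) =
        distr Q (PiM J (\<lambda>_. borel)) (\<lambda>\<omega>. \<lambda>t\<in>J. Y t \<omega>))"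

definition stationary_process :: "'w measure \<Rightarrow> (int \<Rightarrow> 'w \<Rightarrow> real) \<Rightarrow> bool" where
  "stationary_process P Y \<longleftrightarrow>
     stochastic_process P Y \<and> (\<forall>k. same_fdd P (\<lambda>n. Y (n + k)) P Y)"

text \<open>Gaussian laws are allowed to be degenerate, so that for instance \<open>\<tau> 0 = 0\<close> is admissible.\<close>

definition centered_gaussian :: "'w measure \<Rightarrow> ('w \<Rightarrow> real) \<Rightarrow> bool" where
  "centered_gaussian P Z \<longleftrightarrow> Z \<in> borel_measurable P \<and>
     (distr P borel Z = return borel 0 \<or>
      (\<exists>\<sigma>>0. distr P borel Z = density lborel (\<lambda>x. ennreal (normal_density 0 \<sigma> x))))"

definition centered_gaussian_process :: "'w measure \<Rightarrow> ('t \<Rightarrow> 'w \<Rightarrow> real) \<Rightarrow> bool" where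
  "centered_gaussian_process P X \<longleftrightarrow> stochastic_process P X \<and>
     (\<forall>J \<theta>. finite J \<longrightarrow> centered_gaussian P (\<lambda>\<omega>. \<Sum>t\<in>J. \<theta> t * X t \<omega>))"

definition fractional_brownian_motion :: "'w measure \<Rightarrow> real \<Rightarrow> (real \<Rightarrow> 'w \<Rightarrow> real) \<Rightarrow> bool" where
  "fractional_brownian_motion P H \<tau> \<longleftrightarrow> centered_gaussian_process P \<tau> \<and>
     (AE \<omega> in P. \<tau> 0 \<omega> = 0) \<and>
     (\<forall>s t. (\<integral>\<omega>. (\<tau> t \<omega> - \<tau> s \<omega>)\<^sup>2 \<partial>P) = \<bar>t - s\<bar> powr (2 * H))"

definition sas_variable :: "real \<Rightarrow> 'w measure \<Rightarrow> ('w \<Rightarrow> real) \<Rightarrow> bool" where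
  "sas_variable \<alpha> P Z \<longleftrightarrow> Z \<in> borel_measurable P \<and>
     (\<exists>\<sigma>\<ge>0. \<forall>u. char (distr P borel Z) u =
        complex_of_real (exp (- (\<sigma> powr \<alpha> * \<bar>u\<bar> powr \<alpha>))))"

definition sas_process :: "real \<Rightarrow> 'w measure \<Rightarrow> ('t \<Rightarrow> 'w \<Rightarrow> real) \<Rightarrow> bool" where
  "sas_process \<alpha> P X \<longleftrightarrow> stochastic_process P X \<and>
     (\<forall>J \<theta>. finite J \<longrightarrow> sas_variable \<alpha> P (\<lambda>\<omega>. \<Sum>t\<in>J. \<theta> t * X t \<omega>))"

definition Lalpha :: "real \<Rightarrow> 'e measure \<Rightarrow> ('e \<Rightarrow> real) set" where
  "Lalpha \<alpha> m = {h \<in> borel_measurable m. integrable m (\<lambda>x. \<bar>h x\<bar> powr \<alpha>)}"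

text \<open>Because the Bochner integral of a non-integrable function is \<open>0\<close>, a positive value of
  \<open>Lalpha_norm\<close> on a measurable function entails membership in \<open>Lalpha\<close>.\<close>

definition Lalpha_norm :: "real \<Rightarrow> 'e measure \<Rightarrow> ('e \<Rightarrow> real) \<Rightarrow> real" where
  "Lalpha_norm \<alpha> m h = (\<integral>x. \<bar>h x\<bar> powr \<alpha> \<partial>m) powr (1 / \<alpha>)"

text \<open>An S\<open>\<alpha>\<close>S random measure is an independently scattered, almost surely
  \<open>\<sigma>\<close>-additive set function on the sets of finite control measure. Its values on the other
  sets are irrelevant.\<close>

definition sas_random_measure ::
    "real \<Rightarrow> 'w measure \<Rightarrow> 'e measure \<Rightarrow> ('e set \<Rightarrow> 'w \<Rightarrow> real) \<Rightarrow> bool" where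
  "sas_random_measure \<alpha> P m M \<longleftrightarrow> prob_space P \<and>
     (\<forall>A\<in>sets m. emeasure m A < \<infinity> \<longrightarrow>
        M A \<in> borel_measurable P \<and>
        (\<forall>u. char (distr P borel (M A)) u =
           complex_of_real (exp (- (measure m A * \<bar>u\<bar> powr \<alpha>))))) \<and>
     (\<forall>(A :: nat \<Rightarrow> 'e set) n.
        (\<forall>i<n. A i \<in> sets m \<and> emeasure m (A i) < \<infinity>) \<and> disjoint_family_on A {..<n} \<longrightarrow>
        prob_space.indep_vars P (\<lambda>_. borel) (\<lambda>i. M (A i)) {..<n}) \<and>
     (\<forall>A :: nat \<Rightarrow> 'e set.
        (\<forall>i. A i \<in> sets m) \<and> emeasure m (\<Union>i. A i) < \<infinity> \<and> disjoint_family A \<longrightarrow>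
        (AE \<omega> in P. (\<lambda>i. M (A i) \<omega>) sums M (\<Union>i. A i) \<omega>))"

definition simple_integrand :: "'e measure \<Rightarrow> ('e \<Rightarrow> real) \<Rightarrow> bool" where
  "simple_integrand m s \<longleftrightarrow>
     simple_function m s \<and> emeasure m {x\<in>space m. s x \<noteq> 0} < \<infinity>"

definition simple_stable_integral ::
    "'e measure \<Rightarrow> ('e set \<Rightarrow> 'w \<Rightarrow> real) \<Rightarrow> ('e \<Rightarrow> real) \<Rightarrow> 'w \<Rightarrow> real" where
  "simple_stable_integral m M s \<omega> =
     (\<Sum>c\<in>s ` space m - {0}. c * M {x\<in>space m. s x = c} \<omega>)"

text \<open>\<open>has_stable_integral \<alpha> P m M h Z\<close>: the random variable \<open>Z\<close> is a version of
  \<open>\<integral>h dM\<close>, i.e.\ the limit in probability of the integrals of simple functions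
  approximating \<open>h\<close> in \<open>L\<^sup>\<alpha>(m)\<close>. It determines \<open>Z\<close> only almost surely, which is why the
  integral is a relation rather than a function.\<close>

definition has_stable_integral ::
    "real \<Rightarrow> 'w measure \<Rightarrow> 'e measure \<Rightarrow> ('e set \<Rightarrow> 'w \<Rightarrow> real) \<Rightarrow>
     ('e \<Rightarrow> real) \<Rightarrow> ('w \<Rightarrow> real) \<Rightarrow> bool" where
  "has_stable_integral \<alpha> P m M h Z \<longleftrightarrow>
     h \<in> Lalpha \<alpha> m \<and> Z \<in> borel_measurable P \<and>
     (\<exists>s :: nat \<Rightarrow> 'e \<Rightarrow> real.
        (\<forall>k. simple_integrand m (s k)) \<and>
        (\<lambda>k. \<integral>\<^sup>+x. ennreal (\<bar>s k x - h x\<bar> powr \<alpha>) \<partial>m) \<longlonglongrightarrow> 0 \<and>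
        (\<forall>\<epsilon>>0. (\<lambda>k. measure P
           {\<omega>\<in>space P. \<bar>simple_stable_integral m M (s k) \<omega> - Z \<omega>\<bar> > \<epsilon>}) \<longlonglongrightarrow> 0))"

text \<open>In the next definition the random measure is required to live on a probability space over
  the same type as that of \<open>Y\<close>. This costs no generality for the representations with full support
  used below: if \<open>Y\<close> is not identically zero, then stable laws being non-atomic, \<open>'w\<close> has at least
  the cardinality of the continuum, which is all that is needed to carry a random measure over a
  standard Borel control space; if \<open>Y\<close> is zero, full support forces \<open>m = 0\<close>.\<close>

definition sas_representation ::
    "real \<Rightarrow> 'w measure \<Rightarrow> (int \<Rightarrow> 'w \<Rightarrow> real) \<Rightarrow> 'e measure \<Rightarrow> (int \<Rightarrow> 'e \<Rightarrow> real) \<Rightarrow> bool" where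
  "sas_representation \<alpha> P Y m f \<longleftrightarrow>
     sigma_finite_measure m \<and> (\<forall>n. f n \<in> Lalpha \<alpha> m) \<and>
     (\<exists>(Q :: 'w measure) M Z. sas_random_measure \<alpha> Q m M \<and>
        (\<forall>n. has_stable_integral \<alpha> Q m M (f n) (Z n)) \<and> same_fdd P Y Q Z)"

definition standard_borel :: "'e measure \<Rightarrow> bool" where
  "standard_borel m \<longleftrightarrow>
     (\<exists>T. completely_metrizable_space T \<and> second_countable T \<and> topspace T = space m \<and>
        sets m = sigma_sets (topspace T) {U. openin T U})"

definition nonsingular_flow :: "'e measure \<Rightarrow> (int \<Rightarrow> 'e \<Rightarrow> 'e) \<Rightarrow> bool" where
  "nonsingular_flow m \<phi> \<longleftrightarrow>
     (\<forall>n. \<phi> n \<in> measurable m m \<and> \<phi> n ` space m = space m) \<and>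
     (\<forall>x\<in>space m. \<phi> 0 x = x) \<and>
     (\<forall>n k. \<forall>x\<in>space m. \<phi> (n + k) x = \<phi> n (\<phi> k x)) \<and>
     (\<forall>n. absolutely_continuous m (distr m m (\<phi> n)) \<and>
          absolutely_continuous (distr m m (\<phi> n)) m)"

definition sign_cocycle :: "'e measure \<Rightarrow> (int \<Rightarrow> 'e \<Rightarrow> 'e) \<Rightarrow> (int \<Rightarrow> 'e \<Rightarrow> real) \<Rightarrow> bool" where
  "sign_cocycle m \<phi> a \<longleftrightarrow>
     (\<forall>n. a n \<in> borel_measurable m \<and> (\<forall>x\<in>space m. a n x \<in> {-1, 1})) \<and>
     (\<forall>n k. AE x in m. a (n + k) x = a k x * a n (\<phi> k x))"

text \<open>\<open>m \<circ> \<phi>\<^sub>n\<close> is the measure \<open>A \<mapsto> m (\<phi>\<^sub>n(A))\<close>, i.e.\ the image of \<open>m\<close> under the inverse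
  \<open>\<phi>\<^sub>-\<^sub>n\<close> of \<open>\<phi>\<^sub>n\<close>.\<close>

definition flow_derivative :: "'e measure \<Rightarrow> (int \<Rightarrow> 'e \<Rightarrow> 'e) \<Rightarrow> int \<Rightarrow> 'e \<Rightarrow> real" where
  "flow_derivative m \<phi> n x = enn2real (RN_deriv m (distr m m (\<phi> (- n))) x)"

definition generated_by_flow ::
    "real \<Rightarrow> 'w measure \<Rightarrow> (int \<Rightarrow> 'w \<Rightarrow> real) \<Rightarrow> 'e measure \<Rightarrow> (int \<Rightarrow> 'e \<Rightarrow> 'e) \<Rightarrow> bool" where
  "generated_by_flow \<alpha> P Y m \<phi> \<longleftrightarrow>
     sigma_finite_measure m \<and> standard_borel m \<and> nonsingular_flow m \<phi> \<and>
     (\<exists>a f. sign_cocycle m \<phi> a \<and> sas_representation \<alpha> P Y m f \<and>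
        (\<forall>n. AE x in m. f n x = a n x * flow_derivative m \<phi> n x powr (1 / \<alpha>) * f 0 (\<phi> n x)) \<and>
        (AE x in m. \<exists>n. f n x \<noteq> 0))"

definition conservative_flow :: "'e measure \<Rightarrow> (int \<Rightarrow> 'e \<Rightarrow> 'e) \<Rightarrow> bool" where
  "conservative_flow m \<phi> \<longleftrightarrow>
     \<not> (\<exists>W\<in>sets m. emeasure m W > 0 \<and>
          (\<forall>n k. n \<noteq> k \<longrightarrow> emeasure m (\<phi> n ` W \<inter> \<phi> k ` W) = 0))"

definition null_flow :: "'e measure \<Rightarrow> (int \<Rightarrow> 'e \<Rightarrow> 'e) \<Rightarrow> bool" where
  "null_flow m \<phi> \<longleftrightarrow>
     \<not> (\<exists>\<nu>. sets \<nu> = sets m \<and> finite_measure \<nu> \<and> emeasure \<nu> (space \<nu>) > 0 \<and>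
          absolutely_continuous m \<nu> \<and> (\<forall>n. distr \<nu> \<nu> (\<phi> n) = \<nu>))"

text \<open>Every standard Borel space has at most the cardinality of the continuum, so letting the
  points of the flow space be of type \<^typ>\<open>int \<Rightarrow> real\<close> is no restriction; neither the
  underlying set nor its \<open>\<sigma>\<close>-algebra is tied to that type's own Borel structure.\<close>

definition null_conservative_process :: "real \<Rightarrow> 'w measure \<Rightarrow> (int \<Rightarrow> 'w \<Rightarrow> real) \<Rightarrow> bool" where
  "null_conservative_process \<alpha> P Y \<longleftrightarrow>
     sas_process \<alpha> P Y \<and> stationary_process P Y \<and>
     (\<exists>(m :: (int \<Rightarrow> real) measure) \<phi>.
        generated_by_flow \<alpha> P Y m \<phi> \<and> conservative_flow m \<phi> \<and> null_flow m \<phi>)"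

definition self_similar :: "'w measure \<Rightarrow> (real \<Rightarrow> 'w \<Rightarrow> real) \<Rightarrow> real \<Rightarrow> bool" where
  "self_similar P X \<kappa> \<longleftrightarrow>
     (\<forall>c>0. same_fdd P (\<lambda>t. X (c * t)) P (\<lambda>t \<omega>. c powr \<kappa> * X t \<omega>))"

definition stationary_increments :: "'w measure \<Rightarrow> (real \<Rightarrow> 'w \<Rightarrow> real) \<Rightarrow> bool" where
  "stationary_increments P X \<longleftrightarrow>
     (\<forall>s. same_fdd P (\<lambda>t \<omega>. X (t + s) \<omega> - X s \<omega>) P (\<lambda>t \<omega>. X t \<omega> - X 0 \<omega>))"

definition fractional_stable_motion :: "real \<Rightarrow> 'w measure \<Rightarrow> (real \<Rightarrow> 'w \<Rightarrow> real) \<Rightarrow> bool" where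
  "fractional_stable_motion \<alpha> P X \<longleftrightarrow>
     sas_process \<alpha> P X \<and> (\<exists>\<kappa>>0. self_similar P X \<kappa>) \<and> stationary_increments P X"

definition null_conservative_fsm :: "real \<Rightarrow> 'w measure \<Rightarrow> (real \<Rightarrow> 'w \<Rightarrow> real) \<Rightarrow> bool" where
  "null_conservative_fsm \<alpha> P X \<longleftrightarrow>
     fractional_stable_motion \<alpha> P X \<and>
     null_conservative_process \<alpha> P
       (\<lambda>(n :: int) \<omega>. X (of_int (n + 1)) \<omega> - X (of_int n) \<omega>)"

text \<open>Since \<open>0 powr p = 0\<close> for every \<open>p\<close>, including \<open>p = 0\<close>, the powers of positive and negative
  parts below vanish where the part does; for \<open>p = 0\<close> they are the indicators of \<open>{u > 0}\<close> and
  \<open>{u < 0}\<close>.\<close>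

definition pos_part_powr :: "real \<Rightarrow> real \<Rightarrow> real" where
  "pos_part_powr u p = max u 0 powr p"

definition neg_part_powr :: "real \<Rightarrow> real \<Rightarrow> real" where
  "neg_part_powr u p = max (- u) 0 powr p"

definition lfsm_kernel :: "real \<Rightarrow> real \<Rightarrow> real \<Rightarrow> real \<Rightarrow> real \<Rightarrow> real \<Rightarrow> real" where
  "lfsm_kernel \<alpha> H a b s x =
     a * (pos_part_powr (s - x) (H - 1 / \<alpha>) - pos_part_powr (- x) (H - 1 / \<alpha>)) +
     b * (neg_part_powr (s - x) (H - 1 / \<alpha>) - neg_part_powr (- x) (H - 1 / \<alpha>))"

end

theory Submission
  imports Defs
begin

text \<open>Write the kernel as \<open>K (s - x) - K (- x)\<close> and start the fractional Brownian motion from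
  Lebesgue measure: the image \<open>\<mu>\<close> of \<open>P' \<otimes> lborel\<close> under
  \<open>(\<omega>, x) \<mapsto> (\<tau>\<^sub>n \<omega> - x)\<^sub>n\<close> is a \<open>\<sigma>\<close>-finite measure on \<open>\<real>\<^sup>\<int>\<close>, invariant under the shift because
  the increments of \<open>\<tau>\<close> are stationary and Lebesgue measure is translation invariant. The increment
  process is represented by \<open>w \<mapsto> K (w (n + 1)) - K (w n)\<close> with respect to the image of the given
  random measure, so the shift (with trivial cocycle) generates it.

  The shift is conservative since \<open>\<tau>\<^sub>n = o(n)\<close> in probability, and null since
  \<open>\<bar>\<tau>\<^sub>n\<bar> \<rightarrow> \<infinity>\<close> in probability. Nullity also gives full support: the
  paths on which all increments of \<open>K\<close> vanish are covered by countably many invariant sets of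
  finite measure.\<close>

section \<open>Characteristic functions and joint laws\<close>

text \<open>The integrals are known only as limits in probability, so nothing about \<open>X\<close>
  can be argued pathwise. Every law is read off from characteristic functions, which depend on a
  kernel only through the integral of its \<alpha>-th power. Equality of processes becomes equality
  of such integrals for all linear combinations, at the price of passing from scalar characteristic
  functions to joint laws and of handling exponents below 1, where no triangle inequality holds.
  Under \<open>P'\<close> alone the path is pinned to 0 at time 0, so its law cannot be
  shift-invariant; the variable \<open>x\<close>, already present in the control measure, serves as
  a Lebesgue-distributed starting point and removes the pin. Estimates under \<open>\<mu>\<close>
  localise to strips |w 0| \<le> R of measure 2 R, where they concern one Gaussian increment over n
  steps, of standard deviation n^H': \<open>H' < 1\<close> makes it small against n,
  \<open>H' > 0\<close> makes it diverge. Full support cannot rest on bounded level sets alone: for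
  H = 1/\<alpha> the function K takes just the values \<open>a\<close> and \<open>b\<close> off 0.
  There the change of sign of almost every path decides, since the normalisation forces
  \<open>a\<close> and \<open>b\<close> to differ.\<close>

lemma (in prob_space) weighted_law:
  fixes Z w :: "'a \<Rightarrow> real"
  assumes [measurable]: "Z \<in> borel_measurable M" "w \<in> borel_measurable M"
    and w: "\<And>x. x \<in> space M \<Longrightarrow> 0 \<le> w x" "integrable M w" and c: "(\<integral>x. w x \<partial>M) = c" "c > 0"
  defines "N \<equiv> distr (density M (\<lambda>x. ennreal (w x / c))) borel Z"
  shows "real_distribution N"
    and "char N u = (\<integral>x. complex_of_real (w x) * iexp (u * Z x) \<partial>M) / complex_of_real c"
    and "A \<in> sets borel \<Longrightarrow> measure N A = (\<integral>x. w x * indicator A (Z x) \<partial>M) / c"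
proof -
  have wn: "AE x in M. 0 \<le> w x / c" using w c by auto
  have int: "integrable M (\<lambda>x. w x / c)" using w by auto
  have 1: "emeasure (density M (\<lambda>x. ennreal (w x / c))) (space M) = 1"
    using w c by (simp add: emeasure_density nn_integral_eq_integral[OF int wn] cong: nn_integral_cong)
  interpret D: prob_space "density M (\<lambda>x. ennreal (w x / c))"
    by standard (use 1 in simp)
  show "real_distribution N" unfolding N_def by (rule D.real_distribution_distr) simp
  have "char N u = (\<integral>x. iexp (u * Z x) \<partial>density M (\<lambda>x. ennreal (w x / c)))"
    unfolding N_def char_def by (subst integral_distr) auto
  also have "\<dots> = (\<integral>x. (w x / c) *\<^sub>R iexp (u * Z x) \<partial>M)"
    by (rule integral_density) (use wn in auto)
  also have "\<dots> = (\<integral>x. (complex_of_real (w x) * iexp (u * Z x)) / complex_of_real c \<partial>M)"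
    by (intro Bochner_Integration.integral_cong) (auto simp: scaleR_conv_of_real)
  finally show "char N u = (\<integral>x. complex_of_real (w x) * iexp (u * Z x) \<partial>M) / complex_of_real c" by simp
  assume A[measurable]: "A \<in> sets borel"
  have "measure N A = (\<integral>x. indicator A x \<partial>N)"
    using A by (simp add: N_def)
  also have "\<dots> = (\<integral>x. indicator A (Z x) \<partial>density M (\<lambda>x. ennreal (w x / c)))"
    unfolding N_def by (subst integral_distr) auto
  also have "\<dots> = (\<integral>x. (w x / c) *\<^sub>R indicator A (Z x) \<partial>M)"
    by (rule integral_density) (use wn in auto)
  finally show "measure N A = (\<integral>x. w x * indicator A (Z x) \<partial>M) / c" by simp
qed

text \<open>Divided by its total mass, a bounded nonnegative weight is a probability density, so
  Levy uniqueness applies to the tilted law of \<open>Z\<close>.\<close>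

lemma weighted_char_uniqueness:
  fixes Z w :: "'a \<Rightarrow> real" and Z' w' :: "'b \<Rightarrow> real"
  assumes P: "prob_space P" and Q: "prob_space Q"
    and m: "Z \<in> borel_measurable P" "w \<in> borel_measurable P"
    "Z' \<in> borel_measurable Q" "w' \<in> borel_measurable Q"
    and b: "\<And>x. x \<in> space P \<Longrightarrow> 0 \<le> w x \<and> w x \<le> C" "\<And>x. x \<in> space Q \<Longrightarrow> 0 \<le> w' x \<and> w' x \<le> C"
    and eq: "\<And>u. (\<integral>x. complex_of_real (w x) * iexp (u * Z x) \<partial>P) =
                 (\<integral>x. complex_of_real (w' x) * iexp (u * Z' x) \<partial>Q)"
    and A: "A \<in> sets borel"
  shows "(\<integral>x. w x * indicator A (Z x) \<partial>P) = (\<integral>x. w' x * indicator A (Z' x) \<partial>Q)"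
proof -
  interpret P: prob_space P by fact
  interpret Q: prob_space Q by fact
  note m[measurable] A[measurable]
  have iP: "integrable P w" by (rule P.integrable_const_bound[of _ C]) (use b in auto)
  have iQ: "integrable Q w'" by (rule Q.integrable_const_bound[of _ C]) (use b in auto)
  \<comment> \<open>At \<open>u = 0\<close> the hypothesis compares the total masses, so one
    constant normalises both weights.\<close>
  have c: "(\<integral>x. w x \<partial>P) = (\<integral>x. w' x \<partial>Q)"
    using eq[of 0] by (simp add: integral_complex_of_real del: of_real_eq_iff flip: of_real_eq_iff[where 'a=complex])
  have c0: "(\<integral>x. w x \<partial>P) \<ge> 0" using b by (intro integral_nonneg_AE) auto
  show ?thesis
  proof (cases "(\<integral>x. w x \<partial>P) = 0")
    case True
    \<comment> \<open>Zero mass cannot be normalised, but then both weights vanish almost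
      everywhere.\<close>
    have "AE x in P. w x = 0" using iP True b by (subst integral_nonneg_eq_0_iff_AE[symmetric]) auto
    then have 1: "(\<integral>x. w x * indicator A (Z x) \<partial>P) = 0" by (intro integral_eq_zero_AE) auto
    have "AE x in Q. w' x = 0" using iQ True c b by (subst integral_nonneg_eq_0_iff_AE[symmetric]) auto
    then have 2: "(\<integral>x. w' x * indicator A (Z' x) \<partial>Q) = 0" by (intro integral_eq_zero_AE) auto
    show ?thesis using 1 2 by simp
  next
    case False
    define c where "c = (\<integral>x. w x \<partial>P)"
    have cc: "c > 0" "(\<integral>x. w x \<partial>P) = c" "(\<integral>x. w' x \<partial>Q) = c" using False c0 c by (auto simp: c_def)
    note WP = P.weighted_law[OF m(1,2) _ iP cc(2,1)]
    note WQ = Q.weighted_law[OF m(3,4) _ iQ cc(3,1)]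
    have "char (distr (density P (\<lambda>x. ennreal (w x / c))) borel Z) = char (distr (density Q (\<lambda>x. ennreal (w' x / c))) borel Z')"
      using b by (intro ext) (simp add: WP(2) WQ(2) eq[simplified])
    then have "distr (density P (\<lambda>x. ennreal (w x / c))) borel Z = distr (density Q (\<lambda>x. ennreal (w' x / c))) borel Z'"
      using b by (intro Levy_uniqueness[OF WP(1) WQ(1)]) auto
    then show ?thesis using WP(3)[OF _ A] WQ(3)[OF _ A] b cc by simp
  qed
qed

text \<open>An exponential factor is a complex weight, whereas a density has to be nonnegative.
  Hence the decomposition exp(iL) = (1 + cos L) + i (1 + sin L) - (1 + i), whose three weights are
  nonnegative. Euler's formulas express their transforms by the multiples 0, 1 and -1 of
  \<open>L\<close> in the phase, that is, by pure exponentials again.\<close>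

lemma trig_weight_integral:
  fixes Z w L :: "'a \<Rightarrow> real"
  assumes P: "prob_space P"
    and m: "Z \<in> borel_measurable P" "w \<in> borel_measurable P" "L \<in> borel_measurable P"
    and b: "\<And>x. x \<in> space P \<Longrightarrow> 0 \<le> w x \<and> w x \<le> 1"
  defines "F \<equiv> \<lambda>s u. (\<integral>x. complex_of_real (w x) * iexp (s * L x + u * Z x) \<partial>P)"
  shows "(\<integral>x. complex_of_real (w x * (1 + cos (L x))) * iexp (u * Z x) \<partial>P) = F 0 u + (F 1 u + F (-1) u) / 2"
    and "(\<integral>x. complex_of_real (w x * (1 + sin (L x))) * iexp (u * Z x) \<partial>P) = F 0 u + (F 1 u - F (-1) u) / (2 * \<i>)"
    and "A \<in> sets borel \<Longrightarrow> (\<integral>x. complex_of_real (w x * indicator A (Z x)) * iexp (L x) \<partial>P) =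
      complex_of_real (\<integral>x. w x * (1 + cos (L x)) * indicator A (Z x) \<partial>P)
      + \<i> * complex_of_real (\<integral>x. w x * (1 + sin (L x)) * indicator A (Z x) \<partial>P)
      - (1 + \<i>) * complex_of_real (\<integral>x. w x * indicator A (Z x) \<partial>P)"
proof -
  interpret P: prob_space P by fact
  note m[measurable]
  have int: "integrable P (\<lambda>x. complex_of_real (w x) * iexp (s * L x + u * Z x))" for s u
    by (rule P.integrable_const_bound[of _ 1]) (use b in \<open>auto simp: norm_mult norm_exp_i_times\<close>)
  have int1: "integrable P (\<lambda>x. complex_of_real (w x) * iexp (u * Z x))" for u
    using int[of 0 u] by simp
  have int2: "integrable P (\<lambda>x. complex_of_real (w x) * iexp (L x + u * Z x))" for u
    using int[of 1 u] by simp
  have int3: "integrable P (\<lambda>x. complex_of_real (w x) * iexp (- L x + u * Z x))" for u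
    using int[of "-1" u] by simp
  have c: "complex_of_real (w x * (1 + cos (L x))) * iexp (u * Z x) =
      complex_of_real (w x) * iexp (u * Z x) +
      (complex_of_real (w x) * iexp (L x + u * Z x) + complex_of_real (w x) * iexp (- L x + u * Z x)) / 2" for x
    by (simp add: cos_exp_eq distrib_left exp_add exp_diff exp_minus field_simps flip: cos_of_real)
  have s: "complex_of_real (w x * (1 + sin (L x))) * iexp (u * Z x) =
      complex_of_real (w x) * iexp (u * Z x) +
      (complex_of_real (w x) * iexp (L x + u * Z x) - complex_of_real (w x) * iexp (- L x + u * Z x)) / (2 * \<i>)" for x
    by (simp add: sin_exp_eq distrib_left exp_add exp_diff exp_minus field_simps flip: sin_of_real)
  show "(\<integral>x. complex_of_real (w x * (1 + cos (L x))) * iexp (u * Z x) \<partial>P) = F 0 u + (F 1 u + F (-1) u) / 2"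
    unfolding c F_def using int1[of u] int2[of u] int3[of u] by simp
  show "(\<integral>x. complex_of_real (w x * (1 + sin (L x))) * iexp (u * Z x) \<partial>P) = F 0 u + (F 1 u - F (-1) u) / (2 * \<i>)"
    unfolding s F_def using int1[of u] int2[of u] int3[of u] by simp
  assume A[measurable]: "A \<in> sets borel"
  have e: "complex_of_real (w x * indicator A (Z x)) * iexp (L x) =
      complex_of_real (w x * (1 + cos (L x)) * indicator A (Z x)) +
      \<i> * complex_of_real (w x * (1 + sin (L x)) * indicator A (Z x)) -
      (1 + \<i>) * complex_of_real (w x * indicator A (Z x))" for x
    by (simp add: exp_Euler cos_of_real sin_of_real algebra_simps)
  have w2: "w x * (1 + t) * indicator A (Z x) \<le> 2" "0 \<le> w x * (1 + t) * indicator A (Z x)"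
    if "x \<in> space P" "-1 \<le> t" "t \<le> 1" for x t
    using b[OF that(1)] that mult_mono[of "w x" 1 "1 + t" 2] by (auto simp: indicator_def)
  have i1: "integrable P (\<lambda>x. w x * (1 + cos (L x)) * indicator A (Z x))"
    by (rule P.integrable_const_bound[of _ 2]) (use w2 in auto)
  have i2: "integrable P (\<lambda>x. w x * (1 + sin (L x)) * indicator A (Z x))"
    by (rule P.integrable_const_bound[of _ 2]) (use w2 in auto)
  have i3: "integrable P (\<lambda>x. w x * indicator A (Z x))"
    by (rule P.integrable_const_bound[of _ 1]) (use b in \<open>auto simp: indicator_def\<close>)
  show "(\<integral>x. complex_of_real (w x * indicator A (Z x)) * iexp (L x) \<partial>P) =
      complex_of_real (\<integral>x. w x * (1 + cos (L x)) * indicator A (Z x) \<partial>P)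
      + \<i> * complex_of_real (\<integral>x. w x * (1 + sin (L x)) * indicator A (Z x) \<partial>P)
      - (1 + \<i>) * complex_of_real (\<integral>x. w x * indicator A (Z x) \<partial>P)"
    unfolding e using i1 i2 i3
    by (subst Bochner_Integration.integral_diff Bochner_Integration.integral_add;
        (auto simp del: of_real_mult)?)+
qed

text \<open>The joint law of finitely many coordinates is recovered from characteristic functions by
  replacing the exponential factors by indicators one coordinate at a time.\<close>

lemma char_mixed_indicators:
  fixes X :: "'t \<Rightarrow> 'a \<Rightarrow> real" and Y :: "'t \<Rightarrow> 'b \<Rightarrow> real"
  assumes P: "prob_space P" and Q: "prob_space Q"
    and mX: "\<And>t. t \<in> I \<Longrightarrow> X t \<in> borel_measurable P" and mY: "\<And>t. t \<in> I \<Longrightarrow> Y t \<in> borel_measurable Q"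
    and eq: "\<And>\<theta> J. finite J \<Longrightarrow> J \<subseteq> I \<Longrightarrow> (\<integral>x. iexp (\<Sum>t\<in>J. \<theta> t * X t x) \<partial>P) = (\<integral>x. iexp (\<Sum>t\<in>J. \<theta> t * Y t x) \<partial>Q)"
    and "finite S" "S \<subseteq> I" "finite J" "J \<subseteq> I" "J \<inter> S = {}" "\<And>i. i \<in> S \<Longrightarrow> A i \<in> sets borel"
  shows "(\<integral>x. complex_of_real (\<Prod>i\<in>S. indicator (A i) (X i x)) * iexp (\<Sum>t\<in>J. \<theta> t * X t x) \<partial>P) =
         (\<integral>x. complex_of_real (\<Prod>i\<in>S. indicator (A i) (Y i x)) * iexp (\<Sum>t\<in>J. \<theta> t * Y t x) \<partial>Q)"
  using \<open>finite S\<close> \<open>S \<subseteq> I\<close> \<open>finite J\<close> \<open>J \<subseteq> I\<close> \<open>J \<inter> S = {}\<close> \<open>\<And>i. i \<in> S \<Longrightarrow> A i \<in> sets borel\<close>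
proof (induction S arbitrary: J \<theta>)
  case empty
  then show ?case using eq by simp
next
  case (insert s S)
  define wX where "wX x = (\<Prod>i\<in>S. indicator (A i) (X i x) :: real)" for x
  define wY where "wY x = (\<Prod>i\<in>S. indicator (A i) (Y i x) :: real)" for x
  define LX where "LX x = (\<Sum>t\<in>J. \<theta> t * X t x)" for x
  define LY where "LY x = (\<Sum>t\<in>J. \<theta> t * Y t x)" for x
  have ind: "(\<lambda>x. indicator (A i) (X i x) :: real) \<in> borel_measurable P"
    "(\<lambda>x. indicator (A i) (Y i x) :: real) \<in> borel_measurable Q" if "i \<in> S" for i
  proof -
    have [measurable]: "A i \<in> sets borel" "X i \<in> borel_measurable P" "Y i \<in> borel_measurable Q"
      using insert.prems mX mY that by auto
    show "(\<lambda>x. indicator (A i) (X i x) :: real) \<in> borel_measurable P"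
      "(\<lambda>x. indicator (A i) (Y i x) :: real) \<in> borel_measurable Q" by measurable
  qed
  have [measurable]: "wX \<in> borel_measurable P" "wY \<in> borel_measurable Q"
    "LX \<in> borel_measurable P" "LY \<in> borel_measurable Q" "X s \<in> borel_measurable P" "Y s \<in> borel_measurable Q"
    "A s \<in> sets borel"
    using insert.prems mX mY unfolding wX_def wY_def LX_def LY_def
    by (auto intro!: borel_measurable_prod borel_measurable_sum borel_measurable_times ind)
  have bX: "0 \<le> wX x \<and> wX x \<le> 1" for x unfolding wX_def by (auto intro!: prod_nonneg prod_le_1)
  have bY: "0 \<le> wY x \<and> wY x \<le> 1" for x unfolding wY_def by (auto intro!: prod_nonneg prod_le_1)
  \<comment> \<open>The coordinate \<open>s\<close> is put back among the exponentials with a free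
    coefficient \<open>u\<close>, and the old phase is multiplied by \<open>r\<close>. The induction
    hypothesis is general in \<open>J\<close> and \<open>\<theta>\<close> and covers this; below
    \<open>r\<close> takes the values 0, 1 and -1.\<close>
  have F: "(\<integral>x. complex_of_real (wX x) * iexp (r * LX x + u * X s x) \<partial>P) =
           (\<integral>x. complex_of_real (wY x) * iexp (r * LY x + u * Y s x) \<partial>Q)" for r u
  proof -
    have s: "s \<notin> J" using insert.prems by auto
    have "(\<Sum>t\<in>insert s J. (if t = s then u else r * \<theta> t) * f t) = r * (\<Sum>t\<in>J. \<theta> t * f t) + u * f s" for f
      using insert.prems s by (subst sum.insert) (auto simp: sum_distrib_left mult.assoc intro!: sum.cong)
    then show ?thesis
      using insert.IH[of "insert s J" "\<lambda>t. if t = s then u else r * \<theta> t"] insert.prems insert.hyps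
      unfolding wX_def wY_def LX_def LY_def by auto
  qed
  have b2: "0 \<le> w * (1 + t) \<and> w * (1 + t) \<le> 2" if "0 \<le> w \<and> w \<le> 1" "-1 \<le> t" "t \<le> 1" for w t :: real
    using that mult_mono[of w 1 "1 + t" 2] by auto
  have b3: "0 \<le> w * (1 + t)" if "0 \<le> w \<and> w \<le> 1" "-1 \<le> t" for w t :: real
    using that by auto
  have F0: "(\<integral>x. complex_of_real (wX x) * iexp (u * X s x) \<partial>P) =
           (\<integral>x. complex_of_real (wY x) * iexp (u * Y s x) \<partial>Q)" for u
    using F[of 0 u] by simp
  have 1: "(\<integral>x. wX x * indicator (A s) (X s x) \<partial>P) = (\<integral>x. wY x * indicator (A s) (Y s x) \<partial>Q)"
    by (rule weighted_char_uniqueness[OF P Q, where C=1]) (use bX bY F0 in auto)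
  have mm: "X s \<in> borel_measurable P" "wX \<in> borel_measurable P" "LX \<in> borel_measurable P"
    "Y s \<in> borel_measurable Q" "wY \<in> borel_measurable Q" "LY \<in> borel_measurable Q"
    by measurable
  note tP = trig_weight_integral[OF P mm(1-3) bX] and tQ = trig_weight_integral[OF Q mm(4-6) bY]
  have 2: "(\<integral>x. wX x * (1 + cos (LX x)) * indicator (A s) (X s x) \<partial>P) =
           (\<integral>x. wY x * (1 + cos (LY x)) * indicator (A s) (Y s x) \<partial>Q)"
  proof (rule weighted_char_uniqueness[OF P Q, where C=2])
    fix u
    show "(\<integral>x. complex_of_real (wX x * (1 + cos (LX x))) * iexp (u * X s x) \<partial>P) =
          (\<integral>x. complex_of_real (wY x * (1 + cos (LY x))) * iexp (u * Y s x) \<partial>Q)"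
      by (simp only: tP(1) tQ(1) F)
  qed (use bX bY b2 in \<open>auto intro!: b3\<close>)
  have 3: "(\<integral>x. wX x * (1 + sin (LX x)) * indicator (A s) (X s x) \<partial>P) =
           (\<integral>x. wY x * (1 + sin (LY x)) * indicator (A s) (Y s x) \<partial>Q)"
  proof (rule weighted_char_uniqueness[OF P Q, where C=2])
    fix u
    show "(\<integral>x. complex_of_real (wX x * (1 + sin (LX x))) * iexp (u * X s x) \<partial>P) =
          (\<integral>x. complex_of_real (wY x * (1 + sin (LY x))) * iexp (u * Y s x) \<partial>Q)"
      by (simp only: tP(2) tQ(2) F)
  qed (use bX bY b2 in \<open>auto intro!: b3\<close>)
  \<comment> \<open>The three real identities recombine to an identity in which \<open>s\<close>
    carries an indicator instead of an exponential.\<close>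
  have "(\<integral>x. complex_of_real (wX x * indicator (A s) (X s x)) * iexp (LX x) \<partial>P) =
        (\<integral>x. complex_of_real (wY x * indicator (A s) (Y s x)) * iexp (LY x) \<partial>Q)"
    by (simp only: tP(3) tQ(3) 1 2 3 \<open>A s \<in> sets borel\<close>)
  then show ?case using insert.hyps unfolding wX_def wY_def LX_def LY_def by (simp add: mult.commute)
qed

text \<open>Cramer-Wold device. The argument 1 suffices because \<open>\<theta>\<close> ranges over
  all coefficients, and \<open>I\<close> may be infinite because a law on a product is determined by
  boxes in finitely many coordinates.\<close>

lemma law_eqI_char:
  fixes X :: "'t \<Rightarrow> 'a \<Rightarrow> real" and Y :: "'t \<Rightarrow> 'b \<Rightarrow> real"
  assumes P: "prob_space P" and Q: "prob_space Q"
    and mX: "\<And>t. t \<in> I \<Longrightarrow> X t \<in> borel_measurable P" and mY: "\<And>t. t \<in> I \<Longrightarrow> Y t \<in> borel_measurable Q"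
    and eq: "\<And>\<theta> J. finite J \<Longrightarrow> J \<subseteq> I \<Longrightarrow> char (distr P borel (\<lambda>x. \<Sum>t\<in>J. \<theta> t * X t x)) 1 = char (distr Q borel (\<lambda>x. \<Sum>t\<in>J. \<theta> t * Y t x)) 1"
  shows "distr P (PiM I (\<lambda>_. borel)) (\<lambda>x. \<lambda>t\<in>I. X t x) = distr Q (PiM I (\<lambda>_. borel)) (\<lambda>x. \<lambda>t\<in>I. Y t x)"
proof (rule measure_eqI_PiM_infinite)
  have [measurable]: "(\<lambda>x. \<lambda>t\<in>I. X t x) \<in> measurable P (PiM I (\<lambda>_. borel))"
    "(\<lambda>x. \<lambda>t\<in>I. Y t x) \<in> measurable Q (PiM I (\<lambda>_. borel))"
    using mX mY by (auto intro!: measurable_restrict)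
  interpret P: prob_space P by fact
  interpret Q: prob_space Q by fact
  interpret P2: prob_space "distr P (PiM I (\<lambda>_. borel)) (\<lambda>x. \<lambda>t\<in>I. X t x)" by (rule P.prob_space_distr) simp
  show "finite_measure (distr P (PiM I (\<lambda>_. borel)) (\<lambda>x. \<lambda>t\<in>I. X t x))" by unfold_locales
  fix J A assume J: "finite J" "J \<subseteq> I" and A: "\<And>i. i \<in> J \<Longrightarrow> A i \<in> sets (borel::real measure)"
  have e: "(\<integral>x. iexp (\<Sum>t\<in>J. \<theta> t * X t x) \<partial>P) = (\<integral>x. iexp (\<Sum>t\<in>J. \<theta> t * Y t x) \<partial>Q)"
    if "finite J" "J \<subseteq> I" for \<theta> J
  proof -
    have [measurable]: "X t \<in> borel_measurable P" "Y t \<in> borel_measurable Q" if "t \<in> J" for t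
      using \<open>J \<subseteq> I\<close> mX mY that by auto
    show ?thesis using eq[OF that, of \<theta>] unfolding char_def by (simp add: integral_distr)
  qed
  have [measurable]: "prod_emb I (\<lambda>_. borel) J (Pi\<^sub>E J A) \<in> sets (PiM I (\<lambda>_. borel))"
    using J A by (auto intro!: sets_PiM_I)
  let ?B = "prod_emb I (\<lambda>_. borel) J (Pi\<^sub>E J A) :: ('t \<Rightarrow> real) set"
  have B: "indicator ?B (\<lambda>t\<in>I. f t) = (\<Prod>i\<in>J. indicator (A i) (f i) :: real)" for f
    using J by (auto simp: prod_emb_def indicator_def PiE_def Pi_def extensional_def subset_eq intro!: prod.neutral)
  have 1: "measure (distr P (PiM I (\<lambda>_. borel)) (\<lambda>x. \<lambda>t\<in>I. X t x)) ?B =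
    (\<integral>x. (\<Prod>i\<in>J. indicator (A i) (X i x)) \<partial>P)"
    unfolding B[symmetric] by (subst integral_distr[symmetric, where N="PiM I (\<lambda>_. borel)"]) auto
  have 2: "measure (distr Q (PiM I (\<lambda>_. borel)) (\<lambda>x. \<lambda>t\<in>I. Y t x)) ?B =
    (\<integral>x. (\<Prod>i\<in>J. indicator (A i) (Y i x)) \<partial>Q)"
    unfolding B[symmetric] by (subst integral_distr[symmetric, where N="PiM I (\<lambda>_. borel)"]) auto
  \<comment> \<open>All coordinates of \<open>J\<close> carry indicators and the phase is an empty
    sum, so only box probabilities remain.\<close>
  have "(\<integral>x. complex_of_real (\<Prod>i\<in>J. indicator (A i) (X i x)) * iexp (\<Sum>t\<in>{}. 0 * X t x) \<partial>P) =
     (\<integral>x. complex_of_real (\<Prod>i\<in>J. indicator (A i) (Y i x)) * iexp (\<Sum>t\<in>{}. 0 * Y t x) \<partial>Q)"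
    by (rule char_mixed_indicators[OF P Q mX mY e, where \<theta>="\<lambda>_. 0"]) (use J A in auto)
  then have "complex_of_real (\<integral>x. (\<Prod>i\<in>J. indicator (A i) (X i x)) \<partial>P) =
     complex_of_real (\<integral>x. (\<Prod>i\<in>J. indicator (A i) (Y i x)) \<partial>Q)"
    unfolding integral_complex_of_real[symmetric] by simp
  then have m: "measure (distr P (PiM I (\<lambda>_. borel)) (\<lambda>x. \<lambda>t\<in>I. X t x)) ?B =
    measure (distr Q (PiM I (\<lambda>_. borel)) (\<lambda>x. \<lambda>t\<in>I. Y t x)) ?B"
    unfolding 1 2 of_real_eq_iff .
  interpret Q2: prob_space "distr Q (PiM I (\<lambda>_. borel)) (\<lambda>x. \<lambda>t\<in>I. Y t x)" by (rule Q.prob_space_distr) simp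
  show "emeasure (distr P (PiM I (\<lambda>_. borel)) (\<lambda>x. \<lambda>t\<in>I. X t x)) (prod_emb I (\<lambda>_. borel) J (Pi\<^sub>E J A)) =
    emeasure (distr Q (PiM I (\<lambda>_. borel)) (\<lambda>x. \<lambda>t\<in>I. Y t x)) (prod_emb I (\<lambda>_. borel) J (Pi\<^sub>E J A))"
    using m by (simp add: P2.emeasure_eq_measure Q2.emeasure_eq_measure)
qed simp_all

section \<open>Gaussian processes and fractional Brownian motion\<close>

text \<open>The second moment accompanies both alternatives, so that a prescribed variance later
  decides between them and identifies \<open>\<sigma>\<close>.\<close>

lemma centered_gaussian_cases:
  assumes P: "prob_space P" and Z: "centered_gaussian P Z"
  obtains (degenerate) "distr P borel Z = return borel 0" "(\<integral>\<omega>. (Z \<omega>)\<^sup>2 \<partial>P) = 0"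
  | (normal) \<sigma> where "\<sigma> > 0" "distr P borel Z = density lborel (\<lambda>x. ennreal (normal_density 0 \<sigma> x))"
      "(\<integral>\<omega>. (Z \<omega>)\<^sup>2 \<partial>P) = \<sigma>\<^sup>2"
proof -
  have Zm[measurable]: "Z \<in> borel_measurable P" using Z by (simp add: centered_gaussian_def)
  have E: "(\<integral>\<omega>. (Z \<omega>)\<^sup>2 \<partial>P) = (\<integral>x. x\<^sup>2 \<partial>distr P borel Z)" by (simp add: integral_distr)
  consider "distr P borel Z = return borel 0"
    | \<sigma> where "\<sigma> > 0" "distr P borel Z = density lborel (\<lambda>x. ennreal (normal_density 0 \<sigma> x))"
    using Z unfolding centered_gaussian_def by blast
  then show ?thesis
  proof cases
    case 1
    then have "(\<integral>\<omega>. (Z \<omega>)\<^sup>2 \<partial>P) = 0" unfolding E by (simp add: integral_return)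
    with 1 degenerate show ?thesis by blast
  next
    case (2 \<sigma>)
    have "(\<integral>\<omega>. (Z \<omega>)\<^sup>2 \<partial>P) = (\<integral>x. normal_density 0 \<sigma> x * (x - 0) ^ (2 * 1) \<partial>lborel)"
      unfolding E 2 by (subst integral_density) (auto simp: power2_eq_square)
    also have "\<dots> = \<sigma>\<^sup>2"
      using \<open>\<sigma> > 0\<close> by (subst integral_normal_moment_even) (auto simp: fact_numeral)
    finally show ?thesis using 2 normal by blast
  qed
qed

lemma centered_gaussian_integrable:
  assumes P: "prob_space P" and Z: "centered_gaussian P Z"
  shows "integrable P (\<lambda>\<omega>. (Z \<omega>)\<^sup>2)"
proof -
  have Zm[measurable]: "Z \<in> borel_measurable P" using Z by (simp add: centered_gaussian_def)
  have "integrable (distr P borel Z) (\<lambda>x. x\<^sup>2)"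
    using P Z
  proof (cases rule: centered_gaussian_cases)
    case degenerate
    have "integrable (return borel (0::real)) (\<lambda>x. x\<^sup>2)"
      by (rule integrableI_bounded) (auto simp: nn_integral_return)
    with degenerate show ?thesis by simp
  next
    case (normal \<sigma>)
    then show ?thesis using integrable_normal_moment[of \<sigma> 0 2]
      by (simp add: integrable_density)
  qed
  then show ?thesis by (simp add: integrable_distr_eq)
qed

lemma centered_gaussian_char:
  assumes P: "prob_space P" and Z: "centered_gaussian P Z"
  shows "char (distr P borel Z) u = complex_of_real (exp (- ((\<integral>\<omega>. (Z \<omega>)\<^sup>2 \<partial>P) * u\<^sup>2 / 2)))"
  using P Z
proof (cases rule: centered_gaussian_cases)
  case degenerate
  then show ?thesis by (simp add: char_def integral_return)
next
  case (normal \<sigma>)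
  interpret prob_space P by fact
  have Zm[measurable]: "Z \<in> borel_measurable P" using Z by (simp add: centered_gaussian_def)
  have "distr P lborel Z = distr P borel Z" by (rule distr_cong) simp_all
  then have "distributed P lborel Z (normal_density 0 \<sigma>)"
    using normal by (auto simp: distributed_def)
  then have "distributed P lborel (\<lambda>x. (Z x - 0) / \<sigma>) std_normal_density"
    using normal_standard_normal_convert[OF normal(1)] by blast
  moreover have "distr P lborel (\<lambda>x. Z x / \<sigma>) = distr P borel (\<lambda>x. Z x / \<sigma>)" by (rule distr_cong) simp_all
  ultimately have s: "distr P borel (\<lambda>x. Z x / \<sigma>) = std_normal_distribution"
    by (auto simp: distributed_def)
  have "char (distr P borel Z) u = (\<integral>x. iexp (u * Z x) \<partial>P)"
    by (simp add: char_def integral_distr)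
  also have "\<dots> = (\<integral>x. iexp ((u * \<sigma>) * (Z x / \<sigma>)) \<partial>P)"
    using normal by simp
  also have "\<dots> = char (distr P borel (\<lambda>x. Z x / \<sigma>)) (u * \<sigma>)"
    unfolding char_def by (subst integral_distr) auto
  finally show ?thesis
    unfolding s char_std_normal_distribution normal(3) by (simp add: power_mult_distrib mult.commute)
qed

text \<open>A positive variance excludes the point mass. The normal density is at most 1 / (sqrt(2
  pi) v), rounded up to \<open>1 / v\<close>, and the interval has length
  \<open>2 * R\<close>.\<close>

lemma centered_gaussian_small_ball:
  assumes P: "prob_space P" and Z: "centered_gaussian P Z" and v: "(\<integral>\<omega>. (Z \<omega>)\<^sup>2 \<partial>P) = v\<^sup>2" "v > 0" and R: "R \<ge> 0"
  shows "measure P {\<omega> \<in> space P. \<bar>Z \<omega>\<bar> \<le> R} \<le> 2 * R / v"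
  using P Z
proof (cases rule: centered_gaussian_cases)
  case degenerate
  then show ?thesis using v by simp
next
  case (normal \<sigma>)
  have \<sigma>: "\<sigma> = v" using normal v by (metis power2_eq_imp_eq less_imp_le)
  interpret prob_space P by fact
  have Zm[measurable]: "Z \<in> borel_measurable P" using Z by (simp add: centered_gaussian_def)
  have "emeasure P {\<omega> \<in> space P. \<bar>Z \<omega>\<bar> \<le> R} = emeasure (distr P borel Z) {-R..R}"
    by (subst emeasure_distr) (auto intro!: arg_cong[where f="emeasure P"])
  also have "\<dots> = (\<integral>\<^sup>+x. ennreal (normal_density 0 v x) * indicator {-R..R} x \<partial>lborel)"
    unfolding normal \<sigma> by (subst emeasure_density) auto
  also have "\<dots> \<le> (\<integral>\<^sup>+x. ennreal (1 / v) * indicator {-R..R} x \<partial>lborel)"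
  proof (intro nn_integral_mono mult_right_mono ennreal_leI)
    fix x
    have "1 / sqrt (2 * pi * v\<^sup>2) \<le> 1 / v"
    proof (rule divide_left_mono)
      have "v\<^sup>2 \<le> 2 * pi * v\<^sup>2" using pi_gt3 mult_right_mono[of 1 "2 * pi" "v\<^sup>2"] by simp
      then show "v \<le> sqrt (2 * pi * v\<^sup>2)" using v by (intro real_le_rsqrt)
    qed (use v in auto)
    moreover have "1 / sqrt (2 * pi * v\<^sup>2) * exp (- (x - 0)\<^sup>2 / (2 * v\<^sup>2)) \<le> 1 / sqrt (2 * pi * v\<^sup>2) * 1"
      using v by (intro mult_left_mono) auto
    ultimately show "normal_density 0 v x \<le> 1 / v" unfolding normal_density_def by linarith
  qed simp
  also have "\<dots> = ennreal (1 / v) * ennreal (2 * R)"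
    using R by (simp add: nn_integral_cmult_indicator)
  also have "\<dots> = ennreal (2 * R / v)" using R v by (simp flip: ennreal_mult)
  finally show ?thesis using R v by (simp add: emeasure_eq_measure)
qed

text \<open>By polarization the variances of coordinates and of differences determine the variance
  of every linear combination, and with it its characteristic function. For fractional Brownian
  motion these quantities are explicit.\<close>

lemma gaussian_process_law_eqI:
  fixes X :: "'t \<Rightarrow> 'a \<Rightarrow> real" and Y :: "'t \<Rightarrow> 'b \<Rightarrow> real"
  assumes X: "centered_gaussian_process P X" and Y: "centered_gaussian_process Q Y"
    and v: "\<And>t. (\<integral>\<omega>. (X t \<omega>)\<^sup>2 \<partial>P) = (\<integral>\<omega>. (Y t \<omega>)\<^sup>2 \<partial>Q)"
    and d: "\<And>s t. (\<integral>\<omega>. (X s \<omega> - X t \<omega>)\<^sup>2 \<partial>P) = (\<integral>\<omega>. (Y s \<omega> - Y t \<omega>)\<^sup>2 \<partial>Q)"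
  shows "distr P (PiM UNIV (\<lambda>_. borel)) (\<lambda>\<omega> t. X t \<omega>) = distr Q (PiM UNIV (\<lambda>_. borel)) (\<lambda>\<omega> t. Y t \<omega>)"
proof -
  have P: "prob_space P" and Q: "prob_space Q"
    using X Y by (auto simp: centered_gaussian_process_def stochastic_process_def)
  have var: "(\<integral>\<omega>. (\<Sum>t\<in>J. \<theta> t * X t \<omega>)\<^sup>2 \<partial>P) =
     (\<Sum>s\<in>J. \<Sum>t\<in>J. \<theta> s * \<theta> t * (((\<integral>\<omega>. (X s \<omega>)\<^sup>2 \<partial>P) + (\<integral>\<omega>. (X t \<omega>)\<^sup>2 \<partial>P) - (\<integral>\<omega>. (X s \<omega> - X t \<omega>)\<^sup>2 \<partial>P)) / 2))"
    if X: "centered_gaussian_process P X" for P and X :: "'t \<Rightarrow> 'c \<Rightarrow> real" and J \<theta>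
  proof -
    have P: "prob_space P" and [measurable]: "\<And>t. X t \<in> borel_measurable P"
      using X by (auto simp: centered_gaussian_process_def stochastic_process_def)
    have g: "centered_gaussian P (X t)" for t
    proof -
      have "\<And>J \<theta>. finite J \<Longrightarrow> centered_gaussian P (\<lambda>\<omega>. \<Sum>r\<in>J. \<theta> r * X r \<omega>)"
        using X unfolding centered_gaussian_process_def by simp
      from this[of "{t}" "\<lambda>_. 1"] show ?thesis by simp
    qed
    note i = centered_gaussian_integrable[OF P g]
    have i2: "integrable P (\<lambda>\<omega>. (X s \<omega> - X t \<omega>)\<^sup>2)" for s t
    proof (rule Bochner_Integration.integrable_bound)
      show "integrable P (\<lambda>\<omega>. 2 * (X s \<omega>)\<^sup>2 + 2 * (X t \<omega>)\<^sup>2)" using i by auto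
      have "(x - y)\<^sup>2 \<le> 2 * x\<^sup>2 + 2 * y\<^sup>2" for x y :: real
        using zero_le_power2[of "x + y"] by (simp add: power2_eq_square algebra_simps)
      then show "AE x in P. norm ((X s x - X t x)\<^sup>2) \<le> norm (2 * (X s x)\<^sup>2 + 2 * (X t x)\<^sup>2)" by auto
    qed simp
    have "(\<Sum>t\<in>J. \<theta> t * X t \<omega>)\<^sup>2 =
      (\<Sum>s\<in>J. \<Sum>t\<in>J. \<theta> s * \<theta> t * (((X s \<omega>)\<^sup>2 + (X t \<omega>)\<^sup>2 - (X s \<omega> - X t \<omega>)\<^sup>2) / 2))" for \<omega>
      unfolding power2_eq_square sum_product by (intro sum.cong refl) (simp add: algebra_simps)
    then show ?thesis using i i2 by (simp add: Bochner_Integration.integral_sum)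
  qed
  have "distr P (PiM UNIV (\<lambda>_. borel)) (\<lambda>\<omega>. \<lambda>t\<in>UNIV. X t \<omega>) = distr Q (PiM UNIV (\<lambda>_. borel)) (\<lambda>\<omega>. \<lambda>t\<in>UNIV. Y t \<omega>)"
  proof (rule law_eqI_char[OF P Q])
    fix J :: "'t set" and \<theta> assume J: "finite J"
    have "centered_gaussian P (\<lambda>\<omega>. \<Sum>t\<in>J. \<theta> t * X t \<omega>)" "centered_gaussian Q (\<lambda>\<omega>. \<Sum>t\<in>J. \<theta> t * Y t \<omega>)"
      using X Y J by (auto simp: centered_gaussian_process_def)
    then show "char (distr P borel (\<lambda>x. \<Sum>t\<in>J. \<theta> t * X t x)) 1 = char (distr Q borel (\<lambda>x. \<Sum>t\<in>J. \<theta> t * Y t x)) 1"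
      by (simp add: centered_gaussian_char[OF P] centered_gaussian_char[OF Q] var[OF X] var[OF Y] v d)
  qed (use X Y in \<open>auto simp: centered_gaussian_process_def stochastic_process_def\<close>)
  then show ?thesis by (simp add: restrict_def)
qed

text \<open>One source for the Gaussian property of increments, time changes and multiples: the
  coefficients are collected over the union of the finite index sets.\<close>

lemma centered_gaussian_process_linear:
  fixes X :: "'t \<Rightarrow> 'a \<Rightarrow> real" and c :: "'s \<Rightarrow> 't \<Rightarrow> real"
  assumes X: "centered_gaussian_process P X" and F: "\<And>s. finite (F s)"
  shows "centered_gaussian_process P (\<lambda>s \<omega>. \<Sum>t\<in>F s. c s t * X t \<omega>)"
proof -
  have "centered_gaussian P (\<lambda>\<omega>. \<Sum>s\<in>J. \<theta> s * (\<Sum>t\<in>F s. c s t * X t \<omega>))" if J: "finite J" for J \<theta>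
  proof -
    define G where "G = (\<Union>s\<in>J. F s)"
    have G: "finite G" using J F by (auto simp: G_def)
    have "(\<Sum>s\<in>J. \<theta> s * (\<Sum>t\<in>F s. c s t * X t \<omega>)) = (\<Sum>t\<in>G. (\<Sum>s\<in>J. \<theta> s * (if t \<in> F s then c s t else 0)) * X t \<omega>)" for \<omega>
    proof -
      have "(\<Sum>s\<in>J. \<theta> s * (\<Sum>t\<in>F s. c s t * X t \<omega>)) = (\<Sum>s\<in>J. \<theta> s * (\<Sum>t\<in>G. (if t \<in> F s then c s t else 0) * X t \<omega>))"
        using G F by (intro sum.cong refl arg_cong2[where f="(*)"] sum.mono_neutral_cong_left) (auto simp: G_def)
      also have "\<dots> = (\<Sum>t\<in>G. (\<Sum>s\<in>J. \<theta> s * (if t \<in> F s then c s t else 0)) * X t \<omega>)"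
        unfolding sum_distrib_left sum_distrib_right by (subst sum.swap) (simp add: mult.assoc)
      finally show ?thesis .
    qed
    then show ?thesis using X G unfolding centered_gaussian_process_def by simp
  qed
  then show ?thesis using X unfolding centered_gaussian_process_def stochastic_process_def
    by (auto intro!: borel_measurable_sum borel_measurable_times)
qed

lemma fbm_second_moment:
  assumes B: "fractional_brownian_motion P H \<tau>"
  shows "(\<integral>\<omega>. (\<tau> t \<omega>)\<^sup>2 \<partial>P) = \<bar>t\<bar> powr (2 * H)"
proof -
  have [measurable]: "\<And>t. \<tau> t \<in> borel_measurable P"
    using B by (auto simp: fractional_brownian_motion_def centered_gaussian_process_def stochastic_process_def)
  have "AE \<omega> in P. \<tau> 0 \<omega> = 0" using B by (simp add: fractional_brownian_motion_def)
  then have "(\<integral>\<omega>. (\<tau> t \<omega>)\<^sup>2 \<partial>P) = (\<integral>\<omega>. (\<tau> t \<omega> - \<tau> 0 \<omega>)\<^sup>2 \<partial>P)"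
    by (intro integral_cong_AE) auto
  then show ?thesis using B by (auto simp: fractional_brownian_motion_def)
qed

lemma fbm_stationary_increments:
  assumes B: "fractional_brownian_motion P H \<tau>"
  shows "distr P (PiM UNIV (\<lambda>_. borel)) (\<lambda>\<omega> t. \<tau> (t + s) \<omega> - \<tau> s \<omega>) = distr P (PiM UNIV (\<lambda>_. borel)) (\<lambda>\<omega> t. \<tau> t \<omega>)"
proof (rule gaussian_process_law_eqI)
  have g: "centered_gaussian_process P \<tau>" using B by (simp add: fractional_brownian_motion_def)
  \<comment> \<open>For \<open>t = 0\<close> the set \<open>{t + s, s}\<close> collapses to one
    point. Writing the coefficient as a difference of indicators makes it 0 there, as it should
    be.\<close>
  have "centered_gaussian_process P (\<lambda>t \<omega>. \<Sum>r\<in>{t + s, s}. ((if r = t + s then 1 else 0) - (if r = s then 1 else 0)) * \<tau> r \<omega>)"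
    by (rule centered_gaussian_process_linear[OF g]) simp
  moreover have "(\<lambda>t \<omega>. \<Sum>r\<in>{t + s, s}. ((if r = t + s then 1 else 0) - (if r = s then 1 else 0)) * \<tau> r \<omega>) = (\<lambda>t \<omega>. \<tau> (t + s) \<omega> - \<tau> s \<omega>)"
    by (intro ext) (case_tac "t = 0", auto)
  ultimately show "centered_gaussian_process P (\<lambda>t \<omega>. \<tau> (t + s) \<omega> - \<tau> s \<omega>)" by simp
  show "centered_gaussian_process P \<tau>" by fact
  show "(\<integral>\<omega>. (\<tau> (t + s) \<omega> - \<tau> s \<omega>)\<^sup>2 \<partial>P) = (\<integral>\<omega>. (\<tau> t \<omega>)\<^sup>2 \<partial>P)" for t
    using B by (simp add: fbm_second_moment[OF B] fractional_brownian_motion_def)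
  show "(\<integral>\<omega>. (\<tau> (t + s) \<omega> - \<tau> s \<omega> - (\<tau> (u + s) \<omega> - \<tau> s \<omega>))\<^sup>2 \<partial>P) = (\<integral>\<omega>. (\<tau> t \<omega> - \<tau> u \<omega>)\<^sup>2 \<partial>P)" for t u
    using B by (simp add: fractional_brownian_motion_def)
qed

lemma fbm_self_similar:
  assumes B: "fractional_brownian_motion P H \<tau>" and c: "c > 0"
  shows "distr P (PiM UNIV (\<lambda>_. borel)) (\<lambda>\<omega> t. \<tau> (c * t) \<omega>) = distr P (PiM UNIV (\<lambda>_. borel)) (\<lambda>\<omega> t. c powr H * \<tau> t \<omega>)"
proof (rule gaussian_process_law_eqI)
  have g: "centered_gaussian_process P \<tau>" using B by (simp add: fractional_brownian_motion_def)
  show "centered_gaussian_process P (\<lambda>t. \<tau> (c * t))"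
    using centered_gaussian_process_linear[OF g, of "\<lambda>t. {c * t}" "\<lambda>_ _. 1"] by simp
  show "centered_gaussian_process P (\<lambda>t \<omega>. c powr H * \<tau> t \<omega>)"
    using centered_gaussian_process_linear[OF g, of "\<lambda>t. {t}" "\<lambda>_ _. c powr H"] by simp
  have sq: "(c powr H)\<^sup>2 = c powr (2 * H)" by (simp add: power2_eq_square flip: powr_add)
  show "(\<integral>\<omega>. (\<tau> (c * t) \<omega>)\<^sup>2 \<partial>P) = (\<integral>\<omega>. (c powr H * \<tau> t \<omega>)\<^sup>2 \<partial>P)" for t
    using c by (simp add: power_mult_distrib fbm_second_moment[OF B] abs_mult powr_mult sq)
  have "c * t - c * u = c * (t - u)" "c powr H * x - c powr H * y = c powr H * (x - y)" for t u x y
    by (simp_all add: algebra_simps)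
  then show "(\<integral>\<omega>. (\<tau> (c * t) \<omega> - \<tau> (c * u) \<omega>)\<^sup>2 \<partial>P) = (\<integral>\<omega>. (c powr H * \<tau> t \<omega> - c powr H * \<tau> u \<omega>)\<^sup>2 \<partial>P)" for t u
    using c B by (simp add: power_mult_distrib fractional_brownian_motion_def abs_mult powr_mult sq)
qed

section \<open>Convergence of stable integrals\<close>

text \<open>A substitute for the triangle inequality valid for every \<open>p > 0\<close>: either
  \<open>y\<close> is small against \<open>x\<close> and is absorbed into it, or \<open>x\<close> is
  small against \<open>y\<close>. The free \<open>\<delta>\<close> matters: the factor of the
  \<open>x\<close> term tends to 1 as \<open>\<delta>\<close> tends to 0, which yields continuity of
  the integral and not merely a bound.\<close>

lemma abs_add_powr_le:
  fixes x y \<delta> p :: real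
  assumes p: "0 < p" and \<delta>: "0 < \<delta>"
  shows "\<bar>x + y\<bar> powr p \<le> (1 + \<delta>) powr p * \<bar>x\<bar> powr p + (1 + 1 / \<delta>) powr p * \<bar>y\<bar> powr p"
proof (cases "\<bar>y\<bar> \<le> \<delta> * \<bar>x\<bar>")
  case True
  then have "\<bar>x + y\<bar> \<le> (1 + \<delta>) * \<bar>x\<bar>" by (simp add: distrib_right abs_triangle_ineq[THEN order_trans])
  then have "\<bar>x + y\<bar> powr p \<le> ((1 + \<delta>) * \<bar>x\<bar>) powr p" using p by (intro powr_mono2) auto
  then show ?thesis using \<delta> by (simp add: powr_mult add_increasing2)
next
  case False
  then have "\<bar>x\<bar> \<le> 1 / \<delta> * \<bar>y\<bar>" using \<delta> by (simp add: field_simps)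
  then have "\<bar>x + y\<bar> \<le> (1 + 1 / \<delta>) * \<bar>y\<bar>" by (simp add: distrib_right abs_triangle_ineq[THEN order_trans])
  then have "\<bar>x + y\<bar> powr p \<le> ((1 + 1 / \<delta>) * \<bar>y\<bar>) powr p" using p by (intro powr_mono2) auto
  then show ?thesis using \<delta> by (simp add: powr_mult add_increasing)
qed

lemma nn_integral_powr_add_le:
  fixes f g :: "'e \<Rightarrow> real"
  assumes p: "0 < p" and [measurable]: "f \<in> borel_measurable m" "g \<in> borel_measurable m"
  shows "(\<integral>\<^sup>+x. ennreal (\<bar>f x + g x\<bar> powr p) \<partial>m) \<le>
    ennreal (2 powr p) * ((\<integral>\<^sup>+x. ennreal (\<bar>f x\<bar> powr p) \<partial>m) + (\<integral>\<^sup>+x. ennreal (\<bar>g x\<bar> powr p) \<partial>m))"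
proof -
  have "(\<integral>\<^sup>+x. ennreal (\<bar>f x + g x\<bar> powr p) \<partial>m) \<le> (\<integral>\<^sup>+x. ennreal (2 powr p) * (ennreal (\<bar>f x\<bar> powr p) + ennreal (\<bar>g x\<bar> powr p)) \<partial>m)"
    using abs_add_powr_le[OF p, of 1]
    by (intro nn_integral_mono) (auto simp: distrib_left simp flip: ennreal_mult ennreal_plus intro!: ennreal_leI)
  also have "\<dots> = ennreal (2 powr p) * ((\<integral>\<^sup>+x. ennreal (\<bar>f x\<bar> powr p) \<partial>m) + (\<integral>\<^sup>+x. ennreal (\<bar>g x\<bar> powr p) \<partial>m))"
    by (simp add: nn_integral_cmult nn_integral_add)
  finally show ?thesis .
qed

lemma nn_integral_powr_lin_comb_tendsto_0:
  fixes f g :: "nat \<Rightarrow> 'e \<Rightarrow> real"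
  assumes p: "0 < p" and [measurable]: "\<And>k. f k \<in> borel_measurable m" "\<And>k. g k \<in> borel_measurable m"
    and f: "(\<lambda>k. \<integral>\<^sup>+x. ennreal (\<bar>f k x\<bar> powr p) \<partial>m) \<longlonglongrightarrow> 0"
    and g: "(\<lambda>k. \<integral>\<^sup>+x. ennreal (\<bar>g k x\<bar> powr p) \<partial>m) \<longlonglongrightarrow> 0"
  shows "(\<lambda>k. \<integral>\<^sup>+x. ennreal (\<bar>u * f k x + v * g k x\<bar> powr p) \<partial>m) \<longlonglongrightarrow> 0"
proof (rule tendsto_sandwich[where f="\<lambda>_. 0"])
  let ?b = "\<lambda>k. ennreal (2 powr p) * (ennreal (\<bar>u\<bar> powr p) * (\<integral>\<^sup>+x. ennreal (\<bar>f k x\<bar> powr p) \<partial>m) + ennreal (\<bar>v\<bar> powr p) * (\<integral>\<^sup>+x. ennreal (\<bar>g k x\<bar> powr p) \<partial>m))"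
  show "\<forall>\<^sub>F k in sequentially. (\<integral>\<^sup>+x. ennreal (\<bar>u * f k x + v * g k x\<bar> powr p) \<partial>m) \<le> ?b k"
  proof (intro always_eventually allI)
    fix k
    show "(\<integral>\<^sup>+x. ennreal (\<bar>u * f k x + v * g k x\<bar> powr p) \<partial>m) \<le> ?b k"
      using nn_integral_powr_add_le[OF p, of "\<lambda>x. u * f k x" m "\<lambda>x. v * g k x"]
      by (simp add: abs_mult powr_mult ennreal_mult nn_integral_cmult)
  qed
  have "?b \<longlonglongrightarrow> ennreal (2 powr p) * (ennreal (\<bar>u\<bar> powr p) * 0 + ennreal (\<bar>v\<bar> powr p) * 0)"
    by (intro ennreal_tendsto_cmult tendsto_add f g) auto
  then show "?b \<longlonglongrightarrow> 0" by simp
qed auto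

text \<open>For fixed \<open>\<delta>\<close> the error term dies out as \<open>k\<close> grows, in
  spite of its large constant; afterwards \<open>\<delta>\<close> tends to 0 and removes the factor
  \<open>(1 + \<delta>) powr p\<close>. The lower and the upper bound come from exchanging the roles
  of \<open>s k\<close> and \<open>h\<close>.\<close>

lemma integral_abs_powr_tendsto:
  fixes s :: "nat \<Rightarrow> 'e \<Rightarrow> real"
  assumes p: "0 < p" and ms[measurable]: "\<And>k. s k \<in> borel_measurable m"
    and s: "\<And>k. integrable m (\<lambda>x. \<bar>s k x\<bar> powr p)"
    and mh[measurable]: "h \<in> borel_measurable m" and h: "integrable m (\<lambda>x. \<bar>h x\<bar> powr p)"
    and lim: "(\<lambda>k. \<integral>\<^sup>+x. ennreal (\<bar>s k x - h x\<bar> powr p) \<partial>m) \<longlonglongrightarrow> 0"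
  shows "(\<lambda>k. \<integral>x. \<bar>s k x\<bar> powr p \<partial>m) \<longlonglongrightarrow> (\<integral>x. \<bar>h x\<bar> powr p \<partial>m)"
proof -
  have id: "integrable m (\<lambda>x. \<bar>s k x - h x\<bar> powr p)" for k
  proof (rule Bochner_Integration.integrable_bound)
    show "integrable m (\<lambda>x. 2 powr p * \<bar>s k x\<bar> powr p + 2 powr p * \<bar>h x\<bar> powr p)" using s h by auto
    show "AE x in m. norm (\<bar>s k x - h x\<bar> powr p) \<le> norm (2 powr p * \<bar>s k x\<bar> powr p + 2 powr p * \<bar>h x\<bar> powr p)"
      using abs_add_powr_le[OF p, of 1 "s k x" "- h x" for x] by simp
  qed simp
  define e where "e k = (\<integral>x. \<bar>s k x - h x\<bar> powr p \<partial>m)" for k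
  have e: "e \<longlonglongrightarrow> 0"
  proof -
    have "(\<lambda>k. ennreal (e k)) \<longlonglongrightarrow> ennreal 0"
      using lim nn_integral_eq_integral[OF id] by (simp add: e_def)
    then show ?thesis by (subst (asm) tendsto_ennreal_iff) (auto simp: e_def)
  qed
  define a where "a = (\<integral>x. \<bar>h x\<bar> powr p \<partial>m)"
  define b where "b k = (\<integral>x. \<bar>s k x\<bar> powr p \<partial>m)" for k
  have ab: "a \<le> (1 + \<delta>) powr p * b k + (1 + 1 / \<delta>) powr p * e k"
    and ba: "b k \<le> (1 + \<delta>) powr p * a + (1 + 1 / \<delta>) powr p * e k" if \<delta>: "\<delta> > 0" for k \<delta>
  proof -
    have "a \<le> (\<integral>x. (1 + \<delta>) powr p * \<bar>s k x\<bar> powr p + (1 + 1 / \<delta>) powr p * \<bar>s k x - h x\<bar> powr p \<partial>m)"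
      unfolding a_def using abs_add_powr_le[OF p \<delta>, of "s k x" "h x - s k x" for x] s h id
      by (intro integral_mono) (auto simp: abs_minus_commute)
    then show "a \<le> (1 + \<delta>) powr p * b k + (1 + 1 / \<delta>) powr p * e k"
      using s[of k] id[of k] by (simp add: b_def e_def)
    have "b k \<le> (\<integral>x. (1 + \<delta>) powr p * \<bar>h x\<bar> powr p + (1 + 1 / \<delta>) powr p * \<bar>s k x - h x\<bar> powr p \<partial>m)"
      unfolding b_def using abs_add_powr_le[OF p \<delta>, of "h x" "s k x - h x" for x] s h id
      by (intro integral_mono) auto
    then show "b k \<le> (1 + \<delta>) powr p * a + (1 + 1 / \<delta>) powr p * e k"
      using h id[of k] by (simp add: a_def e_def)
  qed
  have cont: "((\<lambda>\<delta>. (1 + \<delta>) powr p) \<longlongrightarrow> 1) (at_right 0)"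
    by (rule tendsto_eq_intros tendsto_powr refl | simp)+
  have "b \<longlonglongrightarrow> a"
  proof (rule order_tendstoI)
    fix y assume y: "y < a"
    have "((\<lambda>\<delta>. a / (1 + \<delta>) powr p) \<longlongrightarrow> a) (at_right 0)"
      by (rule tendsto_eq_intros cont refl | simp)+
    then have "\<forall>\<^sub>F \<delta> in at_right 0. y < a / (1 + \<delta>) powr p" using y by (rule order_tendstoD)
    moreover have "\<forall>\<^sub>F \<delta> in at_right 0. (0::real) < \<delta>" by (rule eventually_at_right_less)
    ultimately obtain \<delta> :: real where \<delta>: "y < a / (1 + \<delta>) powr p" "0 < \<delta>"
      using eventually_happens'[OF trivial_limit_at_right_real] eventually_conj by fast
    have "(\<lambda>k. (a - (1 + 1 / \<delta>) powr p * e k) / (1 + \<delta>) powr p) \<longlonglongrightarrow> (a - (1 + 1 / \<delta>) powr p * 0) / (1 + \<delta>) powr p"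
      using \<delta> by (intro tendsto_intros e) auto
    then have "\<forall>\<^sub>F k in sequentially. y < (a - (1 + 1 / \<delta>) powr p * e k) / (1 + \<delta>) powr p"
      using \<delta> by (intro order_tendstoD) auto
    then show "\<forall>\<^sub>F k in sequentially. y < b k"
    proof eventually_elim
      case (elim k)
      have "(a - (1 + 1 / \<delta>) powr p * e k) / (1 + \<delta>) powr p \<le> b k"
        using ab[OF \<delta>(2), of k] \<delta> by (simp add: field_simps)
      with elim show ?case by simp
    qed
  next
    fix y assume y: "a < y"
    have "((\<lambda>\<delta>. (1 + \<delta>) powr p * a) \<longlongrightarrow> a) (at_right 0)"
      by (rule tendsto_eq_intros cont refl | simp)+
    then have "\<forall>\<^sub>F \<delta> in at_right 0. (1 + \<delta>) powr p * a < y" using y by (rule order_tendstoD)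
    moreover have "\<forall>\<^sub>F \<delta> in at_right 0. (0::real) < \<delta>" by (rule eventually_at_right_less)
    ultimately obtain \<delta> :: real where \<delta>: "(1 + \<delta>) powr p * a < y" "0 < \<delta>"
      using eventually_happens'[OF trivial_limit_at_right_real] eventually_conj by fast
    have "(\<lambda>k. (1 + \<delta>) powr p * a + (1 + 1 / \<delta>) powr p * e k) \<longlonglongrightarrow> (1 + \<delta>) powr p * a + (1 + 1 / \<delta>) powr p * 0"
      by (intro tendsto_intros e)
    then have "\<forall>\<^sub>F k in sequentially. (1 + \<delta>) powr p * a + (1 + 1 / \<delta>) powr p * e k < y"
      using \<delta> by (intro order_tendstoD) auto
    then show "\<forall>\<^sub>F k in sequentially. b k < y"
      by eventually_elim (use ba[OF \<delta>(2)] in \<open>auto intro: le_less_trans\<close>)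
  qed
  then show ?thesis by (simp add: a_def b_def[abs_def])
qed

section \<open>Convergence in probability and characteristic functions\<close>

definition conv_in_prob :: "'w measure \<Rightarrow> (nat \<Rightarrow> 'w \<Rightarrow> real) \<Rightarrow> ('w \<Rightarrow> real) \<Rightarrow> bool" where
  "conv_in_prob P V Z \<longleftrightarrow>
     (\<forall>\<epsilon>>0. (\<lambda>k. measure P {\<omega>\<in>space P. \<bar>V k \<omega> - Z \<omega>\<bar> > \<epsilon>}) \<longlonglongrightarrow> 0)"

text \<open>The relation between \<open>W\<close>, \<open>V\<close> and \<open>V'\<close> is only
  almost sure, with an exceptional set that may depend on \<open>k\<close>, because a random measure
  is additive only almost surely.\<close>

lemma conv_in_prob_lin_comb:
  assumes P: "prob_space P"
    and m: "\<And>k. V k \<in> borel_measurable P" "\<And>k. V' k \<in> borel_measurable P"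
      "Z \<in> borel_measurable P" "Z' \<in> borel_measurable P" "\<And>k. W k \<in> borel_measurable P"
    and V: "conv_in_prob P V Z" and V': "conv_in_prob P V' Z'"
    and W: "\<And>k. AE \<omega> in P. W k \<omega> = u * V k \<omega> + v * V' k \<omega>"
  shows "conv_in_prob P W (\<lambda>\<omega>. u * Z \<omega> + v * Z' \<omega>)"
  unfolding conv_in_prob_def
proof (intro allI impI)
  fix \<epsilon> :: real assume \<epsilon>: "\<epsilon> > 0"
  interpret prob_space P by fact
  note m[measurable]
  \<comment> \<open>The summand 1 keeps the denominator positive when \<open>u\<close> and
    \<open>v\<close> are both 0.\<close>
  define \<delta> where "\<delta> = \<epsilon> / (\<bar>u\<bar> + \<bar>v\<bar> + 1)"
  have \<delta>: "\<delta> > 0" "(\<bar>u\<bar> + \<bar>v\<bar>) * \<delta> \<le> \<epsilon>"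
  proof -
    show "\<delta> > 0" unfolding \<delta>_def using \<epsilon> by (intro divide_pos_pos) auto
    then have "(\<bar>u\<bar> + \<bar>v\<bar>) * \<delta> \<le> (\<bar>u\<bar> + \<bar>v\<bar> + 1) * \<delta>" by (intro mult_right_mono) auto
    also have "\<dots> = \<epsilon>" unfolding \<delta>_def by (simp add: field_simps)
    finally show "(\<bar>u\<bar> + \<bar>v\<bar>) * \<delta> \<le> \<epsilon>" .
  qed
  let ?b = "\<lambda>k. prob {\<omega>\<in>space P. \<bar>V k \<omega> - Z \<omega>\<bar> > \<delta>} + prob {\<omega>\<in>space P. \<bar>V' k \<omega> - Z' \<omega>\<bar> > \<delta>}"
  have le: "prob {\<omega>\<in>space P. \<bar>W k \<omega> - (u * Z \<omega> + v * Z' \<omega>)\<bar> > \<epsilon>} \<le> ?b k" for k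
  proof -
    have "prob {\<omega>\<in>space P. \<bar>W k \<omega> - (u * Z \<omega> + v * Z' \<omega>)\<bar> > \<epsilon>} \<le>
       prob ({\<omega>\<in>space P. \<bar>V k \<omega> - Z \<omega>\<bar> > \<delta>} \<union> {\<omega>\<in>space P. \<bar>V' k \<omega> - Z' \<omega>\<bar> > \<delta>})"
    proof (rule finite_measure_mono_AE)
      show "AE \<omega> in P. \<omega> \<in> {\<omega>\<in>space P. \<bar>W k \<omega> - (u * Z \<omega> + v * Z' \<omega>)\<bar> > \<epsilon>} \<longrightarrow>
         \<omega> \<in> {\<omega>\<in>space P. \<bar>V k \<omega> - Z \<omega>\<bar> > \<delta>} \<union> {\<omega>\<in>space P. \<bar>V' k \<omega> - Z' \<omega>\<bar> > \<delta>}"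
        using W[of k]
      proof eventually_elim
        case (elim \<omega>)
        have "\<bar>u * V k \<omega> + v * V' k \<omega> - (u * Z \<omega> + v * Z' \<omega>)\<bar> \<le> \<epsilon>"
          if "\<bar>V k \<omega> - Z \<omega>\<bar> \<le> \<delta>" "\<bar>V' k \<omega> - Z' \<omega>\<bar> \<le> \<delta>"
        proof -
          have "u * V k \<omega> + v * V' k \<omega> - (u * Z \<omega> + v * Z' \<omega>) = u * (V k \<omega> - Z \<omega>) + v * (V' k \<omega> - Z' \<omega>)"
            by (simp add: algebra_simps)
          also have "\<bar>\<dots>\<bar> \<le> \<bar>u\<bar> * \<bar>V k \<omega> - Z \<omega>\<bar> + \<bar>v\<bar> * \<bar>V' k \<omega> - Z' \<omega>\<bar>"
            by (metis abs_mult abs_triangle_ineq)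
          also have "\<dots> \<le> \<bar>u\<bar> * \<delta> + \<bar>v\<bar> * \<delta>" using that by (intro add_mono mult_left_mono) auto
          finally show ?thesis using \<delta> by (simp add: distrib_right)
        qed
        with elim show ?case by force
      qed
    qed measurable
    also have "\<dots> \<le> ?b k" by (rule measure_Un_le) measurable
    finally show ?thesis .
  qed
  have b: "?b \<longlonglongrightarrow> 0 + 0"
    using V V' \<delta> unfolding conv_in_prob_def by (intro tendsto_add) auto
  show "(\<lambda>k. prob {\<omega>\<in>space P. \<bar>W k \<omega> - (u * Z \<omega> + v * Z' \<omega>)\<bar> > \<epsilon>}) \<longlonglongrightarrow> 0"
  proof (rule tendsto_sandwich)
    show "(\<lambda>_. 0 :: real) \<longlonglongrightarrow> 0" by (rule tendsto_const)
    show "?b \<longlonglongrightarrow> 0" using b by (simp only: add_0)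
    show "\<forall>\<^sub>F k in sequentially. prob {\<omega>\<in>space P. \<bar>W k \<omega> - (u * Z \<omega> + v * Z' \<omega>)\<bar> > \<epsilon>} \<le> ?b k"
      by (rule always_eventually, rule allI, rule le)
    show "\<forall>\<^sub>F k in sequentially. 0 \<le> prob {\<omega>\<in>space P. \<bar>W k \<omega> - (u * Z \<omega> + v * Z' \<omega>)\<bar> > \<epsilon>}"
      by (rule always_eventually, rule allI, rule measure_nonneg)
  qed
qed

text \<open>The integrands differ by at most \<open>\<bar>u\<bar> * \<delta>\<close> off the set
  where the variables are more than \<open>\<delta>\<close> apart, and by at most 2 on it.\<close>

lemma conv_in_prob_char:
  assumes P: "prob_space P" and m: "\<And>k. V k \<in> borel_measurable P" "Z \<in> borel_measurable P"
    and V: "conv_in_prob P V Z"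
  shows "(\<lambda>k. char (distr P borel (V k)) u) \<longlonglongrightarrow> char (distr P borel Z) u"
proof (rule tendstoI)
  fix e :: real assume e: "e > 0"
  interpret prob_space P by fact
  note m[measurable]
  \<comment> \<open>The tolerance is split evenly: at most \<open>e / 2\<close> off the exceptional
    set, and less than twice \<open>e / 4\<close> on it.\<close>
  define \<delta> where "\<delta> = e / (2 * (\<bar>u\<bar> + 1))"
  have \<delta>: "\<delta> > 0" "\<bar>u\<bar> * \<delta> \<le> e / 2"
  proof -
    show "\<delta> > 0" unfolding \<delta>_def using e by (intro divide_pos_pos) auto
    then have "\<bar>u\<bar> * \<delta> \<le> (\<bar>u\<bar> + 1) * \<delta>" by (intro mult_right_mono) auto
    also have "\<dots> = e / 2" unfolding \<delta>_def by (simp add: field_simps)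
    finally show "\<bar>u\<bar> * \<delta> \<le> e / 2" .
  qed
  have "\<forall>\<^sub>F k in sequentially. prob {\<omega>\<in>space P. \<bar>V k \<omega> - Z \<omega>\<bar> > \<delta>} < e / 4"
    using V \<delta> e unfolding conv_in_prob_def by (intro order_tendstoD(2)[where y=0]) auto
  then show "\<forall>\<^sub>F k in sequentially. dist (char (distr P borel (V k)) u) (char (distr P borel Z) u) < e"
  proof eventually_elim
    case (elim k)
    let ?A = "{\<omega>\<in>space P. \<bar>V k \<omega> - Z \<omega>\<bar> > \<delta>}"
    have i: "integrable P (\<lambda>x. iexp (u * Y x))" if [measurable]: "Y \<in> borel_measurable P" for Y
      by (rule integrable_const_bound[of _ 1]) auto
    have "dist (char (distr P borel (V k)) u) (char (distr P borel Z) u) =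
      norm (\<integral>x. iexp (u * V k x) - iexp (u * Z x) \<partial>P)"
      using i[of "V k"] i[of Z] by (simp add: char_def integral_distr dist_norm)
    also have "\<dots> \<le> (\<integral>x. norm (iexp (u * V k x) - iexp (u * Z x)) \<partial>P)"
      by (rule integral_norm_bound)
    also have "\<dots> \<le> (\<integral>x. \<bar>u\<bar> * \<delta> + 2 * indicator ?A x \<partial>P)"
    proof (rule integral_mono)
      show "integrable P (\<lambda>x. norm (iexp (u * V k x) - iexp (u * Z x)))" using i[of "V k"] i[of Z] by auto
      show "integrable P (\<lambda>x. \<bar>u\<bar> * \<delta> + 2 * indicator ?A x)" by (auto simp: emeasure_eq_measure)
      fix x assume x: "x \<in> space P"
      have "iexp (u * V k x) - iexp (u * Z x) = iexp (u * Z x) * (iexp (u * (V k x - Z x)) - 1)"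
        by (simp add: algebra_simps flip: exp_add)
      then have n: "norm (iexp (u * V k x) - iexp (u * Z x)) = norm (iexp (u * (V k x - Z x)) - 1)"
        by (simp only: norm_mult norm_exp_i_times)
      have "norm (iexp (u * (V k x - Z x)) - 1) \<le> \<bar>u * (V k x - Z x)\<bar>"
        using iexp_approx1[of "u * (V k x - Z x)" 0] by simp
      moreover have "norm (iexp (u * (V k x - Z x)) - 1) \<le> norm (iexp (u * (V k x - Z x))) + norm (1::complex)"
        by (rule norm_triangle_ineq4)
      then have "norm (iexp (u * (V k x - Z x)) - 1) \<le> 2" by (simp only: norm_exp_i_times norm_one)
      moreover have "0 \<le> \<bar>u\<bar> * \<delta>" using \<delta> by auto
      moreover have "\<bar>u * (V k x - Z x)\<bar> \<le> \<bar>u\<bar> * \<delta>" if "x \<notin> ?A"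
        using that x by (auto simp: abs_mult intro!: mult_left_mono)
      ultimately have "norm (iexp (u * (V k x - Z x)) - 1) \<le> \<bar>u\<bar> * \<delta> + 2 * (if x \<in> ?A then 1 else 0)"
        by (smt (verit))
      then show "norm (iexp (u * V k x) - iexp (u * Z x)) \<le> \<bar>u\<bar> * \<delta> + 2 * indicator ?A x"
        unfolding n indicator_def by (simp only: of_bool_def)
    qed
    also have "\<dots> = \<bar>u\<bar> * \<delta> + 2 * prob ?A"
      by (subst Bochner_Integration.integral_add) (auto simp: emeasure_eq_measure prob_space)
    finally show ?case using elim \<delta> e by linarith
  qed
qed

text \<open>Levy continuity gives weak convergence to the point mass at 0. As the limit is constant
  this is convergence in probability: the boundary of {|x| > \<epsilon>} does not contain 0.\<close>

lemma conv_in_prob_0_char: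
  assumes P: "prob_space P" and m: "\<And>k. V k \<in> borel_measurable P"
    and c: "\<And>u. (\<lambda>k. char (distr P borel (V k)) u) \<longlonglongrightarrow> 1"
  shows "conv_in_prob P V (\<lambda>_. 0)"
  unfolding conv_in_prob_def
proof (intro allI impI)
  fix \<epsilon> :: real assume \<epsilon>: "\<epsilon> > 0"
  interpret prob_space P by fact
  note m[measurable]
  interpret R: prob_space "return borel (0::real)" by (rule prob_space_return) simp
  have R: "real_distribution (return borel (0::real))"
    by (intro real_distribution.intro real_distribution_axioms.intro R.prob_space_axioms) auto
  have D: "real_distribution (distr P borel (V k))" for k by (rule real_distribution_distr) simp
  have "weak_conv_m (\<lambda>k. distr P borel (V k)) (return borel 0)"
    using c by (intro levy_continuity D R) (simp add: char_def integral_return)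
  then have "(\<lambda>k. measure (distr P borel (V k)) {x. \<bar>x\<bar> > \<epsilon>}) \<longlonglongrightarrow> measure (return borel 0) {x. \<bar>x\<bar> > \<epsilon>}"
  proof (rule weak_conv_imp_continuity_set_conv[OF D R])
    have "frontier {x::real. \<bar>x\<bar> > \<epsilon>} \<subseteq> {x. \<bar>x\<bar> = \<epsilon>}"
    proof -
      have "closure {x::real. \<bar>x\<bar> > \<epsilon>} \<subseteq> {x. \<bar>x\<bar> \<ge> \<epsilon>}"
        by (rule closure_minimal) (auto intro!: closed_Collect_le continuous_intros)
      moreover have "open {x::real. \<bar>x\<bar> > \<epsilon>}" by (auto intro!: open_Collect_less continuous_intros)
      ultimately show ?thesis by (auto simp: frontier_def interior_open)
    qed
    then have "0 \<notin> frontier {x::real. \<bar>x\<bar> > \<epsilon>}" using \<epsilon> by auto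
    then show "emeasure (return borel 0) (frontier {x::real. \<bar>x\<bar> > \<epsilon>}) = 0"
      by (simp add: emeasure_return frontier_closed)
  qed simp
  moreover have "measure (return borel 0) {x::real. \<bar>x\<bar> > \<epsilon>} = 0"
    using \<epsilon> by (simp add: measure_return)
  moreover have "measure (distr P borel (V k)) {x. \<bar>x\<bar> > \<epsilon>} = prob {\<omega>\<in>space P. \<bar>V k \<omega> - 0\<bar> > \<epsilon>}" for k
    by (subst measure_distr) (auto intro!: arg_cong[where f=prob])
  ultimately show "(\<lambda>k. prob {\<omega>\<in>space P. \<bar>V k \<omega> - 0\<bar> > \<epsilon>}) \<longlonglongrightarrow> 0" by simp
qed

section \<open>Simple integrands and their density in L^\<alpha>\<close>

lemma simple_integrand_lin_comb:
  assumes "simple_integrand m s" "simple_integrand m t"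
  shows "simple_integrand m (\<lambda>x. u * s x + v * t x)"
proof -
  have [measurable]: "s \<in> borel_measurable m" "t \<in> borel_measurable m"
    using assms by (auto simp: simple_integrand_def dest: borel_measurable_simple_function)
  have "emeasure m {x\<in>space m. u * s x + v * t x \<noteq> 0} \<le> emeasure m ({x\<in>space m. s x \<noteq> 0} \<union> {x\<in>space m. t x \<noteq> 0})"
    by (intro emeasure_mono) auto
  also have "\<dots> \<le> emeasure m {x\<in>space m. s x \<noteq> 0} + emeasure m {x\<in>space m. t x \<noteq> 0}"
    by (intro emeasure_subadditive) auto
  also have "\<dots> < \<infinity>" using assms by (auto simp: simple_integrand_def)
  finally show ?thesis using assms by (auto simp: simple_integrand_def)
qed

lemma simple_integrand_0: "simple_integrand m (\<lambda>_. 0)"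
  by (simp add: simple_integrand_def)

lemma simple_integrand_level_sets:
  assumes "simple_integrand m s" "c \<noteq> 0"
  shows "{x\<in>space m. s x = c} \<in> sets m" "emeasure m {x\<in>space m. s x = c} < \<infinity>"
proof -
  have [measurable]: "s \<in> borel_measurable m"
    using assms by (auto simp: simple_integrand_def dest: borel_measurable_simple_function)
  show "{x\<in>space m. s x = c} \<in> sets m" by measurable
  have "emeasure m {x\<in>space m. s x = c} \<le> emeasure m {x\<in>space m. s x \<noteq> 0}"
    using assms by (intro emeasure_mono) auto
  also have "\<dots> < \<infinity>" using assms by (auto simp: simple_integrand_def)
  finally show "emeasure m {x\<in>space m. s x = c} < \<infinity>" .
qed

lemma simple_integrand_powr_integral:
  assumes s: "simple_integrand m s" and p: "p > 0"
  shows "has_bochner_integral m (\<lambda>x. \<bar>s x\<bar> powr p) (\<Sum>c\<in>s ` space m - {0}. \<bar>c\<bar> powr p * measure m {x\<in>space m. s x = c})"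
proof -
  have f: "finite (s ` space m - {0})" using s by (auto simp: simple_integrand_def simple_function_def)
  have "has_bochner_integral m (\<lambda>x. \<Sum>c\<in>s ` space m - {0}. indicator {x\<in>space m. s x = c} x *\<^sub>R \<bar>c\<bar> powr p)
     (\<Sum>c\<in>s ` space m - {0}. measure m {x\<in>space m. s x = c} *\<^sub>R \<bar>c\<bar> powr p)"
    by (intro has_bochner_integral_sum has_bochner_integral_indicator) (use s simple_integrand_level_sets in auto)
  then show ?thesis
  proof (rule has_bochner_integral_cong[THEN iffD1, rotated -1])
    show "(\<Sum>c\<in>s ` space m - {0}. indicator {x\<in>space m. s x = c} x *\<^sub>R \<bar>c\<bar> powr p) = \<bar>s x\<bar> powr p" if "x \<in> space m" for x
    proof (cases "s x = 0")
      case True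
      then show ?thesis by (auto intro!: sum.neutral)
    next
      case False
      have "(\<Sum>c\<in>s ` space m - {0}. indicator {x\<in>space m. s x = c} x *\<^sub>R \<bar>c\<bar> powr p) =
            (\<Sum>c\<in>{s x}. indicator {x\<in>space m. s x = c} x *\<^sub>R \<bar>c\<bar> powr p)"
        using f that False by (intro sum.mono_neutral_right) auto
      then show ?thesis using that by simp
    qed
  qed (auto simp: mult.commute)
qed

text \<open>The pointwise approximants are dominated by twice |h|. On a nonzero level set this
  bounds |h| from below, so Markov's inequality gives finite measure; it also supplies the majorant
  for dominated convergence, where |s - h| is at most 3 |h|.\<close>

lemma simple_approximation:
  assumes h: "h \<in> Lalpha p m" and p: "p > 0"
  obtains s where "\<And>k. simple_integrand m (s k)" "(\<lambda>k. \<integral>\<^sup>+x. ennreal (\<bar>s k x - h x\<bar> powr p) \<partial>m) \<longlonglongrightarrow> 0"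
proof -
  have [measurable]: "h \<in> borel_measurable m" and hi: "integrable m (\<lambda>x. \<bar>h x\<bar> powr p)"
    using h by (auto simp: Lalpha_def)
  obtain s where s: "\<And>i. simple_function m (s i)" "\<And>x. x \<in> space m \<Longrightarrow> (\<lambda>i. s i x) \<longlonglongrightarrow> h x"
      "\<And>i x. x \<in> space m \<Longrightarrow> \<bar>s i x\<bar> \<le> 2 * \<bar>h x\<bar>"
    using borel_measurable_implies_sequence_metric[of h m 0] unfolding dist_real_def diff_0_right by (auto 0 0) blast
  have ms[measurable]: "\<And>i. s i \<in> borel_measurable m" using s(1) by (rule borel_measurable_simple_function)
  show thesis
  proof
    show "simple_integrand m (s k)" for k
      unfolding simple_integrand_def
    proof
      show "simple_function m (s k)" by fact
      define C where "C = s k ` space m - {0}"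
      have fC: "finite C" using s(1) by (auto simp: C_def simple_function_def)
      have *: "emeasure m {x\<in>space m. s k x = c} < \<infinity>" if c: "c \<in> C" for c
      proof -
        have c0: "c \<noteq> 0" using c by (auto simp: C_def)
        define d where "d = (\<bar>c\<bar> / 2) powr p"
        have d: "d > 0" using c0 by (simp add: d_def)
        have "emeasure m {x\<in>space m. s k x = c} \<le> emeasure m ({x\<in>space m. d \<le> \<bar>h x\<bar> powr p} \<inter> space m)"
        proof (intro emeasure_mono subsetI)
          fix x assume x: "x \<in> {x\<in>space m. s k x = c}"
          then have "\<bar>c\<bar> / 2 \<le> \<bar>h x\<bar>" using s(3)[of x k] by auto
          then have "d \<le> \<bar>h x\<bar> powr p" unfolding d_def using p by (intro powr_mono2) auto
          then show "x \<in> {x\<in>space m. d \<le> \<bar>h x\<bar> powr p} \<inter> space m" using x by auto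
        qed simp
        also have "{x\<in>space m. d \<le> \<bar>h x\<bar> powr p} \<inter> space m = {x\<in>space m. 1 \<le> ennreal (1 / d) * ennreal (\<bar>h x\<bar> powr p)} \<inter> space m"
          using d by (auto simp: field_simps simp flip: ennreal_mult ennreal_1)
        also have "emeasure m \<dots> \<le> ennreal (1 / d) * (\<integral>\<^sup>+x. ennreal (\<bar>h x\<bar> powr p) * indicator (space m) x \<partial>m)"
          using nn_integral_Markov_inequality[of "\<lambda>x. ennreal (\<bar>h x\<bar> powr p)" "space m" m "ennreal (1 / d)"]
          by (simp add: Int_def conj_commute)
        also have "\<dots> < \<infinity>"
          using hi d by (auto simp: nn_integral_eq_integral ennreal_mult_less_top cong: nn_integral_cong)
        finally show ?thesis .
      qed
      have "emeasure m {x\<in>space m. s k x \<noteq> 0} = emeasure m (\<Union>c\<in>C. {x\<in>space m. s k x = c})"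
        by (intro arg_cong[where f="emeasure m"]) (auto simp: C_def)
      also have "\<dots> \<le> (\<Sum>c\<in>C. emeasure m {x\<in>space m. s k x = c})"
        by (intro emeasure_subadditive_finite fC) auto
      also have "\<dots> < \<infinity>" using * fC by (auto)
      finally show "emeasure m {x\<in>space m. s k x \<noteq> 0} < \<infinity>" .
    qed
    have "(\<lambda>k. \<integral>\<^sup>+x. ennreal (\<bar>s k x - h x\<bar> powr p) \<partial>m) \<longlonglongrightarrow> (\<integral>\<^sup>+x. 0 \<partial>m)"
    proof (rule nn_integral_dominated_convergence[where w="\<lambda>x. ennreal (3 powr p * \<bar>h x\<bar> powr p)"])
      show "(\<integral>\<^sup>+x. ennreal (3 powr p * \<bar>h x\<bar> powr p) \<partial>m) < \<infinity>"
        using hi by (subst nn_integral_eq_integral) auto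
      show "AE x in m. ennreal (\<bar>s k x - h x\<bar> powr p) \<le> ennreal (3 powr p * \<bar>h x\<bar> powr p)" for k
      proof (rule AE_I2, rule ennreal_leI)
        fix x assume "x \<in> space m"
        then have "\<bar>s k x - h x\<bar> \<le> 3 * \<bar>h x\<bar>" using s(3)[of x k] by linarith
        then have "\<bar>s k x - h x\<bar> powr p \<le> (3 * \<bar>h x\<bar>) powr p" using p by (intro powr_mono2) auto
        then show "\<bar>s k x - h x\<bar> powr p \<le> 3 powr p * \<bar>h x\<bar> powr p" by (simp add: powr_mult)
      qed
      show "AE x in m. (\<lambda>k. ennreal (\<bar>s k x - h x\<bar> powr p)) \<longlonglongrightarrow> 0"
      proof (rule AE_I2)
        fix x assume "x \<in> space m"
        then have "(\<lambda>k. \<bar>s k x - h x\<bar>) \<longlonglongrightarrow> 0"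
          by (intro tendsto_rabs_zero LIM_zero s(2))
        then have "(\<lambda>k. \<bar>s k x - h x\<bar> powr p) \<longlonglongrightarrow> 0"
          by (rule tendsto_zero_powrI) (use p in auto)
        then show "(\<lambda>k. ennreal (\<bar>s k x - h x\<bar> powr p)) \<longlonglongrightarrow> 0"
          by (subst ennreal_0[symmetric]) (rule tendsto_ennrealI)
      qed
    qed measurable
    then show "(\<lambda>k. \<integral>\<^sup>+x. ennreal (\<bar>s k x - h x\<bar> powr p) \<partial>m) \<longlonglongrightarrow> 0" by simp
  qed
qed

lemma Lalpha_lin_comb:
  assumes p: "0 < p" and f: "f \<in> Lalpha p m" and g: "g \<in> Lalpha p m"
  shows "(\<lambda>x. u * f x + v * g x) \<in> Lalpha p m"
proof -
  have [measurable]: "f \<in> borel_measurable m" "g \<in> borel_measurable m" using f g by (auto simp: Lalpha_def)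
  have "integrable m (\<lambda>x. \<bar>u * f x + v * g x\<bar> powr p)"
  proof (rule Bochner_Integration.integrable_bound)
    show "integrable m (\<lambda>x. 2 powr p * (\<bar>u\<bar> powr p * \<bar>f x\<bar> powr p) + 2 powr p * (\<bar>v\<bar> powr p * \<bar>g x\<bar> powr p))"
      using f g by (auto simp: Lalpha_def)
    show "AE x in m. norm (\<bar>u * f x + v * g x\<bar> powr p) \<le>
        norm (2 powr p * (\<bar>u\<bar> powr p * \<bar>f x\<bar> powr p) + 2 powr p * (\<bar>v\<bar> powr p * \<bar>g x\<bar> powr p))"
      using abs_add_powr_le[OF p, of 1 "u * f x" "v * g x" for x] by (simp add: abs_mult powr_mult)
  qed simp
  then show ?thesis by (simp add: Lalpha_def)
qed

section \<open>Integration against a stable random measure\<close>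

locale sas_measure =
  fixes \<alpha> :: real and P :: "'w measure" and m :: "'e measure" and M :: "'e set \<Rightarrow> 'w \<Rightarrow> real"
  assumes alpha: "0 < \<alpha>" and random_measure: "sas_random_measure \<alpha> P m M"
begin

sublocale prob_space P using random_measure by (simp add: sas_random_measure_def)

abbreviation I :: "('e \<Rightarrow> real) \<Rightarrow> 'w \<Rightarrow> real" where "I \<equiv> simple_stable_integral m M"

lemma M_measurable [measurable]:
  "A \<in> sets m \<Longrightarrow> emeasure m A < \<infinity> \<Longrightarrow> M A \<in> borel_measurable P"
  using random_measure unfolding sas_random_measure_def by blast

lemma M_char:
  assumes "A \<in> sets m" "emeasure m A < \<infinity>"
  shows "char (distr P borel (M A)) u = complex_of_real (exp (- (measure m A * \<bar>u\<bar> powr \<alpha>)))"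
proof -
  have "\<forall>A\<in>sets m. emeasure m A < \<infinity> \<longrightarrow> M A \<in> borel_measurable P \<and>
        (\<forall>u. char (distr P borel (M A)) u = complex_of_real (exp (- (measure m A * \<bar>u\<bar> powr \<alpha>))))"
    using random_measure unfolding sas_random_measure_def by (elim conjE) assumption
  with assms show ?thesis by blast
qed

lemma M_indep:
  assumes "\<And>i. i < n \<Longrightarrow> A i \<in> sets m" "\<And>i. i < n \<Longrightarrow> emeasure m (A i) < \<infinity>" "disjoint_family_on A {..<n}"
  shows "indep_vars (\<lambda>_. borel) (\<lambda>i. M (A i)) {..<n::nat}"
proof -
  have "\<forall>(A :: nat \<Rightarrow> 'e set) n. (\<forall>i<n. A i \<in> sets m \<and> emeasure m (A i) < \<infinity>) \<and> disjoint_family_on A {..<n} \<longrightarrow>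
        prob_space.indep_vars P (\<lambda>_. borel) (\<lambda>i. M (A i)) {..<n}"
    using random_measure unfolding sas_random_measure_def by (elim conjE) assumption
  with assms show ?thesis by blast
qed

lemma M_sums:
  fixes A :: "nat \<Rightarrow> 'e set"
  assumes "\<And>i. A i \<in> sets m" "emeasure m (\<Union>i. A i) < \<infinity>" "disjoint_family A"
  shows "AE \<omega> in P. (\<lambda>i. M (A i) \<omega>) sums M (\<Union>i. A i) \<omega>"
proof -
  have "\<forall>A :: nat \<Rightarrow> 'e set. (\<forall>i. A i \<in> sets m) \<and> emeasure m (\<Union>i. A i) < \<infinity> \<and> disjoint_family A \<longrightarrow>
        (AE \<omega> in P. (\<lambda>i. M (A i) \<omega>) sums M (\<Union>i. A i) \<omega>)"
    using random_measure unfolding sas_random_measure_def by (elim conjE) assumption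
  with assms show ?thesis by blast
qed

text \<open>Only the law of \<open>M {}\<close> is given: its characteristic function is constantly
  1, so it is the point mass at 0. Finite unions, padded by empty sets, then fall under countable
  additivity.\<close>

lemma M_empty: "AE \<omega> in P. M {} \<omega> = 0"
proof -
  have [measurable]: "M {} \<in> borel_measurable P" by (rule M_measurable) auto
  interpret R: prob_space "return borel (0::real)" by (rule prob_space_return) simp
  have R: "real_distribution (return borel (0::real))"
    by (intro real_distribution.intro real_distribution_axioms.intro R.prob_space_axioms) auto
  have "distr P borel (M {}) = return borel 0"
  proof (rule Levy_uniqueness[OF real_distribution_distr R])
    show "char (distr P borel (M {})) = char (return borel 0)"
      by (intro ext, subst M_char) (auto simp: char_def integral_return)
  qed simp
  moreover have "AE x in return borel (0::real). x = 0" by (subst AE_return) auto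
  ultimately have "AE x in distr P borel (M {}). x = 0" by (simp only:)
  then show ?thesis by (subst (asm) AE_distr_iff) auto
qed

lemma M_Un:
  assumes A: "A \<in> sets m" "emeasure m A < \<infinity>" and B: "B \<in> sets m" "emeasure m B < \<infinity>" and "A \<inter> B = {}"
  shows "AE \<omega> in P. M (A \<union> B) \<omega> = M A \<omega> + M B \<omega>"
proof -
  define C where "C i = (if i = 0 then A else if i = 1 then B else {})" for i :: nat
  have U: "(\<Union>i. C i) = A \<union> B" by (auto simp: C_def split: if_splits)
  have "emeasure m (A \<union> B) \<le> emeasure m A + emeasure m B" using A B by (intro emeasure_subadditive) auto
  also have "\<dots> < \<infinity>" using A B by auto
  finally have "emeasure m (\<Union>i. C i) < \<infinity>" unfolding U .
  then have "AE \<omega> in P. (\<lambda>i. M (C i) \<omega>) sums M (\<Union>i. C i) \<omega>"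
    using A B assms(5) by (intro M_sums) (auto simp: C_def disjoint_family_on_def)
  with M_empty show ?thesis
  proof eventually_elim
    case (elim \<omega>)
    have "(\<lambda>i. M (C i) \<omega>) sums (\<Sum>i\<in>{0,1}. M (C i) \<omega>)"
      by (rule sums_finite) (use elim in \<open>auto simp: C_def\<close>)
    with elim(2) have "M (\<Union>i. C i) \<omega> = (\<Sum>i\<in>{0,1}. M (C i) \<omega>)" by (rule sums_unique2)
    then show ?case unfolding U by (simp add: C_def)
  qed
qed

lemma M_UN_finite:
  assumes "finite K" "\<And>i. i \<in> K \<Longrightarrow> A i \<in> sets m" "\<And>i. i \<in> K \<Longrightarrow> emeasure m (A i) < \<infinity>" "disjoint_family_on A K"
  shows "AE \<omega> in P. M (\<Union>i\<in>K. A i) \<omega> = (\<Sum>i\<in>K. M (A i) \<omega>)"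
  using assms
proof (induction K)
  case empty
  then show ?case using M_empty by simp
next
  case (insert k K)
  have f: "emeasure m (\<Union>i\<in>K. A i) < \<infinity>"
  proof -
    have "emeasure m (\<Union>i\<in>K. A i) \<le> (\<Sum>i\<in>K. emeasure m (A i))"
      by (intro emeasure_subadditive_finite) (use insert in auto)
    also have "\<dots> < \<infinity>" using insert by auto
    finally show ?thesis .
  qed
  have "AE \<omega> in P. M (A k \<union> (\<Union>i\<in>K. A i)) \<omega> = M (A k) \<omega> + M (\<Union>i\<in>K. A i) \<omega>"
    using insert f by (intro M_Un) (auto simp: disjoint_family_on_def)
  moreover have "AE \<omega> in P. M (\<Union>i\<in>K. A i) \<omega> = (\<Sum>i\<in>K. M (A i) \<omega>)"
    using insert by (intro insert.IH) (auto simp: disjoint_family_on_def)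
  ultimately show ?case by eventually_elim (use insert in simp)
qed

text \<open>The integral of a function of \<open>r\<close> may be computed on the level sets of
  \<open>r\<close>: each nonzero level set of the composition is a finite disjoint union of these,
  and \<open>M\<close> is almost surely additive on it. Several simple functions can thus be
  integrated over one common partition.\<close>

lemma simple_stable_integral_comp:
  fixes r :: "'e \<Rightarrow> 'c"
  assumes r: "simple_function m r" "emeasure m {x\<in>space m. r x \<noteq> z} < \<infinity>" and g: "g z = 0"
  shows "AE \<omega> in P. I (\<lambda>x. g (r x)) \<omega> = (\<Sum>c\<in>r ` space m - {z}. g c * M {x\<in>space m. r x = c} \<omega>)"
proof -
  define R where "R = r ` space m - {z}"
  define D where "D = (\<lambda>x. g (r x)) ` space m - {0}"
  have fR: "finite R" and fD: "finite D"
    using r(1) by (auto simp: R_def D_def simple_function_def image_image[symmetric, of g r])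
  have lev: "{x\<in>space m. r x = c} \<in> sets m" for c
  proof -
    have "{x\<in>space m. r x = c} = r -` {c} \<inter> space m" by auto
    then show ?thesis using simple_functionD(2)[OF r(1)] by simp
  qed
  have "{x\<in>space m. r x \<noteq> z} = space m - {x\<in>space m. r x = z}" by auto
  then have nz: "{x\<in>space m. r x \<noteq> z} \<in> sets m" using lev by auto
  have fin: "emeasure m {x\<in>space m. r x = c} < \<infinity>" if "c \<noteq> z" for c
  proof -
    have "emeasure m {x\<in>space m. r x = c} \<le> emeasure m {x\<in>space m. r x \<noteq> z}"
      using that nz by (intro emeasure_mono) auto
    with r(2) show ?thesis by simp
  qed
  have "AE \<omega> in P. \<forall>d\<in>D. M (\<Union>c\<in>{c\<in>R. g c = d}. {x\<in>space m. r x = c}) \<omega> = (\<Sum>c\<in>{c\<in>R. g c = d}. M {x\<in>space m. r x = c} \<omega>)"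
    using fR fD lev fin by (intro AE_finite_allI M_UN_finite) (auto simp: R_def disjoint_family_on_def)
  then show ?thesis
  proof eventually_elim
    case (elim \<omega>)
    have "I (\<lambda>x. g (r x)) \<omega> = (\<Sum>d\<in>D. d * M {x\<in>space m. g (r x) = d} \<omega>)"
      by (simp add: simple_stable_integral_def D_def)
    also have "\<dots> = (\<Sum>d\<in>D. \<Sum>c\<in>{c\<in>R. g c = d}. g c * M {x\<in>space m. r x = c} \<omega>)"
    proof (intro sum.cong refl)
      fix d assume d: "d \<in> D"
      have "{x\<in>space m. g (r x) = d} = (\<Union>c\<in>{c\<in>R. g c = d}. {x\<in>space m. r x = c})"
        using d g by (auto simp: R_def D_def)
      then show "d * M {x\<in>space m. g (r x) = d} \<omega> = (\<Sum>c\<in>{c\<in>R. g c = d}. g c * M {x\<in>space m. r x = c} \<omega>)"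
        using elim d by (simp add: sum_distrib_left)
    qed
    \<comment> \<open>For nonzero \<open>d\<close> the extra condition \<open>g c \<noteq> 0\<close>
      changes nothing, but it makes \<open>D\<close> exactly the image of the index set, as the
      regrouping requires.\<close>
    also have "\<dots> = (\<Sum>d\<in>D. \<Sum>c\<in>{c\<in>{c\<in>R. g c \<noteq> 0}. g c = d}. g c * M {x\<in>space m. r x = c} \<omega>)"
      by (intro sum.cong refl) (auto simp: D_def)
    also have "D = g ` {c\<in>R. g c \<noteq> 0}" using g by (auto simp: D_def R_def)
    also have "(\<Sum>d\<in>g ` {c\<in>R. g c \<noteq> 0}. \<Sum>c\<in>{c\<in>{c\<in>R. g c \<noteq> 0}. g c = d}. g c * M {x\<in>space m. r x = c} \<omega>) =
        (\<Sum>c\<in>{c\<in>R. g c \<noteq> 0}. g c * M {x\<in>space m. r x = c} \<omega>)"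
      using fR by (intro sum.image_gen[symmetric]) auto
    also have "\<dots> = (\<Sum>c\<in>R. g c * M {x\<in>space m. r x = c} \<omega>)"
      using fR by (intro sum.mono_neutral_left) auto
    finally show ?case by (simp add: R_def)
  qed
qed

text \<open>The common refinement is the pair \<open>(s x, t x)\<close>, which turns all three
  integrals into sums over the same level sets.\<close>

lemma simple_stable_integral_lin_comb:
  assumes s: "simple_integrand m s" and t: "simple_integrand m t"
  shows "AE \<omega> in P. I (\<lambda>x. u * s x + v * t x) \<omega> = u * I s \<omega> + v * I t \<omega>"
proof -
  define r where "r x = (s x, t x)" for x
  have r: "simple_function m r" unfolding r_def using s t by (auto simp: simple_integrand_def)
  have [measurable]: "s \<in> borel_measurable m" "t \<in> borel_measurable m"
    using assms by (auto simp: simple_integrand_def dest: borel_measurable_simple_function)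
  have "emeasure m {x\<in>space m. r x \<noteq> (0,0)} \<le> emeasure m ({x\<in>space m. s x \<noteq> 0} \<union> {x\<in>space m. t x \<noteq> 0})"
    by (intro emeasure_mono) (auto simp: r_def)
  also have "\<dots> \<le> emeasure m {x\<in>space m. s x \<noteq> 0} + emeasure m {x\<in>space m. t x \<noteq> 0}"
    by (intro emeasure_subadditive) auto
  also have "\<dots> < \<infinity>" using assms by (auto simp: simple_integrand_def)
  finally have fin: "emeasure m {x\<in>space m. r x \<noteq> (0,0)} < \<infinity>" .
  note c = simple_stable_integral_comp[OF r fin]
  have "AE \<omega> in P. I (\<lambda>x. fst (r x)) \<omega> = (\<Sum>c\<in>r ` space m - {(0,0)}. fst c * M {x\<in>space m. r x = c} \<omega>)"
    "AE \<omega> in P. I (\<lambda>x. snd (r x)) \<omega> = (\<Sum>c\<in>r ` space m - {(0,0)}. snd c * M {x\<in>space m. r x = c} \<omega>)"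
    "AE \<omega> in P. I (\<lambda>x. u * fst (r x) + v * snd (r x)) \<omega> = (\<Sum>c\<in>r ` space m - {(0,0)}. (u * fst c + v * snd c) * M {x\<in>space m. r x = c} \<omega>)"
    by (intro c[where g=fst] c[where g=snd] c[where g="\<lambda>c. u * fst c + v * snd c"]; simp)+
  then show ?thesis
    by eventually_elim (simp add: r_def[abs_def] sum_distrib_left distrib_right sum.distrib mult.assoc)
qed

lemma simple_stable_integral_measurable [measurable]:
  assumes "simple_integrand m s"
  shows "I s \<in> borel_measurable P"
proof -
  have "(\<lambda>\<omega>. \<Sum>c\<in>s ` space m - {0}. c * M {x\<in>space m. s x = c} \<omega>) \<in> borel_measurable P"
    using simple_integrand_level_sets[OF assms]
    by (intro borel_measurable_sum borel_measurable_times M_measurable) auto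
  then show ?thesis by (simp add: simple_stable_integral_def[abs_def])
qed

text \<open>Distinct values have disjoint level sets, on which \<open>M\<close> is independent, so
  the characteristic function factorises over the values.\<close>

lemma simple_stable_integral_char:
  assumes s: "simple_integrand m s"
  shows "char (distr P borel (I s)) u = complex_of_real (exp (- (\<bar>u\<bar> powr \<alpha> * (\<integral>x. \<bar>s x\<bar> powr \<alpha> \<partial>m))))"
proof -
  define C where "C = s ` space m - {0}"
  have "finite C" using s by (auto simp: C_def simple_integrand_def simple_function_def)
  \<comment> \<open>Independence is postulated for families indexed by an initial segment, so the
    values are enumerated.\<close>
  then obtain n h where h: "bij_betw h {..<n::nat} C"
    by (metis ex_bij_betw_nat_finite atLeast0LessThan)
  define A where "A i = {x\<in>space m. s x = h i}" for i
  have h0: "h i \<noteq> 0" if "i < n" for i using h that by (auto simp: bij_betw_def C_def)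
  have A: "A i \<in> sets m" "emeasure m (A i) < \<infinity>" if "i < n" for i
    using simple_integrand_level_sets[OF s h0[OF that]] by (auto simp: A_def)
  have "inj_on h {..<n}" using h by (auto simp: bij_betw_def)
  then have "disjoint_family_on A {..<n}"
    by (auto simp: disjoint_family_on_def A_def inj_on_def)
  then have "indep_vars (\<lambda>_. borel) (\<lambda>i. M (A i)) {..<n}" using A by (intro M_indep) auto
  then have ind: "indep_vars (\<lambda>_. borel) (\<lambda>i \<omega>. h i * M (A i) \<omega>) {..<n}"
    by (rule indep_vars_compose2) auto
  have "I s = (\<lambda>\<omega>. \<Sum>i<n. h i * M (A i) \<omega>)"
    unfolding simple_stable_integral_def[abs_def] C_def[symmetric] A_def
    by (intro ext sum.reindex_bij_betw[OF h, symmetric])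
  then have "char (distr P borel (I s)) u = (\<Prod>i<n. char (distr P borel (\<lambda>\<omega>. h i * M (A i) \<omega>)) u)"
    using char_distr_sum[OF ind] by simp
  also have "\<dots> = (\<Prod>i<n. complex_of_real (exp (- (\<bar>u\<bar> powr \<alpha> * (\<bar>h i\<bar> powr \<alpha> * measure m (A i))))))"
  proof (intro prod.cong refl)
    fix i assume "i \<in> {..<n}"
    then have i: "i < n" by simp
    have [measurable]: "M (A i) \<in> borel_measurable P" using A[OF i] by simp
    have "char (distr P borel (\<lambda>\<omega>. h i * M (A i) \<omega>)) u = (\<integral>\<omega>. iexp ((u * h i) * M (A i) \<omega>) \<partial>P)"
      unfolding char_def by (subst integral_distr) (auto simp: mult.assoc)
    also have "\<dots> = char (distr P borel (M (A i))) (u * h i)"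
      unfolding char_def by (subst integral_distr) auto
    finally show "char (distr P borel (\<lambda>\<omega>. h i * M (A i) \<omega>)) u = complex_of_real (exp (- (\<bar>u\<bar> powr \<alpha> * (\<bar>h i\<bar> powr \<alpha> * measure m (A i)))))"
      using A[OF i] by (simp add: M_char abs_mult powr_mult mult.commute mult.left_commute)
  qed
  also have "\<dots> = complex_of_real (exp (- (\<bar>u\<bar> powr \<alpha> * (\<Sum>i<n. \<bar>h i\<bar> powr \<alpha> * measure m (A i)))))"
    by (simp add: exp_sum sum_distrib_left sum_negf[symmetric] del: sum_negf)
  also have "(\<Sum>i<n. \<bar>h i\<bar> powr \<alpha> * measure m (A i)) = (\<Sum>c\<in>C. \<bar>c\<bar> powr \<alpha> * measure m {x\<in>space m. s x = c})"
    unfolding A_def by (rule sum.reindex_bij_betw[OF h])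
  also have "\<dots> = (\<integral>x. \<bar>s x\<bar> powr \<alpha> \<partial>m)"
    using simple_integrand_powr_integral[OF s alpha] by (simp add: C_def has_bochner_integral_integral_eq)
  finally show ?thesis .
qed

text \<open>Continuity at 0 of the integral as a map from L^\<alpha> to convergence in probability.
  It goes through characteristic functions, the form in which the law of the integral is
  known.\<close>

lemma simple_stable_integral_tendsto_0:
  assumes s: "\<And>k. simple_integrand m (s k)" and l: "(\<lambda>k. \<integral>\<^sup>+x. ennreal (\<bar>s k x\<bar> powr \<alpha>) \<partial>m) \<longlonglongrightarrow> 0"
  shows "conv_in_prob P (\<lambda>k. I (s k)) (\<lambda>_. 0)"
proof (rule conv_in_prob_0_char[OF prob_space_axioms])
  show "I (s k) \<in> borel_measurable P" for k using s by simp
  have i: "integrable m (\<lambda>x. \<bar>s k x\<bar> powr \<alpha>)" for k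
    using simple_integrand_powr_integral[OF s alpha] by (auto simp: has_bochner_integral_iff)
  have "(\<lambda>k. ennreal (\<integral>x. \<bar>s k x\<bar> powr \<alpha> \<partial>m)) \<longlonglongrightarrow> ennreal 0"
    using l nn_integral_eq_integral[OF i] by simp
  then have "(\<lambda>k. \<integral>x. \<bar>s k x\<bar> powr \<alpha> \<partial>m) \<longlonglongrightarrow> 0" by (subst (asm) tendsto_ennreal_iff) auto
  then have "(\<lambda>k. complex_of_real (exp (- (\<bar>u\<bar> powr \<alpha> * (\<integral>x. \<bar>s k x\<bar> powr \<alpha> \<partial>m))))) \<longlonglongrightarrow> complex_of_real (exp (- (\<bar>u\<bar> powr \<alpha> * 0)))" for u
    by (intro tendsto_intros)
  then show "(\<lambda>k. char (distr P borel (I (s k))) u) \<longlonglongrightarrow> 1" for u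
    by (simp add: simple_stable_integral_char[OF s])
qed

lemma has_stable_integral_iff:
  "has_stable_integral \<alpha> P m M h Z \<longleftrightarrow> h \<in> Lalpha \<alpha> m \<and> Z \<in> borel_measurable P \<and>
     (\<exists>s. (\<forall>k. simple_integrand m (s k)) \<and> (\<lambda>k. \<integral>\<^sup>+x. ennreal (\<bar>s k x - h x\<bar> powr \<alpha>) \<partial>m) \<longlonglongrightarrow> 0 \<and>
       conv_in_prob P (\<lambda>k. I (s k)) Z)"
  by (simp add: has_stable_integral_def conv_in_prob_def)

lemma simple_integrand_measurable: "simple_integrand m s \<Longrightarrow> s \<in> borel_measurable m"
  by (auto simp: simple_integrand_def dest: borel_measurable_simple_function)

text \<open>The integral is defined by the existence of one approximating sequence. Any other one
  works: the difference of the two tends to 0 in L^\<alpha>, hence its integrals tend to 0 in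
  probability.\<close>

lemma stable_integral_approximant:
  assumes h: "has_stable_integral \<alpha> P m M h Z"
    and t: "\<And>k. simple_integrand m (t k)" "(\<lambda>k. \<integral>\<^sup>+x. ennreal (\<bar>t k x - h x\<bar> powr \<alpha>) \<partial>m) \<longlonglongrightarrow> 0"
  shows "conv_in_prob P (\<lambda>k. I (t k)) Z"
proof -
  obtain s where s: "\<And>k. simple_integrand m (s k)" "(\<lambda>k. \<integral>\<^sup>+x. ennreal (\<bar>s k x - h x\<bar> powr \<alpha>) \<partial>m) \<longlonglongrightarrow> 0"
      "conv_in_prob P (\<lambda>k. I (s k)) Z"
    and [measurable]: "h \<in> borel_measurable m" "Z \<in> borel_measurable P"
    using h unfolding has_stable_integral_iff Lalpha_def by blast
  have [measurable]: "s k \<in> borel_measurable m" "t k \<in> borel_measurable m" for k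
    using s t by (auto intro: simple_integrand_measurable)
  define d where "d k x = 1 * t k x + (-1) * s k x" for k x
  have d: "simple_integrand m (d k)" for k
    unfolding d_def by (intro simple_integrand_lin_comb s t)
  have "(\<lambda>k. \<integral>\<^sup>+x. ennreal (\<bar>1 * (t k x - h x) + (-1) * (s k x - h x)\<bar> powr \<alpha>) \<partial>m) \<longlonglongrightarrow> 0"
    using s t by (intro nn_integral_powr_lin_comb_tendsto_0[OF alpha]) auto
  moreover have "1 * (t k x - h x) + (-1) * (s k x - h x) = d k x" for k x by (simp add: d_def)
  ultimately have "conv_in_prob P (\<lambda>k. I (d k)) (\<lambda>_. 0)"
    using d by (intro simple_stable_integral_tendsto_0) auto
  moreover have "AE \<omega> in P. I (t k) \<omega> = 1 * I (d k) \<omega> + 1 * I (s k) \<omega>" for k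
    using simple_stable_integral_lin_comb[OF t(1) s(1), of 1 k "-1" k] unfolding d_def by eventually_elim simp
  ultimately have "conv_in_prob P (\<lambda>k. I (t k)) (\<lambda>\<omega>. 1 * 0 + 1 * Z \<omega>)"
    using s t d by (intro conv_in_prob_lin_comb[OF prob_space_axioms _ _ _ _ _ _ s(3)]) auto
  then show ?thesis by simp
qed

lemma stable_integral_lin_comb:
  assumes h: "has_stable_integral \<alpha> P m M h Z" and h': "has_stable_integral \<alpha> P m M h' Z'"
  shows "has_stable_integral \<alpha> P m M (\<lambda>x. u * h x + v * h' x) (\<lambda>\<omega>. u * Z \<omega> + v * Z' \<omega>)"
proof -
  obtain s where s: "\<And>k. simple_integrand m (s k)" "(\<lambda>k. \<integral>\<^sup>+x. ennreal (\<bar>s k x - h x\<bar> powr \<alpha>) \<partial>m) \<longlonglongrightarrow> 0"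
      "conv_in_prob P (\<lambda>k. I (s k)) Z"
    and hL: "h \<in> Lalpha \<alpha> m" and [measurable]: "h \<in> borel_measurable m" "Z \<in> borel_measurable P"
    using h unfolding has_stable_integral_iff Lalpha_def by blast
  obtain t where t: "\<And>k. simple_integrand m (t k)" "(\<lambda>k. \<integral>\<^sup>+x. ennreal (\<bar>t k x - h' x\<bar> powr \<alpha>) \<partial>m) \<longlonglongrightarrow> 0"
      "conv_in_prob P (\<lambda>k. I (t k)) Z'"
    and h'L: "h' \<in> Lalpha \<alpha> m" and [measurable]: "h' \<in> borel_measurable m" "Z' \<in> borel_measurable P"
    using h' unfolding has_stable_integral_iff Lalpha_def by blast
  have [measurable]: "s k \<in> borel_measurable m" "t k \<in> borel_measurable m" for k
    using s t by (auto intro: simple_integrand_measurable)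
  define d where "d k x = u * s k x + v * t k x" for k x
  have d: "simple_integrand m (d k)" for k
    unfolding d_def by (intro simple_integrand_lin_comb s t)
  have "(\<lambda>k. \<integral>\<^sup>+x. ennreal (\<bar>u * (s k x - h x) + v * (t k x - h' x)\<bar> powr \<alpha>) \<partial>m) \<longlonglongrightarrow> 0"
    using s t by (intro nn_integral_powr_lin_comb_tendsto_0[OF alpha]) auto
  moreover have "u * (s k x - h x) + v * (t k x - h' x) = d k x - (u * h x + v * h' x)" for k x
    by (simp add: d_def algebra_simps)
  ultimately have "(\<lambda>k. \<integral>\<^sup>+x. ennreal (\<bar>d k x - (u * h x + v * h' x)\<bar> powr \<alpha>) \<partial>m) \<longlonglongrightarrow> 0" by simp
  moreover have "conv_in_prob P (\<lambda>k. I (d k)) (\<lambda>\<omega>. u * Z \<omega> + v * Z' \<omega>)"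
    using s t d simple_stable_integral_lin_comb[OF s(1) t(1)] unfolding d_def
    by (intro conv_in_prob_lin_comb[OF prob_space_axioms _ _ _ _ _ s(3) t(3)]) auto
  ultimately show ?thesis
    unfolding has_stable_integral_iff using d Lalpha_lin_comb[OF alpha hL h'L] by auto
qed

lemma stable_integral_0: "has_stable_integral \<alpha> P m M (\<lambda>_. 0) (\<lambda>_. 0)"
proof -
  have "conv_in_prob P (\<lambda>k. I (\<lambda>_. 0)) (\<lambda>_. 0)"
    by (rule simple_stable_integral_tendsto_0) (auto simp: simple_integrand_0)
  then show ?thesis unfolding has_stable_integral_iff
    by (auto simp: Lalpha_def intro!: exI[of _ "\<lambda>_ _. 0"] simple_integrand_0)
qed

lemma stable_integral_sum:
  assumes "finite J" "\<And>t. t \<in> J \<Longrightarrow> has_stable_integral \<alpha> P m M (h t) (Z t)"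
  shows "has_stable_integral \<alpha> P m M (\<lambda>x. \<Sum>t\<in>J. \<theta> t * h t x) (\<lambda>\<omega>. \<Sum>t\<in>J. \<theta> t * Z t \<omega>)"
  using assms
proof (induction J)
  case empty
  then show ?case using stable_integral_0 by simp
next
  case (insert j J)
  then show ?case using stable_integral_lin_comb[of "h j" "Z j" _ _ "\<theta> j" 1] by simp
qed

text \<open>Both sides of the formula for simple integrands pass to the limit: the left by
  convergence in probability, the right by continuity of the \<alpha>-th power integral.\<close>

lemma stable_integral_char:
  assumes h: "has_stable_integral \<alpha> P m M h Z"
  shows "char (distr P borel Z) u = complex_of_real (exp (- (\<bar>u\<bar> powr \<alpha> * (\<integral>x. \<bar>h x\<bar> powr \<alpha> \<partial>m))))"
proof -
  obtain s where s: "\<And>k. simple_integrand m (s k)" "(\<lambda>k. \<integral>\<^sup>+x. ennreal (\<bar>s k x - h x\<bar> powr \<alpha>) \<partial>m) \<longlonglongrightarrow> 0"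
      "conv_in_prob P (\<lambda>k. I (s k)) Z"
    and hL: "h \<in> Lalpha \<alpha> m" and Z: "Z \<in> borel_measurable P"
    using h unfolding has_stable_integral_iff by blast
  have "(\<lambda>k. char (distr P borel (I (s k))) u) \<longlonglongrightarrow> char (distr P borel Z) u"
    using s Z by (intro conv_in_prob_char[OF prob_space_axioms]) auto
  moreover have "(\<lambda>k. \<integral>x. \<bar>s k x\<bar> powr \<alpha> \<partial>m) \<longlonglongrightarrow> (\<integral>x. \<bar>h x\<bar> powr \<alpha> \<partial>m)"
    using s hL simple_integrand_powr_integral[OF s(1) alpha]
    by (intro integral_abs_powr_tendsto[OF alpha]) (auto simp: Lalpha_def has_bochner_integral_iff simple_integrand_measurable)
  then have "(\<lambda>k. complex_of_real (exp (- (\<bar>u\<bar> powr \<alpha> * (\<integral>x. \<bar>s k x\<bar> powr \<alpha> \<partial>m))))) \<longlonglongrightarrow>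
      complex_of_real (exp (- (\<bar>u\<bar> powr \<alpha> * (\<integral>x. \<bar>h x\<bar> powr \<alpha> \<partial>m))))"
    by (intro tendsto_intros)
  ultimately show ?thesis
    unfolding simple_stable_integral_char[OF s(1)] using LIMSEQ_unique by blast
qed

lemma stable_integral_sas_process:
  fixes Z :: "'t \<Rightarrow> 'w \<Rightarrow> real"
  assumes Z: "\<And>t. has_stable_integral \<alpha> P m M (h t) (Z t)"
  shows "sas_process \<alpha> P Z"
  unfolding sas_process_def stochastic_process_def
proof (intro conjI allI impI prob_space_axioms)
  show "Z t \<in> borel_measurable P" for t using Z by (auto simp: has_stable_integral_def)
  fix J :: "'t set" and \<theta> assume "finite J"
  then have S: "has_stable_integral \<alpha> P m M (\<lambda>x. \<Sum>t\<in>J. \<theta> t * h t x) (\<lambda>\<omega>. \<Sum>t\<in>J. \<theta> t * Z t \<omega>)"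
    by (rule stable_integral_sum) (rule Z)
  define v where "v = (\<integral>x. \<bar>\<Sum>t\<in>J. \<theta> t * h t x\<bar> powr \<alpha> \<partial>m)"
  have v: "v \<ge> 0" by (simp add: v_def)
  \<comment> \<open>The scale parameter is the \<alpha>-norm of the combined kernel.\<close>
  have "(v powr (1 / \<alpha>)) powr \<alpha> = v" using v alpha by (simp add: powr_powr)
  then show "sas_variable \<alpha> P (\<lambda>\<omega>. \<Sum>t\<in>J. \<theta> t * Z t \<omega>)"
    unfolding sas_variable_def using stable_integral_char[OF S] S
    by (auto simp: has_stable_integral_def v_def mult.commute intro!: exI[of _ "v powr (1 / \<alpha>)"])
qed

end

text \<open>The tool by which self-similarity and both stationarity statements become identities
  between integrals over control measures. Extended nonnegative integrals allow a change of
  variables without prior integrability.\<close>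

lemma same_fdd_stable_integral:
  fixes Z :: "'t \<Rightarrow> 'w \<Rightarrow> real" and Y :: "'t \<Rightarrow> 'v \<Rightarrow> real"
    and m :: "'e measure" and n :: "'f measure"
  assumes "sas_measure \<alpha> P m M" "sas_measure \<alpha> Q n N"
    and Z: "\<And>t. has_stable_integral \<alpha> P m M (h t) (Z t)" and Y: "\<And>t. has_stable_integral \<alpha> Q n N (g t) (Y t)"
    and eq: "\<And>J \<theta>. finite J \<Longrightarrow> (\<integral>\<^sup>+x. ennreal (\<bar>\<Sum>t\<in>J. \<theta> t * h t x\<bar> powr \<alpha>) \<partial>m) = (\<integral>\<^sup>+x. ennreal (\<bar>\<Sum>t\<in>J. \<theta> t * g t x\<bar> powr \<alpha>) \<partial>n)"
  shows "same_fdd P Z Q Y"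
  unfolding same_fdd_def
proof (intro allI impI)
  fix J :: "'t set" assume J: "finite J"
  interpret P: sas_measure \<alpha> P m M by fact
  interpret Q: sas_measure \<alpha> Q n N by fact
  show "distr P (PiM J (\<lambda>_. borel)) (\<lambda>\<omega>. \<lambda>t\<in>J. Z t \<omega>) = distr Q (PiM J (\<lambda>_. borel)) (\<lambda>\<omega>. \<lambda>t\<in>J. Y t \<omega>)"
  proof (rule law_eqI_char[OF P.prob_space_axioms Q.prob_space_axioms])
    show "Z t \<in> borel_measurable P" "Y t \<in> borel_measurable Q" for t
      using Z Y by (auto simp: has_stable_integral_def)
    fix \<theta> and K :: "'t set" assume K: "finite K"
    have iZ: "has_stable_integral \<alpha> P m M (\<lambda>x. \<Sum>t\<in>K. \<theta> t * h t x) (\<lambda>\<omega>. \<Sum>t\<in>K. \<theta> t * Z t \<omega>)"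
      by (rule P.stable_integral_sum[OF K]) (rule Z)
    have iY: "has_stable_integral \<alpha> Q n N (\<lambda>x. \<Sum>t\<in>K. \<theta> t * g t x) (\<lambda>\<omega>. \<Sum>t\<in>K. \<theta> t * Y t \<omega>)"
      by (rule Q.stable_integral_sum[OF K]) (rule Y)
    have "(\<integral>x. \<bar>\<Sum>t\<in>K. \<theta> t * h t x\<bar> powr \<alpha> \<partial>m) = (\<integral>x. \<bar>\<Sum>t\<in>K. \<theta> t * g t x\<bar> powr \<alpha> \<partial>n)"
      using iZ iY by (subst (1 2) integral_eq_nn_integral) (auto simp: eq[OF K] has_stable_integral_def Lalpha_def)
    then show "char (distr P borel (\<lambda>x. \<Sum>t\<in>K. \<theta> t * Z t x)) 1 = char (distr Q borel (\<lambda>x. \<Sum>t\<in>K. \<theta> t * Y t x)) 1"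
      by (simp add: P.stable_integral_char[OF iZ] Q.stable_integral_char[OF iY])
  qed
qed

section \<open>The shift flow on Lebesgue-started paths\<close>

context sas_measure
begin

text \<open>Preimages commute with unions and keep disjoint sets disjoint, so every axiom passes to
  the image. This moves the given random measure to path space.\<close>

lemma sas_measure_distr:
  fixes n :: "'f measure"
  assumes T[measurable]: "T \<in> measurable m n"
  shows "sas_measure \<alpha> P (distr m n T) (\<lambda>A. M (T -` A \<inter> space m))"
proof (unfold_locales, rule alpha, unfold sas_random_measure_def, intro conjI allI ballI impI prob_space_axioms)
  have T1: "T -` A \<inter> space m \<in> sets m" if "A \<in> sets (distr m n T)" for A
    using that measurable_sets[OF T] by simp
  have T2: "emeasure (distr m n T) A = emeasure m (T -` A \<inter> space m)" if "A \<in> sets (distr m n T)" for A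
    using that by (simp add: emeasure_distr)
  {
    fix A assume A: "A \<in> sets (distr m n T)" "emeasure (distr m n T) A < \<infinity>"
    then show "M (T -` A \<inter> space m) \<in> borel_measurable P"
      using T1 T2 by simp
    show "char (distr P borel (M (T -` A \<inter> space m))) u =
       complex_of_real (exp (- (measure (distr m n T) A * \<bar>u\<bar> powr \<alpha>)))" for u
      using A T1 T2 by (subst M_char) (auto simp: measure_def)
  }
  {
    fix A :: "nat \<Rightarrow> 'f set" and k
    assume A: "(\<forall>i<k. A i \<in> sets (distr m n T) \<and> emeasure (distr m n T) (A i) < \<infinity>) \<and> disjoint_family_on A {..<k}"
    show "indep_vars (\<lambda>_. borel) (\<lambda>i. M (T -` A i \<inter> space m)) {..<k}"
    proof (rule M_indep)
      show "T -` A i \<inter> space m \<in> sets m" "emeasure m (T -` A i \<inter> space m) < \<infinity>" if "i < k" for i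
        using A that T1 T2 by auto
      show "disjoint_family_on (\<lambda>i. T -` A i \<inter> space m) {..<k}"
        using A by (fastforce simp: disjoint_family_on_def)
    qed
  }
  {
    fix A :: "nat \<Rightarrow> 'f set"
    assume A: "(\<forall>i. A i \<in> sets (distr m n T)) \<and> emeasure (distr m n T) (\<Union>i. A i) < \<infinity> \<and> disjoint_family A"
    have U: "T -` (\<Union>i. A i) \<inter> space m = (\<Union>i. T -` A i \<inter> space m)" by auto
    have e: "emeasure (distr m n T) (\<Union>i. A i) = emeasure m (\<Union>i. T -` A i \<inter> space m)"
      unfolding U[symmetric] using A by (intro T2 sets.countable_UN) auto
    show "AE \<omega> in P. (\<lambda>i. M (T -` A i \<inter> space m) \<omega>) sums M (T -` (\<Union>i. A i) \<inter> space m) \<omega>"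
      unfolding U
    proof (rule M_sums)
      show "T -` A i \<inter> space m \<in> sets m" for i using A T1 by auto
      show "disjoint_family (\<lambda>i. T -` A i \<inter> space m)" using A by (fastforce simp: disjoint_family_on_def)
    qed (use A e in auto)
  }
qed

lemma simple_stable_integral_distr:
  assumes T[measurable]: "T \<in> measurable m n" and t: "simple_integrand (distr m n T) t"
  shows "simple_integrand m (\<lambda>x. t (T x))"
    and "AE \<omega> in P. simple_stable_integral (distr m n T) (\<lambda>A. M (T -` A \<inter> space m)) t \<omega> = I (\<lambda>x. t (T x)) \<omega>"
proof -
  have tm[measurable]: "t \<in> borel_measurable n"
    using t by (auto simp: simple_integrand_def dest: borel_measurable_simple_function)
  have sf: "T x \<in> space n" if "x \<in> space m" for x using measurable_space[OF T that] .
  have ft: "finite (t ` space n)" using t by (auto simp: simple_integrand_def simple_function_def)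
  have sub: "(\<lambda>x. t (T x)) ` space m \<subseteq> t ` space n" using sf by auto
  show si: "simple_integrand m (\<lambda>x. t (T x))"
    unfolding simple_integrand_def
  proof
    show "simple_function m (\<lambda>x. t (T x))"
      using finite_subset[OF sub ft] by (subst simple_function_borel_measurable) auto
    have "emeasure (distr m n T) {x\<in>space n. t x \<noteq> 0} = emeasure m {x\<in>space m. t (T x) \<noteq> 0}"
      using sf by (subst emeasure_distr) (auto intro!: arg_cong[where f="emeasure m"])
    then show "emeasure m {x\<in>space m. t (T x) \<noteq> 0} < \<infinity>"
      using t by (simp add: simple_integrand_def)
  qed
  show "AE \<omega> in P. simple_stable_integral (distr m n T) (\<lambda>A. M (T -` A \<inter> space m)) t \<omega> = I (\<lambda>x. t (T x)) \<omega>"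
    using M_empty
  proof eventually_elim
    case (elim \<omega>)
    have lev: "T -` {y\<in>space n. t y = c} \<inter> space m = {x\<in>space m. t (T x) = c}" for c using sf by auto
    have "simple_stable_integral (distr m n T) (\<lambda>A. M (T -` A \<inter> space m)) t \<omega> =
       (\<Sum>c\<in>t ` space n - {0}. c * M {x\<in>space m. t (T x) = c} \<omega>)"
      unfolding simple_stable_integral_def space_distr lev ..
    \<comment> \<open>Values of \<open>t\<close> that are not attained on the range of
      \<open>T\<close> have an empty level set here, and \<open>M {}\<close> vanishes only almost
      surely.\<close>
    also have "\<dots> = (\<Sum>c\<in>(\<lambda>x. t (T x)) ` space m - {0}. c * M {x\<in>space m. t (T x) = c} \<omega>)"
    proof (rule sum.mono_neutral_right)
      show "\<forall>c\<in>t ` space n - {0} - ((\<lambda>x. t (T x)) ` space m - {0}). c * M {x\<in>space m. t (T x) = c} \<omega> = 0"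
      proof
        fix c assume "c \<in> t ` space n - {0} - ((\<lambda>x. t (T x)) ` space m - {0})"
        then have "c \<notin> (\<lambda>x. t (T x)) ` space m" by auto
        then have "{x\<in>space m. t (T x) = c} = {}" by blast
        with elim show "c * M {x\<in>space m. t (T x) = c} \<omega> = 0" by (simp only: mult_zero_right)
      qed
    qed (use ft sub in auto)
    finally show ?case by (simp add: simple_stable_integral_def)
  qed
qed

text \<open>A sequence approximating the composed integrand need not factor through
  \<open>T\<close>. So \<open>h\<close> is approximated on the image space, the approximants are
  composed with \<open>T\<close>, and the integral is computed along this sequence instead.\<close>

lemma has_stable_integral_distr:
  assumes T[measurable]: "T \<in> measurable m n" and hm[measurable]: "h \<in> borel_measurable n"
    and hs: "has_stable_integral \<alpha> P m M (\<lambda>x. h (T x)) Z"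
  shows "has_stable_integral \<alpha> P (distr m n T) (\<lambda>A. M (T -` A \<inter> space m)) h Z"
proof -
  interpret D: sas_measure \<alpha> P "distr m n T" "\<lambda>A. M (T -` A \<inter> space m)" by (rule sas_measure_distr) fact
  have hL: "h \<in> Lalpha \<alpha> (distr m n T)" and Z: "Z \<in> borel_measurable P"
    using hs by (auto simp: has_stable_integral_def Lalpha_def integrable_distr_eq)
  obtain t where t: "\<And>k. simple_integrand (distr m n T) (t k)"
    "(\<lambda>k. \<integral>\<^sup>+x. ennreal (\<bar>t k x - h x\<bar> powr \<alpha>) \<partial>distr m n T) \<longlonglongrightarrow> 0"
    using simple_approximation[OF hL alpha] by blast
  have [measurable]: "t k \<in> borel_measurable n" for k using D.simple_integrand_measurable[OF t(1)] by simp
  have "conv_in_prob P (\<lambda>k. I (\<lambda>x. t k (T x))) Z"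
    using t(2) by (intro stable_integral_approximant[OF hs] simple_stable_integral_distr(1)[OF T t(1)])
      (simp add: nn_integral_distr)
  \<comment> \<open>The combination with coefficients 1 and 0 serves to replace a sequence by an
    almost surely equal one.\<close>
  then have "conv_in_prob P (\<lambda>k. D.I (t k)) (\<lambda>\<omega>. 1 * Z \<omega> + 0 * Z \<omega>)"
    using Z simple_stable_integral_distr[OF T t(1)]
      D.simple_stable_integral_measurable[OF t(1)] simple_stable_integral_measurable[OF simple_stable_integral_distr(1)[OF T t(1)]]
    by (intro conv_in_prob_lin_comb[OF prob_space_axioms, where V="\<lambda>k. I (\<lambda>x. t k (T x))" and V'="\<lambda>k. I (\<lambda>x. t k (T x))"]) auto
  then show ?thesis unfolding D.has_stable_integral_iff using hL Z t by auto
qed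

end

section \<open>The shift and the path measure\<close>

definition shift :: "int \<Rightarrow> (int \<Rightarrow> real) \<Rightarrow> int \<Rightarrow> real" where
  "shift k w = (\<lambda>n. w (n + k))"

abbreviation paths :: "(int \<Rightarrow> real) measure" where
  "paths \<equiv> PiM UNIV (\<lambda>_. borel)"

lemma shift_measurable [measurable]: "shift k \<in> measurable paths paths"
  unfolding shift_def[abs_def] by (rule measurable_PiM_single') auto

lemma shift_0: "shift 0 w = w" and shift_shift: "shift n (shift k w) = shift (n + k) w"
  by (auto simp: shift_def algebra_simps)

text \<open>Wandering sets are defined by images under the flow; written as preimages these are
  visibly measurable.\<close>

lemma shift_image: "shift k ` W = shift (- k) -` W"
proof (rule set_eqI, rule iffI)
  show "w \<in> shift (- k) -` W" if "w \<in> shift k ` W" for w using that by (auto simp: shift_shift shift_0)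
  show "w \<in> shift k ` W" if "w \<in> shift (- k) -` W" for w
    by (rule image_eqI[where x="shift (- k) w"]) (use that in \<open>simp_all add: shift_shift shift_0\<close>)
qed

locale lebesgue_fbm = prob_space P' for P' :: "'o measure" +
  fixes H' :: real and \<tau> :: "real \<Rightarrow> 'o \<Rightarrow> real"
  assumes fbm: "fractional_brownian_motion P' H' \<tau>" and H'_pos: "0 < H'" and H'_less_1: "H' < 1"
begin

definition traj :: "'o \<times> real \<Rightarrow> int \<Rightarrow> real" where
  "traj = (\<lambda>(\<omega>, x) n. \<tau> (of_int n) \<omega> - x)"

definition \<mu> :: "(int \<Rightarrow> real) measure" where
  "\<mu> = distr (P' \<Otimes>\<^sub>M lborel) paths traj"

lemma tau_measurable [measurable]: "\<tau> t \<in> borel_measurable P'"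
  using fbm by (auto simp: fractional_brownian_motion_def centered_gaussian_process_def stochastic_process_def)

lemma traj_measurable [measurable]: "traj \<in> measurable (P' \<Otimes>\<^sub>M lborel) paths"
  unfolding traj_def case_prod_beta by (rule measurable_PiM_single') auto

lemma sets_mu [simp, measurable_cong]: "sets \<mu> = sets paths" and space_mu [simp]: "space \<mu> = UNIV"
  by (simp_all add: \<mu>_def space_PiM)

lemma nn_integral_mu:
  assumes [measurable]: "F \<in> borel_measurable paths"
  shows "(\<integral>\<^sup>+w. F w \<partial>\<mu>) = (\<integral>\<^sup>+\<omega>. \<integral>\<^sup>+x. F (\<lambda>n. \<tau> (of_int n) \<omega> - x) \<partial>lborel \<partial>P')"
  unfolding \<mu>_def by (simp add: nn_integral_distr lborel.nn_integral_fst[symmetric]) (simp add: traj_def)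

text \<open>Integrating over the starting point first gives a functional \<open>G\<close> that is
  unchanged when a constant is added to the path. So \<open>\<tau> (t + s)\<close> may be replaced
  by \<open>\<tau> (t + s) - \<tau> s\<close>, which has the law of \<open>\<tau>\<close>. Time is
  real because the result serves both the shift and the increments of \<open>X\<close>.\<close>

lemma nn_integral_increments:
  assumes F[measurable]: "F \<in> borel_measurable (PiM UNIV (\<lambda>_::real. borel))"
  shows "(\<integral>\<^sup>+\<omega>. \<integral>\<^sup>+x. F (\<lambda>t. \<tau> (t + s) \<omega> - x) \<partial>lborel \<partial>P') = (\<integral>\<^sup>+\<omega>. \<integral>\<^sup>+x. F (\<lambda>t. \<tau> t \<omega> - x) \<partial>lborel \<partial>P')"
proof -
  define G where "G w = (\<integral>\<^sup>+x. F (\<lambda>t. w t - x) \<partial>lborel)" for w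
  have c[measurable]: "(\<lambda>(w, x). (\<lambda>t. w t - x)) \<in> measurable (PiM UNIV (\<lambda>_::real. borel) \<Otimes>\<^sub>M lborel) (PiM UNIV (\<lambda>_::real. borel))"
    unfolding case_prod_beta by (rule measurable_PiM_single') auto
  have Gm[measurable]: "G \<in> borel_measurable (PiM UNIV (\<lambda>_. borel))"
    unfolding G_def[abs_def] by measurable
  have m1[measurable]: "(\<lambda>\<omega> t. \<tau> (t + s) \<omega> - \<tau> s \<omega>) \<in> measurable P' (PiM UNIV (\<lambda>_. borel))"
    "(\<lambda>\<omega> t. \<tau> t \<omega>) \<in> measurable P' (PiM UNIV (\<lambda>_. borel))"
    by (rule measurable_PiM_single'; auto)+
  have mx: "(\<lambda>x t. w t - x) \<in> measurable borel (PiM UNIV (\<lambda>_::real. borel))" for w :: "real \<Rightarrow> real"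
    by (rule measurable_PiM_single') auto
  have "(\<integral>\<^sup>+x. F (\<lambda>t. \<tau> (t + s) \<omega> - x) \<partial>lborel) = G (\<lambda>t. \<tau> (t + s) \<omega> - \<tau> s \<omega>)" for \<omega>
    unfolding G_def
    by (subst nn_integral_real_affine[where c=1 and t="\<tau> s \<omega>"])
      (use measurable_compose[OF mx F] in \<open>auto simp: algebra_simps\<close>)
  then have "(\<integral>\<^sup>+\<omega>. \<integral>\<^sup>+x. F (\<lambda>t. \<tau> (t + s) \<omega> - x) \<partial>lborel \<partial>P') = (\<integral>\<^sup>+\<omega>. G (\<lambda>t. \<tau> (t + s) \<omega> - \<tau> s \<omega>) \<partial>P')"
    by simp
  also have "\<dots> = (\<integral>\<^sup>+w. G w \<partial>distr P' (PiM UNIV (\<lambda>_. borel)) (\<lambda>\<omega> t. \<tau> (t + s) \<omega> - \<tau> s \<omega>))"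
    by (subst nn_integral_distr) auto
  also have "\<dots> = (\<integral>\<^sup>+\<omega>. G (\<lambda>t. \<tau> t \<omega>) \<partial>P')"
    unfolding fbm_stationary_increments[OF fbm] by (subst nn_integral_distr) auto
  finally show ?thesis by (simp add: G_def)
qed

lemma nn_integral_mu_shift:
  assumes [measurable]: "F \<in> borel_measurable paths"
  shows "(\<integral>\<^sup>+w. F (shift k w) \<partial>\<mu>) = (\<integral>\<^sup>+w. F w \<partial>\<mu>)"
proof -
  have r[measurable]: "(\<lambda>w n. w (of_int n)) \<in> measurable (PiM UNIV (\<lambda>_::real. borel)) paths"
    by (rule measurable_PiM_single') auto
  have "(\<lambda>w. F (\<lambda>n. w (of_int n))) \<in> borel_measurable (PiM UNIV (\<lambda>_::real. borel))"
    by measurable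
  from nn_integral_increments[OF this, of "of_int k"]
  show ?thesis by (simp add: nn_integral_mu) (simp add: shift_def)
qed

lemma emeasure_mu_shift:
  assumes [measurable]: "A \<in> sets paths"
  shows "emeasure \<mu> (shift k -` A) = emeasure \<mu> A"
proof -
  have "emeasure \<mu> (shift k -` A) = (\<integral>\<^sup>+w. indicator (shift k -` A) w \<partial>\<mu>)"
    using measurable_sets[OF shift_measurable assms, of k] by (simp add: space_PiM)
  also have "\<dots> = (\<integral>\<^sup>+w. indicator A (shift k w) \<partial>\<mu>)"
    by (intro nn_integral_cong) (simp add: indicator_def)
  also have "\<dots> = emeasure \<mu> A" by (subst nn_integral_mu_shift) auto
  finally show ?thesis .
qed

lemma distr_mu_shift: "distr \<mu> \<mu> (shift k) = \<mu>"
  by (rule measure_eqI) (auto simp: emeasure_distr emeasure_mu_shift)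

text \<open>For fixed \<open>\<omega>\<close> the bound on \<open>w 0\<close> confines the starting
  point to an interval of length \<open>2 * R\<close>, while \<open>w k - w 0\<close> does not
  involve the starting point, so the measure factorises. \<open>\<tau> 0\<close> stays in the
  formula because it vanishes only almost surely.\<close>

lemma emeasure_mu_window:
  assumes [measurable]: "B \<in> sets borel" and R: "R \<ge> 0"
  shows "emeasure \<mu> {w. \<bar>w 0\<bar> \<le> R \<and> w k - w 0 \<in> B} =
    ennreal (2 * R) * emeasure P' {\<omega>\<in>space P'. \<tau> (of_int k) \<omega> - \<tau> 0 \<omega> \<in> B}"
proof -
  let ?A = "{w :: int \<Rightarrow> real. \<bar>w 0\<bar> \<le> R \<and> w k - w 0 \<in> B}"
  have A: "?A \<in> sets paths"
  proof -
    have "{w \<in> space paths. \<bar>w 0\<bar> \<le> R \<and> w k - w 0 \<in> B} \<in> sets paths" by measurable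
    then show ?thesis by (simp add: space_PiM)
  qed
  have "emeasure \<mu> ?A = (\<integral>\<^sup>+w. indicator ?A w \<partial>\<mu>)" using A by simp
  also have "\<dots> = (\<integral>\<^sup>+\<omega>. \<integral>\<^sup>+x. indicator ?A (\<lambda>n. \<tau> (of_int n) \<omega> - x) \<partial>lborel \<partial>P')"
    using A by (intro nn_integral_mu) auto
  also have "\<dots> = (\<integral>\<^sup>+\<omega>. ennreal (2 * R) * indicator {\<omega>\<in>space P'. \<tau> (of_int k) \<omega> - \<tau> 0 \<omega> \<in> B} \<omega> \<partial>P')"
  proof (intro nn_integral_cong)
    fix \<omega> assume \<omega>: "\<omega> \<in> space P'"
    have "(\<integral>\<^sup>+x. indicator ?A (\<lambda>n. \<tau> (of_int n) \<omega> - x) \<partial>lborel) =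
      (\<integral>\<^sup>+x. indicator {\<omega>\<in>space P'. \<tau> (of_int k) \<omega> - \<tau> 0 \<omega> \<in> B} \<omega> * indicator {\<tau> 0 \<omega> - R..\<tau> 0 \<omega> + R} x \<partial>lborel)"
      using \<omega> by (intro nn_integral_cong) (auto simp: indicator_def abs_le_iff)
    also have "\<dots> = indicator {\<omega>\<in>space P'. \<tau> (of_int k) \<omega> - \<tau> 0 \<omega> \<in> B} \<omega> * emeasure lborel {\<tau> 0 \<omega> - R..\<tau> 0 \<omega> + R}"
      by (rule nn_integral_cmult_indicator) simp
    also have "emeasure lborel {\<tau> 0 \<omega> - R..\<tau> 0 \<omega> + R} = ennreal (2 * R)"
      by (subst emeasure_lborel_Icc) (use R in \<open>auto intro!: arg_cong[where f=ennreal]\<close>)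
    finally show "(\<integral>\<^sup>+x. indicator ?A (\<lambda>n. \<tau> (of_int n) \<omega> - x) \<partial>lborel) =
      ennreal (2 * R) * indicator {\<omega>\<in>space P'. \<tau> (of_int k) \<omega> - \<tau> 0 \<omega> \<in> B} \<omega>" by (simp add: mult.commute)
  qed
  also have "\<dots> = ennreal (2 * R) * emeasure P' {\<omega>\<in>space P'. \<tau> (of_int k) \<omega> - \<tau> 0 \<omega> \<in> B}"
    by (rule nn_integral_cmult_indicator) measurable
  finally show ?thesis .
qed

definition strip :: "real \<Rightarrow> (int \<Rightarrow> real) set" where
  "strip R = {w. \<bar>w 0\<bar> \<le> R}"

lemma sets_paths_Collect:
  "{w \<in> space paths. Q w} \<in> sets paths \<Longrightarrow> {w. Q w} \<in> sets paths"
  by (simp add: space_PiM)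

lemma strip_sets [measurable]: "strip R \<in> sets paths"
  unfolding strip_def by (rule sets_paths_Collect) measurable

lemma emeasure_strip: "R \<ge> 0 \<Longrightarrow> emeasure \<mu> (strip R) = ennreal (2 * R)"
  using emeasure_mu_window[of UNIV R 0] by (simp add: strip_def emeasure_space_1)

lemma UN_strip: "(\<Union>N. strip (real N)) = UNIV"
  using real_arch_simple by (auto simp: strip_def)

lemma sigma_finite_mu: "sigma_finite_measure \<mu>"
proof
  show "\<exists>A. countable A \<and> A \<subseteq> sets \<mu> \<and> \<Union> A = space \<mu> \<and> (\<forall>a\<in>A. emeasure \<mu> a \<noteq> \<infinity>)"
    by (rule exI[of _ "range (\<lambda>N. strip (real N))"]) (auto simp: UN_strip emeasure_strip simp del: of_nat_le_iff)
qed

lemma standard_borel_mu: "standard_borel \<mu>"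
proof -
  have "completely_metrizable_space (product_topology (\<lambda>_::int. euclidean :: real topology) UNIV)"
    by (simp add: completely_metrizable_space_product_topology completely_metrizable_space_euclidean)
  moreover have "product_topology (\<lambda>_::int. euclidean :: real topology) UNIV = euclidean"
    by (simp add: euclidean_product_topology)
  moreover have "second_countable (euclidean :: (int \<Rightarrow> real) topology)"
  proof -
    obtain B :: "(int \<Rightarrow> real) set set" where B: "countable B" "topological_basis B"
      using ex_countable_basis by blast
    then show ?thesis unfolding second_countable_def
      using topological_basis_open[OF B(2)] topological_basisE[OF B(2)] by (metis open_openin)
  qed
  moreover have "sets \<mu> = sigma_sets UNIV {U. open U}"
    by (simp add: sets_PiM_equal_borel sets_borel)
  ultimately show ?thesis unfolding standard_borel_def
    by (intro exI[of _ euclidean]) auto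
qed

lemma nonsingular_flow_shift: "nonsingular_flow \<mu> shift"
  unfolding nonsingular_flow_def
proof (intro conjI allI ballI)
  show "shift n \<in> measurable \<mu> \<mu>" for n by measurable
  show "shift n ` space \<mu> = space \<mu>" for n by (simp add: shift_image)
  show "shift 0 x = x" for x by (rule shift_0)
  show "shift (n + k) x = shift n (shift k x)" for n k x by (simp add: shift_shift)
qed (auto simp: distr_mu_shift absolutely_continuous_def)

lemma flow_derivative_shift: "AE w in \<mu>. flow_derivative \<mu> shift k w = 1"
proof -
  interpret sigma_finite_measure \<mu> by (rule sigma_finite_mu)
  have "AE w in \<mu>. 1 = RN_deriv \<mu> \<mu> w" by (rule RN_deriv_unique) (auto simp: density_1)
  then show ?thesis unfolding flow_derivative_def distr_mu_shift
    by eventually_elim (drule sym, simp)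
qed

lemma increment_second_moment: "(\<integral>\<omega>. (\<tau> t \<omega> - \<tau> s \<omega>)\<^sup>2 \<partial>P') = \<bar>t - s\<bar> powr (2 * H')"
  using fbm by (simp add: fractional_brownian_motion_def)

lemma increment_gaussian: "centered_gaussian P' (\<lambda>\<omega>. \<tau> t \<omega> - \<tau> 0 \<omega>)"
proof -
  have g: "centered_gaussian_process P' \<tau>" using fbm by (simp add: fractional_brownian_motion_def)
  have "centered_gaussian_process P' (\<lambda>t \<omega>. \<Sum>r\<in>{t, 0}. ((if r = t then 1 else 0) - (if r = 0 then 1 else 0)) * \<tau> r \<omega>)"
    by (rule centered_gaussian_process_linear[OF g]) simp
  moreover have "(\<lambda>t \<omega>. \<Sum>r\<in>{t, 0}. ((if r = t then 1 else 0) - (if r = 0 then 1 else 0)) * \<tau> r \<omega>) = (\<lambda>t \<omega>. \<tau> t \<omega> - \<tau> 0 \<omega>)"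
    by (intro ext) (case_tac "t = 0", auto)
  ultimately have "centered_gaussian_process P' (\<lambda>t \<omega>. \<tau> t \<omega> - \<tau> 0 \<omega>)" by simp
  then have "\<And>J \<theta>. finite J \<Longrightarrow> centered_gaussian P' (\<lambda>\<omega>. \<Sum>r\<in>J. \<theta> r * (\<tau> r \<omega> - \<tau> 0 \<omega>))"
    unfolding centered_gaussian_process_def by simp
  from this[of "{t}" "\<lambda>_. 1"] show ?thesis by simp
qed

text \<open>Chebyshev's inequality. With \<open>c\<close> proportional to \<open>n\<close> and
  \<open>t\<close> at most \<open>n\<close> the bound is of order
  \<open>n powr (2 * H' - 2)\<close>.\<close>

lemma increment_tail:
  assumes "c > 0"
  shows "prob {\<omega>\<in>space P'. \<tau> t \<omega> - \<tau> 0 \<omega> \<in> {x. c < \<bar>x\<bar>}} \<le> \<bar>t\<bar> powr (2 * H') / c\<^sup>2"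
proof -
  have i: "integrable P' (\<lambda>\<omega>. (\<tau> t \<omega> - \<tau> 0 \<omega>)\<^sup>2)"
    by (rule centered_gaussian_integrable[OF prob_space_axioms increment_gaussian])
  have "prob {\<omega>\<in>space P'. \<tau> t \<omega> - \<tau> 0 \<omega> \<in> {x. c < \<bar>x\<bar>}} \<le> prob {\<omega>\<in>space P'. c\<^sup>2 \<le> (\<tau> t \<omega> - \<tau> 0 \<omega>)\<^sup>2}"
    using assms by (intro finite_measure_mono) (auto simp: abs_le_square_iff[symmetric])
  also have "\<dots> \<le> (\<integral>\<omega>. (\<tau> t \<omega> - \<tau> 0 \<omega>)\<^sup>2 \<partial>P') / c\<^sup>2"
    using integral_Markov_inequality_measure[OF i, of "{}" "c\<^sup>2"] assms by simp
  finally show ?thesis by (simp add: increment_second_moment)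
qed

lemma increment_small_ball:
  assumes "t > 0" "R \<ge> 0"
  shows "prob {\<omega>\<in>space P'. \<tau> t \<omega> - \<tau> 0 \<omega> \<in> {-R..R}} \<le> 2 * R / t powr H'"
proof -
  have "(\<integral>\<omega>. (\<tau> t \<omega> - \<tau> 0 \<omega>)\<^sup>2 \<partial>P') = (t powr H')\<^sup>2"
    unfolding increment_second_moment using assms by (simp add: power2_eq_square flip: powr_add)
  from centered_gaussian_small_ball[OF prob_space_axioms increment_gaussian this _ assms(2)] assms
  moreover have "x \<in> {-R..R} \<longleftrightarrow> \<bar>x\<bar> \<le> R" for x by auto
  ultimately show ?thesis by simp
qed

end

lemma UNIV_sets_paths [simp]: "UNIV \<in> sets paths"
  using sets.top[of paths] by (simp add: space_PiM)

section \<open>Conservativity and nullity of the shift\<close>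

context lebesgue_fbm
begin

text \<open>The points of \<open>W\<close> in a strip of width \<open>N\<close> drift by \<open>o(n)\<close> in \<open>n\<close> steps, so the
  first \<open>n\<close> images of a wandering \<open>W\<close> would have to fit disjointly into a strip of width \<open>o(n)\<close>.\<close>

lemma wandering_bound:
  assumes W[measurable]: "W \<in> sets paths" and sub: "W \<subseteq> strip N" and N: "0 \<le> N" and \<epsilon>: "0 < \<epsilon>" and n: "0 < n"
    and disj: "\<And>i j. i \<noteq> j \<Longrightarrow> emeasure \<mu> (shift i ` W \<inter> shift j ` W) = 0"
  shows "measure \<mu> W \<le> 2 * \<epsilon> + 2 * N / real n + 2 * N * real n powr (2 * H' - 2) / \<epsilon>\<^sup>2"
proof -
  \<comment> \<open>A path that starts in the strip of half-width \<open>N\<close> and drifts by at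
    most \<open>\<epsilon> * n\<close> ends in the strip of half-width \<open>R\<close>.\<close>
  define R where "R = \<epsilon> * real n + N"
  define T where "T k = shift (int k) ` W" for k
  have T[measurable]: "T k \<in> sets paths" for k
    unfolding T_def shift_image using measurable_sets[OF shift_measurable W, of "- int k"] by (simp add: space_PiM)
  have R0: "R \<ge> 0" using \<epsilon> N by (simp add: R_def)
  \<comment> \<open>The images are disjoint up to null sets, so their traces on one strip have total
    measure at most that of the strip.\<close>
  have "(\<Sum>k<n. emeasure \<mu> (T k \<inter> strip R)) = (\<integral>\<^sup>+w. (\<Sum>k<n. indicator (T k \<inter> strip R) w) \<partial>\<mu>)"
    by (subst nn_integral_sum) auto
  also have "\<dots> \<le> (\<integral>\<^sup>+w. indicator (strip R) w \<partial>\<mu>)"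
  proof (rule nn_integral_mono_AE)
    have "AE w in \<mu>. w \<notin> T i \<inter> T j" if "i \<noteq> j" for i j
      using disj[of "int i" "int j"] that T by (intro AE_not_in) (auto simp: null_sets_def T_def)
    then have "AE w in \<mu>. \<forall>i j. i \<noteq> j \<longrightarrow> w \<notin> T i \<inter> T j" by (auto simp: AE_all_countable)
    then show "AE w in \<mu>. (\<Sum>k<n. indicator (T k \<inter> strip R) w) \<le> (indicator (strip R) w :: ennreal)"
    proof eventually_elim
      case (elim w)
      show ?case
      proof (cases "\<exists>k<n. w \<in> T k \<inter> strip R")
        case True
        then obtain k where k: "k < n" "w \<in> T k" "w \<in> strip R" by auto
        have "(\<Sum>i<n. indicator (T i \<inter> strip R) w) = (\<Sum>i\<in>{k}. indicator (T i \<inter> strip R) w :: ennreal)"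
          using k elim by (intro sum.mono_neutral_right) (auto simp: indicator_def)
        then show ?thesis using k by simp
      next
        case False
        then have "(\<Sum>i<n. indicator (T i \<inter> strip R) w) = (0::ennreal)" by (intro sum.neutral) (auto simp: indicator_def)
        then show ?thesis by simp
      qed
    qed
  qed
  also have "\<dots> = ennreal (2 * R)" using R0 by (simp add: emeasure_strip)
  finally have sum_le: "(\<Sum>k<n. emeasure \<mu> (T k \<inter> strip R)) \<le> ennreal (2 * R)" .
  \<comment> \<open>Chebyshev bound for a drift beyond \<open>\<epsilon> * n\<close>, uniform in
    \<open>k < n\<close>.\<close>
  define q where "q = real n powr (2 * H') / (\<epsilon> * real n)\<^sup>2"
  \<comment> \<open>\<open>W\<close> is covered by the paths that are in \<open>strip R\<close>
    after \<open>k\<close> steps and those that drift too far. By invariance the first part has the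
    measure of \<open>T k \<inter> strip R\<close>.\<close>
  have Wle: "emeasure \<mu> W \<le> emeasure \<mu> (T k \<inter> strip R) + ennreal (2 * N * q)" if k: "k < n" for k
  proof -
    let ?V = "{w. \<bar>w 0\<bar> \<le> N \<and> w (int k) - w 0 \<in> {x. \<epsilon> * real n < \<bar>x\<bar>}}"
    have V: "?V \<in> sets paths" by (rule sets_paths_Collect) measurable
    have S: "shift (int k) -` (T k \<inter> strip R) \<in> sets paths"
      using measurable_sets[OF shift_measurable, of "T k \<inter> strip R" "int k"] by (simp add: space_PiM)
    have "W \<subseteq> shift (int k) -` (T k \<inter> strip R) \<union> ?V"
    proof
      fix w assume w: "w \<in> W"
      have "shift (int k) w \<in> T k" using w by (simp add: T_def)
      moreover have "\<bar>w 0\<bar> \<le> N" using sub w by (auto simp: strip_def)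
      ultimately show "w \<in> shift (int k) -` (T k \<inter> strip R) \<union> ?V"
        by (auto simp: strip_def shift_def R_def)
    qed
    then have "emeasure \<mu> W \<le> emeasure \<mu> (shift (int k) -` (T k \<inter> strip R) \<union> ?V)"
      using S V by (intro emeasure_mono) auto
    also have "\<dots> \<le> emeasure \<mu> (shift (int k) -` (T k \<inter> strip R)) + emeasure \<mu> ?V"
      using S V by (intro emeasure_subadditive) auto
    also have "emeasure \<mu> (shift (int k) -` (T k \<inter> strip R)) = emeasure \<mu> (T k \<inter> strip R)"
      by (rule emeasure_mu_shift) measurable
    also have "emeasure \<mu> ?V = ennreal (2 * N) * ennreal (prob {\<omega>\<in>space P'. \<tau> (of_int (int k)) \<omega> - \<tau> 0 \<omega> \<in> {x. \<epsilon> * real n < \<bar>x\<bar>}})"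
      using N by (subst emeasure_mu_window) (auto simp: emeasure_eq_measure)
    also have "\<dots> \<le> ennreal (2 * N) * ennreal q"
    proof (intro mult_left_mono ennreal_leI)
      have "prob {\<omega>\<in>space P'. \<tau> (of_int (int k)) \<omega> - \<tau> 0 \<omega> \<in> {x. \<epsilon> * real n < \<bar>x\<bar>}} \<le> \<bar>of_int (int k)\<bar> powr (2 * H') / (\<epsilon> * real n)\<^sup>2"
        using \<epsilon> n by (intro increment_tail) auto
      also have "\<dots> \<le> q" unfolding q_def using k H'_pos by (intro divide_right_mono powr_mono2) auto
      finally show "prob {\<omega>\<in>space P'. \<tau> (of_int (int k)) \<omega> - \<tau> 0 \<omega> \<in> {x. \<epsilon> * real n < \<bar>x\<bar>}} \<le> q" .
    qed simp
    also have "ennreal (2 * N) * ennreal q = ennreal (2 * N * q)" using N by (simp add: q_def flip: ennreal_mult)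
    finally show ?thesis by (simp add: add_left_mono)
  qed
  have fin: "emeasure \<mu> W < \<infinity>"
  proof -
    have "emeasure \<mu> W \<le> emeasure \<mu> (strip N)" using sub by (intro emeasure_mono) auto
    then show ?thesis using N by (auto simp: emeasure_strip intro: le_less_trans)
  qed
  then have eW: "emeasure \<mu> W = ennreal (measure \<mu> W)" by (simp add: emeasure_eq_ennreal_measure less_top)
  have q0: "q \<ge> 0" by (simp add: q_def)
  have "(\<Sum>k<n. emeasure \<mu> W) \<le> (\<Sum>k<n. emeasure \<mu> (T k \<inter> strip R) + ennreal (2 * N * q))"
    using Wle by (intro sum_mono) auto
  also have "\<dots> \<le> ennreal (2 * R) + (\<Sum>k<n. ennreal (2 * N * q))"
    using sum_le by (simp add: sum.distrib add_right_mono)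
  also have "\<dots> = ennreal (2 * R + real n * (2 * N * q))"
    using R0 N q0 by (simp add: ennreal_of_nat_eq_real_of_nat flip: ennreal_mult ennreal_plus)
  also have "(\<Sum>k<n. emeasure \<mu> W) = ennreal (real n * measure \<mu> W)"
    unfolding eW by (simp add: ennreal_of_nat_eq_real_of_nat ennreal_mult)
  finally have "real n * measure \<mu> W \<le> 2 * R + real n * (2 * N * q)"
    using R0 N q0 by (subst (asm) ennreal_le_iff) auto
  then have "measure \<mu> W \<le> (2 * R + real n * (2 * N * q)) / real n"
    using n by (simp add: pos_le_divide_eq mult.commute)
  also have "\<dots> = 2 * \<epsilon> + 2 * N / real n + 2 * N * q" using n by (simp add: R_def field_simps)
  also have "q = real n powr (2 * H' - 2) / \<epsilon>\<^sup>2"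
    using n by (simp add: q_def powr_diff power_mult_distrib powr_numeral field_simps)
  finally show ?thesis by simp
qed

lemma conservative_shift: "conservative_flow \<mu> shift"
  unfolding conservative_flow_def
proof safe
  fix W assume W: "W \<in> sets \<mu>" and pos: "emeasure \<mu> W > 0"
    and disj: "\<forall>n k. n \<noteq> k \<longrightarrow> emeasure \<mu> (shift n ` W \<inter> shift k ` W) = 0"
  have Wm[measurable]: "W \<in> sets paths" using W by simp
  \<comment> \<open>A wandering set may have infinite measure, so the bound is applied to its pieces
    in strips, which are wandering as well.\<close>
  have "emeasure \<mu> (W \<inter> strip (real N)) = 0" for N
  proof -
    have sm: "shift i ` V \<in> sets paths" if "V \<in> sets paths" for i V
      using measurable_sets[OF shift_measurable that, of "-i"] by (simp add: shift_image space_PiM)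
    have d: "emeasure \<mu> (shift i ` (W \<inter> strip (real N)) \<inter> shift j ` (W \<inter> strip (real N))) = 0" if "i \<noteq> j" for i j
    proof -
      have "emeasure \<mu> (shift i ` (W \<inter> strip (real N)) \<inter> shift j ` (W \<inter> strip (real N))) \<le> emeasure \<mu> (shift i ` W \<inter> shift j ` W)"
        using sm[of W] by (intro emeasure_mono) auto
      then show ?thesis using disj that by simp
    qed
    let ?c = "measure \<mu> (W \<inter> strip (real N))"
    have "?c \<le> 2 * \<epsilon>" if \<epsilon>: "\<epsilon> > 0" for \<epsilon>
    proof (rule LIMSEQ_le_const)
      \<comment> \<open>Here \<open>H' < 1\<close> enters. First \<open>n\<close> tends to infinity,
        then \<open>\<epsilon>\<close> to 0.\<close>
      have "((\<lambda>n. real n powr (2 * H' - 2))) \<longlonglongrightarrow> 0"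
        using H'_less_1 by (intro tendsto_neg_powr filterlim_real_sequentially) auto
      then have "(\<lambda>n. 2 * \<epsilon> + 2 * real N / real n + 2 * real N * real n powr (2 * H' - 2) / \<epsilon>\<^sup>2) \<longlonglongrightarrow> 2 * \<epsilon> + 0 + 2 * real N * 0 / \<epsilon>\<^sup>2"
        using \<epsilon> by (intro tendsto_intros lim_const_over_n) auto
      then show "(\<lambda>n. 2 * \<epsilon> + 2 * real N / real n + 2 * real N * real n powr (2 * H' - 2) / \<epsilon>\<^sup>2) \<longlonglongrightarrow> 2 * \<epsilon>" by simp
      show "\<exists>M. \<forall>n\<ge>M. ?c \<le> 2 * \<epsilon> + 2 * real N / real n + 2 * real N * real n powr (2 * H' - 2) / \<epsilon>\<^sup>2"
        using \<epsilon> d by (intro exI[of _ 1] allI impI wandering_bound) auto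
    qed
    then have "?c \<le> 0" using field_le_epsilon[of ?c 0] by (metis add_0 field_sum_of_halves half_gt_zero mult_2)
    moreover have "emeasure \<mu> (W \<inter> strip (real N)) \<le> emeasure \<mu> (strip (real N))" by (intro emeasure_mono) auto
    then have "emeasure \<mu> (W \<inter> strip (real N)) \<noteq> \<top>" by (auto simp: emeasure_strip top_unique)
    ultimately show ?thesis by (simp add: emeasure_eq_ennreal_measure measure_le_0_iff)
  qed
  then have "emeasure \<mu> (\<Union>N. W \<inter> strip (real N)) = 0" by (intro emeasure_UN_eq_0) auto
  also have "(\<Union>N. W \<inter> strip (real N)) = W" using UN_strip by blast
  finally show False using pos by simp
qed

text \<open>A finite invariant \<open>\<nu>\<close> keeps a fixed share of its mass in one strip at
  any two times, while under \<open>\<mu>\<close> the paths that are in the strip at times 0 and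
  \<open>n\<close> have measure of order n^(-H'). Absolute continuity makes the two
  incompatible.\<close>

lemma null_shift: "null_flow \<mu> shift"
  unfolding null_flow_def
proof safe
  fix \<nu> assume sets_nu: "sets \<nu> = sets \<mu>" and fin: "finite_measure \<nu>" and pos: "emeasure \<nu> (space \<nu>) > 0"
    and ac: "absolutely_continuous \<mu> \<nu>" and inv: "\<forall>n. distr \<nu> \<nu> (shift n) = \<nu>"
  interpret N: finite_measure \<nu> by fact
  have [measurable_cong, simp]: "sets \<nu> = sets paths" using sets_nu by simp
  have sp[simp]: "space \<nu> = UNIV" using sets_eq_imp_space_eq[OF sets_nu] by simp
  define V where "V = measure \<nu> UNIV"
  have V: "V > 0" using pos by (simp add: V_def N.emeasure_eq_measure)
  have "(\<lambda>K. measure \<nu> (strip (real K))) \<longlonglongrightarrow> measure \<nu> (\<Union>K. strip (real K))"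
  proof (rule N.finite_Lim_measure_incseq)
    show "range (\<lambda>K. strip (real K)) \<subseteq> sets \<nu>" by auto
    show "incseq (\<lambda>K. strip (real K))" by (auto simp: incseq_def strip_def)
  qed
  \<comment> \<open>Two sets of measure above \<open>2 / 3 * V\<close> inside total mass
    \<open>V\<close> meet in a set of measure above \<open>V / 3\<close>.\<close>
  then have "\<forall>\<^sub>F K in sequentially. 2 / 3 * V < measure \<nu> (strip (real K))"
    using V by (intro order_tendstoD) (auto simp: UN_strip V_def)
  then obtain K where K: "2 / 3 * V < measure \<nu> (strip (real K))" by (auto dest: eventually_happens)
  define E where "E n = strip (real K) \<inter> shift (int n) -` strip (real K)" for n
  have sv: "shift (int n) -` strip (real K) \<in> sets paths" for n
    using measurable_sets[OF shift_measurable strip_sets, of "int n" "real K"] by (simp add: space_PiM)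
  have E[measurable]: "E n \<in> sets paths" for n using sv by (simp add: E_def)
  have big: "V / 3 < measure \<nu> (E n)" for n
  proof -
    have "measure \<nu> (shift (int n) -` strip (real K)) = measure (distr \<nu> \<nu> (shift (int n))) (strip (real K))"
      by (subst measure_distr) auto
    then have "measure \<nu> (shift (int n) -` strip (real K)) = measure \<nu> (strip (real K))" using inv by simp
    moreover have "measure \<nu> (strip (real K) \<union> shift (int n) -` strip (real K)) \<le> V"
      unfolding V_def using sv by (intro N.finite_measure_mono) auto
    moreover have "measure \<nu> (strip (real K) \<union> shift (int n) -` strip (real K)) + measure \<nu> (E n) =
      measure \<nu> (strip (real K)) + measure \<nu> (shift (int n) -` strip (real K))"
      unfolding E_def using sv N.finite_measure_Union'[of "strip (real K)" "shift (int n) -` strip (real K)"]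
        N.finite_measure_Diff'[of "shift (int n) -` strip (real K)" "strip (real K)"] by (simp add: Int_commute)
    ultimately show ?thesis using K by linarith
  qed
  \<comment> \<open>On \<open>E n\<close> both \<open>w 0\<close> and \<open>w n\<close> are bounded
    by \<open>K\<close>, so the increment is at most \<open>2 * K\<close> in absolute value, a
    small-ball event.\<close>
  have small: "emeasure \<mu> (E n) \<le> ennreal (2 * real K * (4 * real K / real n powr H'))" if n: "n > 0" for n
  proof -
    let ?V = "{w. \<bar>w 0\<bar> \<le> real K \<and> w (int n) - w 0 \<in> {-(2 * real K)..2 * real K}}"
    have "?V \<in> sets paths" by (rule sets_paths_Collect) measurable
    then have "emeasure \<mu> (E n) \<le> emeasure \<mu> ?V"
      by (intro emeasure_mono) (auto simp: E_def strip_def shift_def)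
    also have "\<dots> = ennreal (2 * real K) * ennreal (prob {\<omega>\<in>space P'. \<tau> (of_int (int n)) \<omega> - \<tau> 0 \<omega> \<in> {-(2 * real K)..2 * real K}})"
      by (subst emeasure_mu_window) (auto simp: emeasure_eq_measure)
    also have "\<dots> \<le> ennreal (2 * real K) * ennreal (4 * real K / real n powr H')"
      using increment_small_ball[of "real n" "2 * real K"] n by (intro mult_left_mono ennreal_leI) auto
    also have "\<dots> = ennreal (2 * real K * (4 * real K / real n powr H'))" by (intro ennreal_mult[symmetric]) auto
    finally show ?thesis .
  qed
  have lim: "(\<lambda>n. 2 * real K * (4 * real K / real n powr H')) \<longlonglongrightarrow> 0"
  proof -
    have "(\<lambda>n. real n powr (- H')) \<longlonglongrightarrow> 0"
      using H'_pos by (intro tendsto_neg_powr filterlim_real_sequentially) auto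
    from tendsto_mult_left[OF this, of "2 * real K * (4 * real K)"] show ?thesis
      by (simp add: powr_minus divide_inverse mult.assoc)
  qed
  \<comment> \<open>The measures of the \<open>E n\<close> need not be summable, so a subsequence
    with geometric decay is selected for the Borel-Cantelli lemma.\<close>
  have "\<exists>n. n > 0 \<and> emeasure \<mu> (E n) \<le> ennreal ((1 / 2) ^ j)" for j
  proof -
    have "\<forall>\<^sub>F n in sequentially. 2 * real K * (4 * real K / real n powr H') < (1 / 2) ^ j"
      by (intro order_tendstoD(2)[OF lim]) auto
    then have "\<forall>\<^sub>F n in sequentially. n > 0 \<and> 2 * real K * (4 * real K / real n powr H') < (1 / 2) ^ j"
      using eventually_gt_at_top[of 0] by eventually_elim auto
    then obtain n where n: "n > 0" "2 * real K * (4 * real K / real n powr H') < (1 / 2) ^ j"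
      by (auto dest: eventually_happens)
    have "emeasure \<mu> (E n) \<le> ennreal ((1 / 2) ^ j)"
      by (rule order_trans[OF small[OF n(1)]]) (use n(2) in \<open>intro ennreal_leI, simp\<close>)
    with n show ?thesis by blast
  qed
  then obtain r where r: "\<And>j. emeasure \<mu> (E (r j)) \<le> ennreal ((1 / 2) ^ j)" by metis
  have "AE w in \<mu>. \<forall>\<^sub>F j in sequentially. w \<in> space \<mu> - E (r j)"
  proof (rule borel_cantelli_AE1)
    show "emeasure \<mu> (E (r j)) < \<infinity>" for j using le_less_trans[OF r] by simp
    have "measure \<mu> (E (r j)) \<le> (1 / 2) ^ j" for j
      using r[of j] by (simp add: measure_def enn2real_leI)
    then show "summable (\<lambda>j. measure \<mu> (E (r j)))"
      by (intro summable_comparison_test'[OF summable_geometric[of "1 / 2"], of 0]) auto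
  qed simp
  \<comment> \<open>Absolute continuity transports null sets, not convergence of measures. Hence the
    detour: almost every path is eventually outside \<open>E (r j)\<close>, and as
    \<open>\<nu>\<close> is finite, dominated convergence returns to measures.\<close>
  then have AE: "AE w in \<nu>. \<forall>\<^sub>F j in sequentially. w \<in> space \<mu> - E (r j)"
    using absolutely_continuous_AE[OF sets_nu ac] by auto
  have "(\<lambda>j. \<integral>w. indicator (E (r j)) w \<partial>\<nu>) \<longlonglongrightarrow> (\<integral>w. (0::real) \<partial>\<nu>)"
  proof (rule integral_dominated_convergence[where w="\<lambda>_. 1"])
    show "AE w in \<nu>. (\<lambda>j. indicator (E (r j)) w :: real) \<longlonglongrightarrow> 0"
      using AE
    proof eventually_elim
      case (elim w)
      then have "\<forall>\<^sub>F j in sequentially. indicator (E (r j)) w = (0::real)" by eventually_elim simp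
      then show ?case by (rule tendsto_eventually)
    qed
  qed (auto simp: indicator_def)
  then have "(\<lambda>j. measure \<nu> (E (r j))) \<longlonglongrightarrow> 0" by simp
  then have "\<forall>\<^sub>F j in sequentially. measure \<nu> (E (r j)) < V / 3" using V by (intro order_tendstoD) auto
  then obtain j where "measure \<nu> (E (r j)) < V / 3" by (auto dest: eventually_happens)
  with big[of "r j"] show False by simp
qed

text \<open>Otherwise \<open>\<mu>\<close> restricted to \<open>D\<close> would be a nonzero finite
  invariant measure, which nullity forbids.\<close>

lemma invariant_finite_null:
  assumes D[measurable]: "D \<in> sets paths" and inv: "\<And>k w. shift k w \<in> D \<longleftrightarrow> w \<in> D" and fin: "emeasure \<mu> D < \<infinity>"
  shows "emeasure \<mu> D = 0"
proof (rule ccontr)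
  assume nz: "emeasure \<mu> D \<noteq> 0"
  define \<nu> where "\<nu> = density \<mu> (indicator D)"
  have em: "emeasure \<nu> A = emeasure \<mu> (D \<inter> A)" if "A \<in> sets paths" for A
    using that by (simp add: \<nu>_def emeasure_density flip: indicator_inter_arith)
  have [simp, measurable_cong]: "sets \<nu> = sets paths" "space \<nu> = UNIV" by (simp_all add: \<nu>_def)
  have "distr \<nu> \<nu> (shift n) = \<nu>" for n
  proof (rule measure_eqI)
    fix A assume "A \<in> sets (distr \<nu> \<nu> (shift n))"
    then have A[measurable]: "A \<in> sets paths" by simp
    have s: "shift n -` A \<in> sets paths" using measurable_sets[OF shift_measurable A, of n] by (simp add: space_PiM)
    have "emeasure (distr \<nu> \<nu> (shift n)) A = emeasure \<nu> (shift n -` A)" by (subst emeasure_distr) auto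
    also have "\<dots> = emeasure \<mu> (D \<inter> shift n -` A)" using s by (rule em)
    also have "D \<inter> shift n -` A = shift n -` (D \<inter> A)" using inv by auto
    also have "emeasure \<mu> \<dots> = emeasure \<nu> A" by (subst emeasure_mu_shift) (auto simp: em)
    finally show "emeasure (distr \<nu> \<nu> (shift n)) A = emeasure \<nu> A" .
  qed simp
  moreover have "finite_measure \<nu>" using fin by (intro finite_measureI) (simp add: em)
  moreover have "absolutely_continuous \<mu> \<nu>" unfolding \<nu>_def by (rule absolutely_continuousI_density) simp
  moreover have "emeasure \<nu> (space \<nu>) > 0" using nz by (simp add: em zero_less_iff_neq_zero)
  ultimately show False using null_shift unfolding null_flow_def by auto
qed

lemma invariant_strip_null:
  assumes D[measurable]: "D \<in> sets paths" and inv: "\<And>k w. shift k w \<in> D \<longleftrightarrow> w \<in> D" and sub: "D \<subseteq> strip R"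
  shows "emeasure \<mu> D = 0"
proof (rule invariant_finite_null[OF D inv])
  \<comment> \<open>\<open>R\<close> may be negative; the strip is then empty, and the maximum with
    0 makes the formula for its measure applicable.\<close>
  have "emeasure \<mu> D \<le> emeasure \<mu> (strip (max R 0))"
  proof (rule emeasure_mono)
    show "D \<subseteq> strip (max R 0)" using sub by (auto simp: strip_def)
  qed simp
  then show "emeasure \<mu> D < \<infinity>" by (auto simp: emeasure_strip intro: le_less_trans)
qed

text \<open>Paths whose infimum lies in a bounded interval form an invariant set of finite measure.\<close>

lemma one_sided_null:
  assumes \<sigma>: "\<bar>\<sigma>\<bar> = 1"
  shows "AE w in \<mu>. \<exists>n. \<sigma> * w n < 0"
proof -
  define D where "D c = {w::int \<Rightarrow> real. (\<forall>n. 0 \<le> \<sigma> * w n) \<and> (\<exists>n. \<sigma> * w n < c)}" for c :: real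
  have Dm[measurable]: "D c \<in> sets paths" for c
    unfolding D_def by (rule sets_paths_Collect) measurable
  have "emeasure \<mu> (D c) = 0" for c
  proof (rule invariant_finite_null[OF Dm])
    fix k :: int and w :: "int \<Rightarrow> real"
    have all: "(\<forall>n. Q (n + k)) \<longleftrightarrow> (\<forall>n. Q n)" for Q :: "int \<Rightarrow> bool" by (metis diff_add_cancel)
    from all[of "\<lambda>n. 0 \<le> \<sigma> * w n"] all[of "\<lambda>n. \<not> \<sigma> * w n < c"]
    show "shift k w \<in> D c \<longleftrightarrow> w \<in> D c" by (auto simp: D_def shift_def)
  next
    have "emeasure \<mu> (D c) = (\<integral>\<^sup>+\<omega>. \<integral>\<^sup>+x. indicator (D c) (\<lambda>n. \<tau> (of_int n) \<omega> - x) \<partial>lborel \<partial>P')"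
      by (subst nn_integral_mu[symmetric]) auto
    also have "\<dots> \<le> (\<integral>\<^sup>+\<omega>. ennreal (2 * \<bar>c\<bar>) \<partial>P')"
    proof (rule nn_integral_mono)
      fix \<omega>
      show "(\<integral>\<^sup>+x. indicator (D c) (\<lambda>n. \<tau> (of_int n) \<omega> - x) \<partial>lborel) \<le> ennreal (2 * \<bar>c\<bar>)"
      proof (cases "\<exists>x. (\<lambda>n. \<tau> (of_int n) \<omega> - x) \<in> D c")
        case False
        then show ?thesis by simp
      next
        case True
        then obtain y where y: "(\<lambda>n. \<tau> (of_int n) \<omega> - y) \<in> D c" by blast
        \<comment> \<open>Where one path is below \<open>c\<close> the other is nonnegative, and
          conversely. So the two starting points are less than \<open>c\<close> apart, and each
          section of \<open>D c\<close> in the starting point lies in an interval of length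
          \<open>2 * \<bar>c\<bar>\<close>.\<close>
        have "x \<in> {y - \<bar>c\<bar>..y + \<bar>c\<bar>}" if x: "(\<lambda>n. \<tau> (of_int n) \<omega> - x) \<in> D c" for x
        proof -
          obtain i where i: "\<sigma> * (\<tau> (of_int i) \<omega> - x) < c" using x by (auto simp: D_def)
          obtain j where j: "\<sigma> * (\<tau> (of_int j) \<omega> - y) < c" using y by (auto simp: D_def)
          have "0 \<le> \<sigma> * (\<tau> (of_int i) \<omega> - y)" "0 \<le> \<sigma> * (\<tau> (of_int j) \<omega> - x)" using x y by (auto simp: D_def)
          moreover have "\<sigma> = 1 \<or> \<sigma> = -1" using \<sigma> by linarith
          ultimately show ?thesis using i j by auto
        qed
        then have "(\<integral>\<^sup>+x. indicator (D c) (\<lambda>n. \<tau> (of_int n) \<omega> - x) \<partial>lborel) \<le> (\<integral>\<^sup>+x. indicator {y - \<bar>c\<bar>..y + \<bar>c\<bar>} x \<partial>lborel)"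
          by (intro nn_integral_mono) (auto simp: indicator_def)
        also have "\<dots> = ennreal (2 * \<bar>c\<bar>)"
          by (subst nn_integral_indicator) (auto intro!: arg_cong[where f=ennreal])
        finally show ?thesis .
      qed
    qed
    also have "\<dots> < \<infinity>" by (simp add: emeasure_space_1)
    finally show "emeasure \<mu> (D c) < \<infinity>" .
  qed
  then have "D (real c) \<in> null_sets \<mu>" for c :: nat by (simp add: null_sets_def)
  then have "AE w in \<mu>. w \<notin> D (real c)" for c :: nat by (rule AE_not_in)
  then have "AE w in \<mu>. \<forall>c::nat. w \<notin> D (real c)" by (simp add: AE_all_countable)
  then show ?thesis
  proof eventually_elim
    case (elim w)
    \<comment> \<open>A path that stays on one side lies in \<open>D c\<close> as soon as
      \<open>c\<close> exceeds \<open>\<sigma> * w 0\<close>.\<close>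
    obtain c :: nat where "\<sigma> * w 0 < real c" using reals_Archimedean2 by blast
    with elim[rule_format, of c] show ?case by (auto simp: D_def not_le)
  qed
qed

end

section \<open>The kernel and its increments\<close>

definition two_sided_powr :: "real \<Rightarrow> real \<Rightarrow> real \<Rightarrow> real \<Rightarrow> real" where
  "two_sided_powr p a b u = a * pos_part_powr u p + b * neg_part_powr u p"

lemma lfsm_kernel_eq:
  "lfsm_kernel \<alpha> H a b s x = two_sided_powr (H - 1 / \<alpha>) a b (s - x) - two_sided_powr (H - 1 / \<alpha>) a b (- x)"
  by (simp add: lfsm_kernel_def two_sided_powr_def algebra_simps)

lemma two_sided_powr_measurable [measurable]: "two_sided_powr p a b \<in> borel_measurable borel"
  unfolding two_sided_powr_def[abs_def] pos_part_powr_def neg_part_powr_def by measurable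

lemma two_sided_powr_pos: "0 < u \<Longrightarrow> two_sided_powr p a b u = a * u powr p"
  and two_sided_powr_neg: "u < 0 \<Longrightarrow> two_sided_powr p a b u = b * (- u) powr p"
  and two_sided_powr_0: "two_sided_powr p a b 0 = 0"
  by (simp_all add: two_sided_powr_def pos_part_powr_def neg_part_powr_def)

lemma two_sided_powr_scale:
  assumes "0 < c"
  shows "two_sided_powr p a b (c * u) = c powr p * two_sided_powr p a b u"
proof -
  consider "u < 0" | "u = 0" | "0 < u" by linarith
  then show ?thesis
  proof cases
    case 1
    then have "c * u < 0" "- (c * u) = c * (- u)" using assms by (auto simp: mult_pos_neg)
    then show ?thesis using 1 assms by (simp only: two_sided_powr_neg powr_mult) simp
  next
    case 3
    then show ?thesis using assms by (simp add: two_sided_powr_pos powr_mult)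
  qed (simp add: two_sided_powr_0)
qed

text \<open>The normalisation rules out a kernel that vanishes almost everywhere. With exponent 0
  and \<open>a = b\<close>, \<open>two_sided_powr\<close> is constant off 0, so the kernel would
  vanish except at \<open>x = 0\<close> and \<open>x = 1\<close>.\<close>

lemma lfsm_kernel_nondegenerate:
  assumes "Lalpha_norm \<alpha> lborel (lfsm_kernel \<alpha> H a b 1) = 1"
  shows "a \<noteq> 0 \<or> b \<noteq> 0" and "H - 1 / \<alpha> = 0 \<Longrightarrow> a \<noteq> b"
proof -
  have nz: False if "AE x in lborel. lfsm_kernel \<alpha> H a b 1 x = 0"
  proof -
    have "(\<integral>x. \<bar>lfsm_kernel \<alpha> H a b 1 x\<bar> powr \<alpha> \<partial>lborel) = 0"
      by (rule integral_eq_zero_AE) (use that in \<open>eventually_elim, simp\<close>)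
    then show False using assms by (simp add: Lalpha_norm_def)
  qed
  show "a \<noteq> 0 \<or> b \<noteq> 0" using nz by (auto simp: lfsm_kernel_def)
  show "a \<noteq> b" if p: "H - 1 / \<alpha> = 0"
  proof
    assume "a = b"
    then have c: "two_sided_powr (H - 1 / \<alpha>) a b u = a" if "u \<noteq> 0" for u
      unfolding p using that by (cases "0 < u") (auto simp: two_sided_powr_pos two_sided_powr_neg)
    have "AE x in lborel. x \<noteq> (0::real)" "AE x in lborel. x \<noteq> (1::real)"
      by (rule AE_lborel_singleton)+
    then have "AE x in lborel. lfsm_kernel \<alpha> H a b 1 x = 0"
      by eventually_elim (simp add: lfsm_kernel_eq c)
    then show False by (rule nz)
  qed
qed

text \<open>For positive \<open>c\<close> the quantity eventually exceeds \<open>hi\<close> if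
  \<open>p > 0\<close>, and eventually falls below \<open>lo\<close> if \<open>p < 0\<close>; the
  second exit is why \<open>lo\<close> must be positive.\<close>

lemma powr_leaves_window:
  fixes c p lo hi :: real
  assumes "0 \<le> c" "p \<noteq> 0" "0 < lo"
  obtains R where "\<And>u. R \<le> u \<Longrightarrow> 0 < u \<Longrightarrow> \<not> (lo \<le> c * u powr p \<and> c * u powr p \<le> hi)"
proof (cases "c = 0")
  case True
  then show thesis using that[of 0] assms by auto
next
  case False
  with assms have c: "0 < c" by simp
  show thesis
  proof (cases "0 < p")
    case True
    \<comment> \<open>The summand 1 puts \<open>c * y\<close> strictly above \<open>hi\<close> and
      keeps \<open>y\<close> positive even for \<open>hi = 0\<close>.\<close>
    define y where "y = \<bar>hi\<bar> / c + 1"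
    have cy: "c * y = \<bar>hi\<bar> + c" using c by (simp add: y_def field_simps)
    have y: "0 < y" "hi < c * y" unfolding cy using c by (auto simp: y_def intro!: add_nonneg_pos)
    show thesis
    proof (rule that[of "y powr (1 / p)"])
      fix u assume u: "y powr (1 / p) \<le> u" "0 < u"
      have "y = (y powr (1 / p)) powr p" using y True by (simp add: powr_powr)
      also have "\<dots> \<le> u powr p" using u True by (intro powr_mono2) auto
      finally have "c * y \<le> c * u powr p" using c by simp
      then show "\<not> (lo \<le> c * u powr p \<and> c * u powr p \<le> hi)" using y by linarith
    qed
  next
    case False
    with assms have p: "p < 0" by simp
    \<comment> \<open>With the factor 2, \<open>c * y\<close> is half of \<open>lo\<close>.\<close>
    define y where "y = lo / (2 * c)"
    have y: "0 < y" "c * y < lo" using c assms by (auto simp: y_def)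
    show thesis
    proof (rule that[of "y powr (1 / p)"])
      fix u assume u: "y powr (1 / p) \<le> u" "0 < u"
      have "u powr p \<le> (y powr (1 / p)) powr p" using u p y by (intro powr_mono2') auto
      also have "\<dots> = y" using y p by (simp add: powr_powr)
      finally have "c * u powr p \<le> c * y" using c by simp
      then show "\<not> (lo \<le> c * u powr p \<and> c * u powr p \<le> hi)" using y by linarith
    qed
  qed
qed

text \<open>Each half-line is an instance of the previous lemma, and the value 0 at the origin lies
  below \<open>lo\<close>.\<close>

lemma two_sided_powr_window_bounded:
  assumes "0 \<le> a" "0 \<le> b" "p \<noteq> 0" "0 < lo"
  obtains R where "\<And>u. lo \<le> two_sided_powr p a b u \<Longrightarrow> two_sided_powr p a b u \<le> hi \<Longrightarrow> \<bar>u\<bar> \<le> R"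
proof -
  obtain R1 where R1: "\<And>u. R1 \<le> u \<Longrightarrow> 0 < u \<Longrightarrow> \<not> (lo \<le> a * u powr p \<and> a * u powr p \<le> hi)"
    using powr_leaves_window[OF assms(1,3,4)] by blast
  obtain R2 where R2: "\<And>u. R2 \<le> u \<Longrightarrow> 0 < u \<Longrightarrow> \<not> (lo \<le> b * u powr p \<and> b * u powr p \<le> hi)"
    using powr_leaves_window[OF assms(2,3,4)] by blast
  show thesis
  proof (rule that[of "max R1 R2"])
    fix u assume u: "lo \<le> two_sided_powr p a b u" "two_sided_powr p a b u \<le> hi"
    consider "u < 0" | "u = 0" | "0 < u" by linarith
    then show "\<bar>u\<bar> \<le> max R1 R2"
    proof cases
      case 1
      then show ?thesis using R2[of "- u"] u by (cases "R2 \<le> - u") (auto simp: two_sided_powr_neg)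
    next
      case 3
      then show ?thesis using R1[of u] u by (cases "R1 \<le> u") (auto simp: two_sided_powr_pos)
    qed (use u assms in \<open>simp add: two_sided_powr_0\<close>)
  qed
qed

definition increment_kernel :: "real \<Rightarrow> real \<Rightarrow> real \<Rightarrow> int \<Rightarrow> (int \<Rightarrow> real) \<Rightarrow> real" where
  "increment_kernel p a b n w = two_sided_powr p a b (w (n + 1)) - two_sided_powr p a b (w n)"

lemma increment_kernel_measurable [measurable]: "increment_kernel p a b n \<in> borel_measurable paths"
  unfolding increment_kernel_def[abs_def] by measurable

lemma increment_kernel_shift: "increment_kernel p a b n (shift k w) = increment_kernel p a b (n + k) w"
  by (simp add: increment_kernel_def shift_def algebra_simps)

lemma increment_kernel_eq_0_const:
  assumes "\<And>n. increment_kernel p a b n w = 0"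
  shows "two_sided_powr p a b (w n) = two_sided_powr p a b (w 0)"
proof (induction n rule: int_induct[of _ 0])
  case (step1 i)
  then show ?case using assms[of i] by (simp add: increment_kernel_def)
next
  case (step2 i)
  then show ?case using assms[of "i - 1"] by (simp add: increment_kernel_def)
qed simp

section \<open>Full support and scaling of the kernel\<close>

context lebesgue_fbm
begin

text \<open>A path on which all increments of the kernel vanish stays on one side of \<open>0\<close> or at a
  level of the kernel whose level set is bounded; both kinds of paths are negligible.\<close>

lemma increment_kernel_full_support:
  assumes ab: "0 \<le> a" "0 \<le> b" "a \<noteq> 0 \<or> b \<noteq> 0" and p: "p = 0 \<Longrightarrow> a \<noteq> b"
  shows "AE w in \<mu>. \<exists>n. increment_kernel p a b n w \<noteq> 0"
proof -
  define K where "K = two_sided_powr p a b"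
  \<comment> \<open>The windows exhaust the positive levels; each is bounded and bounded away from
    0, so for \<open>p \<noteq> 0\<close> it confines \<open>w 0\<close> to a strip.\<close>
  define L where "L N = {w. (\<forall>n. increment_kernel p a b n w = 0) \<and> 1 / real (Suc N) \<le> K (w 0) \<and> K (w 0) \<le> real (Suc N)}" for N
  have [measurable]: "K \<in> borel_measurable borel" by (simp add: K_def)
  have L: "AE w in \<mu>. w \<notin> L N" if p0: "p \<noteq> 0" for N
  proof -
    have Lm[measurable]: "L N \<in> sets paths" unfolding L_def by (rule sets_paths_Collect) measurable
    obtain R where R: "\<And>u. 1 / real (Suc N) \<le> K u \<Longrightarrow> K u \<le> real (Suc N) \<Longrightarrow> \<bar>u\<bar> \<le> R"
      unfolding K_def using two_sided_powr_window_bounded[OF ab(1,2) p0, of "1 / real (Suc N)" "real (Suc N)"] by auto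
    have "emeasure \<mu> (L N) = 0"
    proof (rule invariant_strip_null[OF Lm])
      show "L N \<subseteq> strip R" using R by (auto simp: L_def strip_def)
      fix k :: int and w :: "int \<Rightarrow> real"
      have "(\<forall>n. increment_kernel p a b n (shift k w) = 0) \<longleftrightarrow> (\<forall>n. increment_kernel p a b n w = 0)"
        unfolding increment_kernel_shift by (metis diff_add_cancel)
      \<comment> \<open>The window condition refers to time 0, yet it is shift-invariant here
        because \<open>K\<close> is constant along such a path.\<close>
      moreover have "K (shift k w 0) = K (w 0)" if "\<forall>n. increment_kernel p a b n w = 0"
        using increment_kernel_eq_0_const[of p a b w k] that by (simp add: shift_def K_def)
      ultimately show "shift k w \<in> L N \<longleftrightarrow> w \<in> L N" by (auto simp: L_def)
    qed
    then show ?thesis by (intro AE_not_in) (simp add: null_sets_def)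
  qed
  have "AE w in \<mu>. \<forall>N. p \<noteq> 0 \<longrightarrow> w \<notin> L N" using L by (simp add: AE_all_countable)
  moreover have "AE w in \<mu>. \<exists>n. 1 * w n < 0" "AE w in \<mu>. \<exists>n. (-1) * w n < 0"
    by (rule one_sided_null; simp)+
  ultimately show ?thesis
  proof eventually_elim
    case (elim w)
    show ?case
    proof (rule ccontr)
      assume "\<not> (\<exists>n. increment_kernel p a b n w \<noteq> 0)"
      then have z: "\<And>n. increment_kernel p a b n w = 0" by auto
      obtain i j where i: "w i < 0" and j: "0 < w j" using elim by auto
      have Ki: "b * (- w i) powr p = K (w 0)" and Kj: "a * w j powr p = K (w 0)"
        using increment_kernel_eq_0_const[OF z, of i] increment_kernel_eq_0_const[OF z, of j] i j
        by (simp_all add: K_def two_sided_powr_pos two_sided_powr_neg)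
      have pi: "(- w i) powr p > 0" and pj: "w j powr p > 0" using i j by auto
      \<comment> \<open>For \<open>p = 0\<close> the two one-sided levels are \<open>b\<close> and
        \<open>a\<close>, which differ.\<close>
      have "p \<noteq> 0" using p Ki Kj i j by auto
      \<comment> \<open>A common level 0 would force both \<open>a\<close> and \<open>b\<close> to
        vanish.\<close>
      have "K (w 0) \<noteq> 0" using Ki Kj pi pj ab by auto
      moreover have "K (w 0) \<ge> 0" unfolding Kj[symmetric] using ab pj by simp
      ultimately have K0: "K (w 0) > 0" by simp
      obtain N1 :: nat where N1: "K (w 0) \<le> real N1" using real_arch_simple by blast
      obtain N2 :: nat where N2: "1 / K (w 0) \<le> real N2" using real_arch_simple by blast
      have "K (w 0) \<le> real (Suc (max N1 N2))" using N1 by linarith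
      moreover have "1 / K (w 0) \<le> real (Suc (max N1 N2))" using N2 by linarith
      then have "1 / real (Suc (max N1 N2)) \<le> K (w 0)" using K0 by (simp add: field_simps)
      ultimately have "w \<in> L (max N1 N2)" using z by (simp add: L_def)
      then show False using elim \<open>p \<noteq> 0\<close> by blast
    qed
  qed
qed

text \<open>Put \<open>l = c powr H'\<close>. In law the time change multiplies the path by
  \<open>l\<close>; substituting \<open>l * x\<close> for \<open>x\<close> then yields a factor
  \<open>l\<close> from Lebesgue measure and \<open>l powr (p * \<alpha>)\<close> from the
  homogeneity of \<open>K\<close>.\<close>

lemma nn_integral_self_similar:
  fixes \<theta> :: "real \<Rightarrow> real" and p a b \<alpha> c :: real
  assumes c: "0 < c"
  defines "K \<equiv> two_sided_powr p a b"
  shows "(\<integral>\<^sup>+\<omega>. \<integral>\<^sup>+x. ennreal (\<bar>\<Sum>t\<in>J. \<theta> t * (K (\<tau> (c * t) \<omega> - x) - K (- x))\<bar> powr \<alpha>) \<partial>lborel \<partial>P') =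
    ennreal ((c powr H') powr (1 + p * \<alpha>)) * (\<integral>\<^sup>+\<omega>. \<integral>\<^sup>+x. ennreal (\<bar>\<Sum>t\<in>J. \<theta> t * (K (\<tau> t \<omega> - x) - K (- x))\<bar> powr \<alpha>) \<partial>lborel \<partial>P')"
proof -
  have [measurable]: "K \<in> borel_measurable borel" by (simp add: K_def)
  define G where "G w = (\<integral>\<^sup>+x. ennreal (\<bar>\<Sum>t\<in>J. \<theta> t * (K (w t - x) - K (- x))\<bar> powr \<alpha>) \<partial>lborel)" for w
  have Gm[measurable]: "G \<in> borel_measurable (PiM UNIV (\<lambda>_. borel))"
    unfolding G_def[abs_def] by measurable
  define l where "l = c powr H'"
  have l: "0 < l" using c by (simp add: l_def)
  have Gs: "G (\<lambda>t. l * w t) = ennreal (l powr (1 + p * \<alpha>)) * G w" for w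
  proof -
    \<comment> \<open>The terms \<open>0 + l * x\<close> have the shape produced by the affine
      substitution below.\<close>
    have e: "(\<Sum>t\<in>J. \<theta> t * (K (l * w t - (0 + l * x)) - K (- (0 + l * x)))) = l powr p * (\<Sum>t\<in>J. \<theta> t * (K (w t - x) - K (- x)))" for x
    proof -
      have "l * w t - (0 + l * x) = l * (w t - x)" "- (0 + l * x) = l * (- x)" for t by (simp_all add: algebra_simps)
      then have "K (l * w t - (0 + l * x)) = l powr p * K (w t - x)" "K (- (0 + l * x)) = l powr p * K (- x)" for t
        unfolding K_def by (simp_all only: two_sided_powr_scale[OF l])
      then show ?thesis by (simp only: sum_distrib_left right_diff_distrib mult.left_commute)
    qed
    have "G (\<lambda>t. l * w t) = ennreal \<bar>l\<bar> * (\<integral>\<^sup>+x. ennreal (\<bar>\<Sum>t\<in>J. \<theta> t * (K (l * w t - (0 + l * x)) - K (- (0 + l * x)))\<bar> powr \<alpha>) \<partial>lborel)"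
      unfolding G_def by (rule nn_integral_real_affine) (use l in auto)
    also have "\<dots> = ennreal \<bar>l\<bar> * (\<integral>\<^sup>+x. ennreal (l powr (p * \<alpha>)) * ennreal (\<bar>\<Sum>t\<in>J. \<theta> t * (K (w t - x) - K (- x))\<bar> powr \<alpha>) \<partial>lborel)"
      unfolding e using l by (simp add: abs_mult powr_mult powr_powr ennreal_mult)
    also have "\<dots> = ennreal \<bar>l\<bar> * (ennreal (l powr (p * \<alpha>)) * G w)"
      unfolding G_def by (subst nn_integral_cmult) auto
    also have "\<dots> = ennreal (l powr (1 + p * \<alpha>)) * G w"
      using l by (simp add: powr_add ennreal_mult mult.assoc)
    finally show ?thesis .
  qed
  have m1[measurable]: "(\<lambda>\<omega> t. \<tau> (c * t) \<omega>) \<in> measurable P' (PiM UNIV (\<lambda>_. borel))"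
    "(\<lambda>\<omega> t. c powr H' * \<tau> t \<omega>) \<in> measurable P' (PiM UNIV (\<lambda>_. borel))"
    "(\<lambda>\<omega> t. \<tau> t \<omega>) \<in> measurable P' (PiM UNIV (\<lambda>_. borel))"
    by (rule measurable_PiM_single'; auto)+
  have "(\<integral>\<^sup>+\<omega>. G (\<lambda>t. \<tau> (c * t) \<omega>) \<partial>P') = (\<integral>\<^sup>+w. G w \<partial>distr P' (PiM UNIV (\<lambda>_. borel)) (\<lambda>\<omega> t. \<tau> (c * t) \<omega>))"
    by (subst nn_integral_distr) auto
  also have "\<dots> = (\<integral>\<^sup>+\<omega>. G (\<lambda>t. c powr H' * \<tau> t \<omega>) \<partial>P')"
    unfolding fbm_self_similar[OF fbm c] by (subst nn_integral_distr) auto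
  also have "\<dots> = (\<integral>\<^sup>+\<omega>. ennreal (l powr (1 + p * \<alpha>)) * G (\<lambda>t. \<tau> t \<omega>) \<partial>P')"
    unfolding l_def[symmetric] Gs ..
  also have "\<dots> = ennreal (l powr (1 + p * \<alpha>)) * (\<integral>\<^sup>+\<omega>. G (\<lambda>t. \<tau> t \<omega>) \<partial>P')"
    by (rule nn_integral_cmult) measurable
  finally show ?thesis unfolding G_def l_def .
qed

end

section \<open>The random-time motion and its increment process\<close>

locale random_time_lfsm = lebesgue_fbm P' H' \<tau> + S: sas_measure \<alpha> P "P' \<Otimes>\<^sub>M lborel" M
  for P' :: "'o measure" and H' \<tau> and \<alpha> :: real and P :: "'w measure"
    and M :: "('o \<times> real) set \<Rightarrow> 'w \<Rightarrow> real" +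
  fixes H a b :: real and X :: "real \<Rightarrow> 'w \<Rightarrow> real"
  assumes H_pos: "0 < H" and a_nonneg: "0 \<le> a" and b_nonneg: "0 \<le> b"
    and normalized: "Lalpha_norm \<alpha> lborel (lfsm_kernel \<alpha> H a b 1) = 1"
    and X: "\<And>t. has_stable_integral \<alpha> P (P' \<Otimes>\<^sub>M lborel) M
               (\<lambda>(\<omega>', x). lfsm_kernel \<alpha> H a b (\<tau> t \<omega>') x) (X t)"
begin

abbreviation K :: "real \<Rightarrow> real" where "K \<equiv> two_sided_powr (H - 1 / \<alpha>) a b"

text \<open>The common term \<open>K (- x)\<close> cancels, and what remains depends on the point
  only through the path \<open>\<tau> - x\<close> started from \<open>x\<close>.\<close>

lemma X_increment:
  "has_stable_integral \<alpha> P (P' \<Otimes>\<^sub>M lborel) M (\<lambda>(\<omega>, x). K (\<tau> t \<omega> - x) - K (\<tau> s \<omega> - x)) (\<lambda>\<omega>. X t \<omega> - X s \<omega>)"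
  using S.stable_integral_lin_comb[OF X X, of 1 t "-1" s] by (simp add: lfsm_kernel_eq case_prod_beta')

lemma nn_integral_pair:
  assumes [measurable]: "F \<in> borel_measurable (P' \<Otimes>\<^sub>M lborel)"
  shows "(\<integral>\<^sup>+z. F z \<partial>(P' \<Otimes>\<^sub>M lborel)) = (\<integral>\<^sup>+\<omega>. \<integral>\<^sup>+x. F (\<omega>, x) \<partial>lborel \<partial>P')"
  by (rule lborel.nn_integral_fst[symmetric]) measurable

lemma self_similar_X: "self_similar P X (H * H')"
  unfolding self_similar_def
proof (intro allI impI)
  fix c :: real assume c: "0 < c"
  have sc: "has_stable_integral \<alpha> P (P' \<Otimes>\<^sub>M lborel) M
      (\<lambda>(\<omega>, x). c powr (H * H') * (K (\<tau> t \<omega> - x) - K (- x))) (\<lambda>\<omega>. c powr (H * H') * X t \<omega>)" for t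
    using S.stable_integral_lin_comb[OF X X, of "c powr (H * H')" t 0 t] by (simp add: lfsm_kernel_eq case_prod_beta')
  have X': "has_stable_integral \<alpha> P (P' \<Otimes>\<^sub>M lborel) M (\<lambda>(\<omega>, x). K (\<tau> (c * t) \<omega> - x) - K (- x)) (X (c * t))" for t
    using X[of "c * t"] by (simp add: lfsm_kernel_eq)
  show "same_fdd P (\<lambda>t. X (c * t)) P (\<lambda>t \<omega>. c powr (H * H') * X t \<omega>)"
  proof (rule same_fdd_stable_integral[OF S.sas_measure_axioms S.sas_measure_axioms X' sc])
    fix J :: "real set" and \<theta> :: "real \<Rightarrow> real"
    let ?g = "\<lambda>z. ennreal (\<bar>\<Sum>t\<in>J. \<theta> t * (K (\<tau> t (fst z) - snd z) - K (- snd z))\<bar> powr \<alpha>)"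
    have gm: "?g \<in> borel_measurable (P' \<Otimes>\<^sub>M lborel)" by measurable
    have "(\<integral>\<^sup>+z. ennreal (\<bar>\<Sum>t\<in>J. \<theta> t * (case z of (\<omega>, x) \<Rightarrow> K (\<tau> (c * t) \<omega> - x) - K (- x))\<bar> powr \<alpha>) \<partial>(P' \<Otimes>\<^sub>M lborel)) =
       (\<integral>\<^sup>+\<omega>. \<integral>\<^sup>+x. ennreal (\<bar>\<Sum>t\<in>J. \<theta> t * (K (\<tau> (c * t) \<omega> - x) - K (- x))\<bar> powr \<alpha>) \<partial>lborel \<partial>P')"
      by (subst nn_integral_pair) (simp_all add: case_prod_beta)
    also have "\<dots> = ennreal ((c powr H') powr (1 + (H - 1 / \<alpha>) * \<alpha>)) * (\<integral>\<^sup>+z. ?g z \<partial>(P' \<Otimes>\<^sub>M lborel))"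
      by (subst nn_integral_self_similar[OF c], subst nn_integral_pair[OF gm]) simp
    \<comment> \<open>The substitution contributes 1 and the homogeneity
      \<open>(H - 1 / \<alpha>) * \<alpha>\<close> to the exponent, in total
      \<open>H * \<alpha>\<close>; this is the origin of the index \<open>H * H'\<close>.\<close>
    also have "(c powr H') powr (1 + (H - 1 / \<alpha>) * \<alpha>) = (c powr (H * H')) powr \<alpha>"
      using S.alpha by (simp add: powr_powr field_simps)
    also have "ennreal ((c powr (H * H')) powr \<alpha>) * (\<integral>\<^sup>+z. ?g z \<partial>(P' \<Otimes>\<^sub>M lborel)) =
       (\<integral>\<^sup>+z. ennreal ((c powr (H * H')) powr \<alpha>) * ?g z \<partial>(P' \<Otimes>\<^sub>M lborel))"
      by (rule nn_integral_cmult[symmetric]) (rule gm)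
    also have "\<dots> = (\<integral>\<^sup>+z. ennreal (\<bar>\<Sum>t\<in>J. \<theta> t * (case z of (\<omega>, x) \<Rightarrow> c powr (H * H') * (K (\<tau> t \<omega> - x) - K (- x)))\<bar> powr \<alpha>) \<partial>(P' \<Otimes>\<^sub>M lborel))"
    proof (intro nn_integral_cong)
      fix z :: "'o \<times> real"
      have "(\<Sum>t\<in>J. \<theta> t * (case z of (\<omega>, x) \<Rightarrow> c powr (H * H') * (K (\<tau> t \<omega> - x) - K (- x)))) =
        c powr (H * H') * (\<Sum>t\<in>J. \<theta> t * (K (\<tau> t (fst z) - snd z) - K (- snd z)))"
        by (simp only: case_prod_beta sum_distrib_left mult.left_commute)
      then show "ennreal ((c powr (H * H')) powr \<alpha>) * ?g z =
        ennreal (\<bar>\<Sum>t\<in>J. \<theta> t * (case z of (\<omega>, x) \<Rightarrow> c powr (H * H') * (K (\<tau> t \<omega> - x) - K (- x)))\<bar> powr \<alpha>)"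
        by (simp only: abs_mult powr_mult abs_of_nonneg[OF powr_ge_zero] ennreal_mult powr_ge_zero)
    qed
    finally show "(\<integral>\<^sup>+z. ennreal (\<bar>\<Sum>t\<in>J. \<theta> t * (case z of (\<omega>, x) \<Rightarrow> K (\<tau> (c * t) \<omega> - x) - K (- x))\<bar> powr \<alpha>) \<partial>(P' \<Otimes>\<^sub>M lborel)) =
      (\<integral>\<^sup>+z. ennreal (\<bar>\<Sum>t\<in>J. \<theta> t * (case z of (\<omega>, x) \<Rightarrow> c powr (H * H') * (K (\<tau> t \<omega> - x) - K (- x)))\<bar> powr \<alpha>) \<partial>(P' \<Otimes>\<^sub>M lborel))" .
  qed
qed

lemma stationary_increments_X: "stationary_increments P X"
  unfolding stationary_increments_def
proof
  fix s
  show "same_fdd P (\<lambda>t \<omega>. X (t + s) \<omega> - X s \<omega>) P (\<lambda>t \<omega>. X t \<omega> - X 0 \<omega>)"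
  proof (rule same_fdd_stable_integral[OF S.sas_measure_axioms S.sas_measure_axioms X_increment X_increment])
    fix J :: "real set" and \<theta> :: "real \<Rightarrow> real"
    \<comment> \<open>The reference point is \<open>w 0\<close>, which turns into
      \<open>\<tau> s - x\<close> under the time shift.\<close>
    define F where "F w = ennreal (\<bar>\<Sum>t\<in>J. \<theta> t * (K (w t) - K (w 0))\<bar> powr \<alpha>)" for w
    have Fm: "F \<in> borel_measurable (PiM UNIV (\<lambda>_. borel))" unfolding F_def[abs_def] by measurable
    have "(\<integral>\<^sup>+z. ennreal (\<bar>\<Sum>t\<in>J. \<theta> t * (case z of (\<omega>, x) \<Rightarrow> K (\<tau> (t + s) \<omega> - x) - K (\<tau> s \<omega> - x))\<bar> powr \<alpha>) \<partial>(P' \<Otimes>\<^sub>M lborel)) =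
      (\<integral>\<^sup>+\<omega>. \<integral>\<^sup>+x. F (\<lambda>t. \<tau> (t + s) \<omega> - x) \<partial>lborel \<partial>P')"
      by (subst nn_integral_pair) (simp_all add: case_prod_beta F_def)
    also have "\<dots> = (\<integral>\<^sup>+\<omega>. \<integral>\<^sup>+x. F (\<lambda>t. \<tau> t \<omega> - x) \<partial>lborel \<partial>P')"
      by (rule nn_integral_increments[OF Fm])
    also have "\<dots> = (\<integral>\<^sup>+z. ennreal (\<bar>\<Sum>t\<in>J. \<theta> t * (case z of (\<omega>, x) \<Rightarrow> K (\<tau> t \<omega> - x) - K (\<tau> 0 \<omega> - x))\<bar> powr \<alpha>) \<partial>(P' \<Otimes>\<^sub>M lborel))"
      by (subst nn_integral_pair) (simp_all add: case_prod_beta F_def)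
    finally show "(\<integral>\<^sup>+z. ennreal (\<bar>\<Sum>t\<in>J. \<theta> t * (case z of (\<omega>, x) \<Rightarrow> K (\<tau> (t + s) \<omega> - x) - K (\<tau> s \<omega> - x))\<bar> powr \<alpha>) \<partial>(P' \<Otimes>\<^sub>M lborel)) =
      (\<integral>\<^sup>+z. ennreal (\<bar>\<Sum>t\<in>J. \<theta> t * (case z of (\<omega>, x) \<Rightarrow> K (\<tau> t \<omega> - x) - K (\<tau> 0 \<omega> - x))\<bar> powr \<alpha>) \<partial>(P' \<Otimes>\<^sub>M lborel))" .
  qed
qed

abbreviation Y :: "int \<Rightarrow> 'w \<Rightarrow> real" where
  "Y \<equiv> \<lambda>n \<omega>. X (of_int (n + 1)) \<omega> - X (of_int n) \<omega>"

abbreviation f :: "int \<Rightarrow> (int \<Rightarrow> real) \<Rightarrow> real" where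
  "f \<equiv> increment_kernel (H - 1 / \<alpha>) a b"

abbreviation M_paths :: "(int \<Rightarrow> real) set \<Rightarrow> 'w \<Rightarrow> real" where
  "M_paths \<equiv> \<lambda>A. M (traj -` A \<inter> space (P' \<Otimes>\<^sub>M lborel))"

lemma sas_measure_paths: "sas_measure \<alpha> P \<mu> M_paths"
  unfolding \<mu>_def by (rule S.sas_measure_distr) measurable

lemma Y_stable_integral: "has_stable_integral \<alpha> P \<mu> M_paths (f n) (Y n)"
  unfolding \<mu>_def
proof (rule S.has_stable_integral_distr)
  have "(\<lambda>z. f n (traj z)) = (\<lambda>(\<omega>, x). K (\<tau> (of_int (n + 1)) \<omega> - x) - K (\<tau> (of_int n) \<omega> - x))"
    by (auto simp: increment_kernel_def traj_def)
  then show "has_stable_integral \<alpha> P (P' \<Otimes>\<^sub>M lborel) M (\<lambda>z. f n (traj z)) (Y n)"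
    using X_increment[of "of_int (n + 1)" "of_int n"] by simp
qed measurable

lemma sas_process_Y: "sas_process \<alpha> P Y"
  by (rule sas_measure.stable_integral_sas_process[OF sas_measure_paths]) (rule Y_stable_integral)

lemma stationary_Y: "stationary_process P Y"
proof -
  have "stochastic_process P Y" using sas_process_Y by (simp only: sas_process_def)
  moreover have "same_fdd P (\<lambda>n. Y (n + k)) P Y" for k
  proof (rule same_fdd_stable_integral[OF sas_measure_paths sas_measure_paths Y_stable_integral Y_stable_integral])
    fix J :: "int set" and \<theta> :: "int \<Rightarrow> real"
    have "(\<integral>\<^sup>+w. ennreal (\<bar>\<Sum>n\<in>J. \<theta> n * f n (shift k w)\<bar> powr \<alpha>) \<partial>\<mu>) = (\<integral>\<^sup>+w. ennreal (\<bar>\<Sum>n\<in>J. \<theta> n * f n w\<bar> powr \<alpha>) \<partial>\<mu>)"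
      by (rule nn_integral_mu_shift[where F="\<lambda>w. ennreal (\<bar>\<Sum>n\<in>J. \<theta> n * f n w\<bar> powr \<alpha>)"]) measurable
    then show "(\<integral>\<^sup>+w. ennreal (\<bar>\<Sum>n\<in>J. \<theta> n * f (n + k) w\<bar> powr \<alpha>) \<partial>\<mu>) = (\<integral>\<^sup>+w. ennreal (\<bar>\<Sum>n\<in>J. \<theta> n * f n w\<bar> powr \<alpha>) \<partial>\<mu>)"
      by (simp only: increment_kernel_shift)
  qed
  ultimately show ?thesis by (simp add: stationary_process_def)
qed

lemma Y_generated_by_shift: "generated_by_flow \<alpha> P Y \<mu> shift"
  unfolding generated_by_flow_def
proof (intro conjI sigma_finite_mu standard_borel_mu nonsingular_flow_shift exI allI)
  interpret D: sas_measure \<alpha> P \<mu> M_paths by (rule sas_measure_paths)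
  show "sign_cocycle \<mu> shift (\<lambda>_ _. 1)" by (simp add: sign_cocycle_def)
  have "same_fdd P Y P Y" by (simp add: same_fdd_def)
  \<comment> \<open>\<open>Y\<close> represents itself, since the image random measure lives on the
    original space \<open>P\<close>.\<close>
  then have "\<exists>(Q :: 'w measure) M Z. sas_random_measure \<alpha> Q \<mu> M \<and> (\<forall>n. has_stable_integral \<alpha> Q \<mu> M (f n) (Z n)) \<and> same_fdd P Y Q Z"
    by (intro exI[of _ P] exI[of _ M_paths] exI[of _ Y] conjI allI D.random_measure Y_stable_integral)
  moreover have "f n \<in> Lalpha \<alpha> \<mu>" for n using Y_stable_integral[of n] by (simp add: has_stable_integral_def)
  ultimately show "sas_representation \<alpha> P Y \<mu> f"
    using sigma_finite_mu by (simp add: sas_representation_def)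
  show "AE w in \<mu>. f n w = 1 * flow_derivative \<mu> shift n w powr (1 / \<alpha>) * f 0 (shift n w)" for n
    using flow_derivative_shift[of n] by eventually_elim (simp add: increment_kernel_shift)
  show "AE w in \<mu>. \<exists>n. f n w \<noteq> 0"
    using lfsm_kernel_nondegenerate[OF normalized] a_nonneg b_nonneg by (intro increment_kernel_full_support) auto
qed

lemma null_conservative_X: "null_conservative_fsm \<alpha> P X"
proof -
  have "null_conservative_process \<alpha> P Y"
    unfolding null_conservative_process_def
    using sas_process_Y stationary_Y Y_generated_by_shift conservative_shift null_shift by blast
  moreover have "sas_process \<alpha> P X"
    by (rule S.stable_integral_sas_process) (rule X)
  moreover have "H * H' > 0" using H_pos H'_pos by simp
  ultimately show ?thesis
    unfolding null_conservative_fsm_def fractional_stable_motion_def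
    using self_similar_X stationary_increments_X by blast
qed

end

theorem proposition4p5:
  fixes \<alpha> H H' a b :: real
    and P' :: "'o measure" and \<tau> :: "real \<Rightarrow> 'o \<Rightarrow> real"
    and P :: "'w measure" and M :: "('o \<times> real) set \<Rightarrow> 'w \<Rightarrow> real"
    and X :: "real \<Rightarrow> 'w \<Rightarrow> real"
  assumes "0 < \<alpha>" and "\<alpha> < 2" and "0 < H" and "0 < H'" and "H' < 1"
    and "prob_space P'" and "fractional_brownian_motion P' H' \<tau>"
    and "0 \<le> a" and "0 \<le> b" and "Lalpha_norm \<alpha> lborel (lfsm_kernel \<alpha> H a b 1) = 1"
    and "sas_random_measure \<alpha> P (P' \<Otimes>\<^sub>M lborel) M"
    and "\<And>t. has_stable_integral \<alpha> P (P' \<Otimes>\<^sub>M lborel) M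
               (\<lambda>(\<omega>', x). lfsm_kernel \<alpha> H a b (\<tau> t \<omega>') x) (X t)"
  shows "null_conservative_fsm \<alpha> P X"
proof -
  interpret prob_space P' by fact
  interpret random_time_lfsm P' H' \<tau> \<alpha> P M H a b X
    by unfold_locales (use assms in auto)
  show ?thesis by (rule null_conservative_X)
qed

end
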